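(* Let $d=2$, and let $\mathbf{a}_1=(c_1,d_1)$, $\mathbf{a}_2=(c_2,d_2)$ be the extremal rays of $S\subseteq\mathbb{N}^2$. The ring $R=\mathbb{K}[S]$ is Cohen-Macaulay if and only if $$|\mathrm{Ap}(S,E)|+|P_S\setminus\mathrm{Gr}(S)|=|c_1d_2-c_2d_1|.$$
   Context: Let $\mathbb{N}$ be the set of non-negative integers and let $S\subseteq\mathbb{N}^2$ be an affine (finitely generated) semigroup containing $\mathbf 0$ of dimension $2$ (i.e. $S$ spans $\mathbb{R}^2$). Its minimal generating set is $\{\mathbf{a}_1,\dots,\mathbf{a}_{s+2}\}$ with $\mathbf{a}_i=(c_i,d_i)$, where $\mathbf{a}_1,\mathbf{a}_2$ are the extremal rays of $S$, i.e. the smallest nonzero elements of $S$ on each of the two extremal rays of the cone generated by $S$ in $\mathbb{R}^2$. Put $E=\{\mathbf{a}_1,\mathbf{a}_2\}$ and $\mathrm{Ap}(S,E)=\{\mathbf{a}\in S : \mathbf{a}-\mathbf{a}_1\notin S,\ \mathbf{a}-\mathbf{a}_2\notin S\}$. Let $\mathrm{Gr}(S)=\{\mathbf{a}-\mathbf{b} : \mathbf{a},\mathbf{b}\in S\}\subseteq\mathbb{Z}^2$ be the group of differences of $S$, and let $P_S=\{\mathbf{z}\in\mathbb{N}^2 : \mathbf{z}=\lambda_1\mathbf{a}_1+\lambda_2\mathbf{a}_2 \text{ with } 0\leq\lambda_1,\lambda_2<1\}$. Let $\mathbb{K}$ be a field; $\mathbb{K}[S]$ is the $\mathbb{K}$-subalgebra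 of $\mathbb{K}[x_1,x_2]$ generated by the monomials with exponents in $S$. *)

theory Defs
  imports
    "HOL-Analysis.Polytope"
    "HOL-Library.Extended_Nat"
    "HOL-Library.Poly_Mapping"
    "HOL-Algebra.Algebra"
    "HOL-Algebra.Algebraic_Closure_Type"
begin

section \<open>Cohen--Macaulay rings\<close>

text \<open>The localization of \<open>R\<close> at a multiplicative set \<open>W\<close>: fractions \<open>a/s\<close> are the classes of
  pairs \<open>(a, s)\<close>, where \<open>a/s = b/t\<close> iff \<open>u (a t - b s) = 0\<close> for some \<open>u \<in> W\<close>. The unions in the ring
  operations only select representatives: all members of the family coincide.\<close>

definition fraction_rel :: "('a, 'm) ring_scheme \<Rightarrow> 'a set \<Rightarrow> (('a \<times> 'a) \<times> ('a \<times> 'a)) set" where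
  "fraction_rel R W =
     {((a, s), (b, t)). a \<in> carrier R \<and> s \<in> W \<and> b \<in> carrier R \<and> t \<in> W \<and>
        (\<exists>u\<in>W. u \<otimes>\<^bsub>R\<^esub> ((a \<otimes>\<^bsub>R\<^esub> t) \<ominus>\<^bsub>R\<^esub> (b \<otimes>\<^bsub>R\<^esub> s)) = \<zero>\<^bsub>R\<^esub>)}"

definition fraction :: "('a, 'm) ring_scheme \<Rightarrow> 'a set \<Rightarrow> 'a \<Rightarrow> 'a \<Rightarrow> ('a \<times> 'a) set" where
  "fraction R W a s = fraction_rel R W `` {(a, s)}"

definition localization :: "('a, 'm) ring_scheme \<Rightarrow> 'a set \<Rightarrow> ('a \<times> 'a) set ring" where
  "localization R W =
     \<lparr> carrier = (carrier R \<times> W) // fraction_rel R W,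
       monoid.mult = (\<lambda>A B. \<Union>(a, s)\<in>A. \<Union>(b, t)\<in>B. fraction R W (a \<otimes>\<^bsub>R\<^esub> b) (s \<otimes>\<^bsub>R\<^esub> t)),
       one = fraction R W \<one>\<^bsub>R\<^esub> \<one>\<^bsub>R\<^esub>,
       ring.zero = fraction R W \<zero>\<^bsub>R\<^esub> \<one>\<^bsub>R\<^esub>,
       add = (\<lambda>A B. \<Union>(a, s)\<in>A. \<Union>(b, t)\<in>B.
                fraction R W ((a \<otimes>\<^bsub>R\<^esub> t) \<oplus>\<^bsub>R\<^esub> (b \<otimes>\<^bsub>R\<^esub> s)) (s \<otimes>\<^bsub>R\<^esub> t)) \<rparr>"

definition localization_at :: "('a, 'm) ring_scheme \<Rightarrow> 'a set \<Rightarrow> ('a \<times> 'a) set ring" where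
  "localization_at R P = localization R (carrier R - P)"

definition krull_dim :: "('a, 'm) ring_scheme \<Rightarrow> enat" where
  "krull_dim R =
     Sup {enat n | n. \<exists>p :: nat \<Rightarrow> 'a set.
            (\<forall>i\<le>n. primeideal (p i) R) \<and> (\<forall>i<n. p i \<subset> p (Suc i))}"

definition regular_sequence :: "('a, 'm) ring_scheme \<Rightarrow> 'a list \<Rightarrow> bool" where
  "regular_sequence R xs \<longleftrightarrow>
     set xs \<subseteq> carrier R \<and>
     (\<forall>i<length xs. \<forall>r\<in>carrier R.
        xs ! i \<otimes>\<^bsub>R\<^esub> r \<in> Idl\<^bsub>R\<^esub> (set (take i xs)) \<longrightarrow> r \<in> Idl\<^bsub>R\<^esub> (set (take i xs))) \<and>
     Idl\<^bsub>R\<^esub> (set xs) \<noteq> carrier R"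

text \<open>The depth of a Noetherian local ring; \<open>THE\<close> picks out its unique maximal ideal.\<close>

definition local_depth :: "('a, 'm) ring_scheme \<Rightarrow> enat" where
  "local_depth R =
     Sup {enat (length xs) | xs. regular_sequence R xs \<and> set xs \<subseteq> (THE M. maximalideal M R)}"

definition cohen_macaulay :: "('a, 'm) ring_scheme \<Rightarrow> bool" where
  "cohen_macaulay R \<longleftrightarrow>
     cring R \<and> noetherian_ring R \<and>
     (\<forall>M. maximalideal M R \<longrightarrow>
        local_depth (localization_at R M) = krull_dim (localization_at R M))"


section \<open>Affine semigroups in the plane and their semigroup rings\<close>

inductive_set generated_monoid :: "'a::monoid_add set \<Rightarrow> 'a set" for A where
  zero: "0 \<in> generated_monoid A"
| incl: "a \<in> A \<Longrightarrow> a \<in> generated_monoid A"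
| plus: "a \<in> generated_monoid A \<Longrightarrow> b \<in> generated_monoid A \<Longrightarrow> a + b \<in> generated_monoid A"

definition affine_semigroup :: "(nat \<times> nat) set \<Rightarrow> bool" where
  "affine_semigroup S \<longleftrightarrow> (\<exists>A. finite A \<and> S = generated_monoid A)"

definition real_vec :: "nat \<times> nat \<Rightarrow> real \<times> real" where
  "real_vec a = (real (fst a), real (snd a))"

definition int_vec :: "nat \<times> nat \<Rightarrow> int \<times> int" where
  "int_vec a = (int (fst a), int (snd a))"

definition semigroup_cone :: "(nat \<times> nat) set \<Rightarrow> (real \<times> real) set" where
  "semigroup_cone S = convex_cone hull (real_vec ` S)"

text \<open>The half-line spanned by \<open>a\<close> is an extremal ray (one-dimensional face) of the cone of \<open>S\<close>, and
  \<open>a\<close> is the smallest nonzero element of \<open>S\<close> on it.\<close>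

definition extremal_ray :: "(nat \<times> nat) set \<Rightarrow> nat \<times> nat \<Rightarrow> bool" where
  "extremal_ray S a \<longleftrightarrow>
     a \<in> S \<and> a \<noteq> 0 \<and>
     (conic hull {real_vec a}) face_of semigroup_cone S \<and>
     (\<forall>b\<in>S. b \<noteq> 0 \<and> real_vec b \<in> conic hull {real_vec a} \<longrightarrow> fst a \<le> fst b \<and> snd a \<le> snd b)"

text \<open>Differences are taken in \<open>\<int>\<^sup>2\<close>, since subtraction on \<^typ>\<open>nat\<close> truncates.\<close>

definition apery_set :: "(nat \<times> nat) set \<Rightarrow> (nat \<times> nat) set \<Rightarrow> (nat \<times> nat) set" where
  "apery_set S E = {a \<in> S. \<forall>e\<in>E. int_vec a - int_vec e \<notin> int_vec ` S}"

definition difference_group :: "(nat \<times> nat) set \<Rightarrow> (int \<times> int) set" where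
  "difference_group S = {int_vec a - int_vec b | a b. a \<in> S \<and> b \<in> S}"

definition half_open_parallelogram :: "nat \<times> nat \<Rightarrow> nat \<times> nat \<Rightarrow> (nat \<times> nat) set" where
  "half_open_parallelogram a b =
     {z. \<exists>l m :: real. 0 \<le> l \<and> l < 1 \<and> 0 \<le> m \<and> m < 1 \<and>
           real_vec z = l *\<^sub>R real_vec a + m *\<^sub>R real_vec b}"

text \<open>\<open>(nat \<times> nat) \<Rightarrow>\<^sub>0 'k\<close> is the polynomial ring \<open>K[x\<^sub>1, x\<^sub>2]\<close>: a polynomial is its finitely
  supported family of coefficients, indexed by exponent vectors. The \<open>K\<close>-subalgebra generated by a
  set is the subring generated by that set together with the constants.\<close>

definition semigroup_ring :: "(nat \<times> nat) set \<Rightarrow> ((nat \<times> nat) \<Rightarrow>\<^sub>0 'k::field) ring" where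
  "semigroup_ring S =
     ring_of_type_algebra
       \<lparr> carrier := generate_ring ring_of_type_algebra
           (range (\<lambda>c. Poly_Mapping.single 0 c) \<union> (\<lambda>a. Poly_Mapping.single a 1) ` S) \<rparr>"

end

theory Submission
  imports Defs "HOL-Library.Product_Lexorder"
begin

text \<open>
  Write \<open>a\<close>, \<open>b\<close> for the two extremal generators, \<open>\<Lambda> = \<int>a + \<int>b\<close> and \<open>A = K[x\<^sup>a, x\<^sup>b]\<close>. Both sides of the
  equivalence are compared with one condition on the semigroup:
  a point \<open>z\<close> of the plane lattice with \<open>z + a \<in> S\<close> and \<open>z + b \<in> S\<close> already lies in \<open>S\<close>
  (\<open>depth_condition\<close>).

  \<^emph>\<open>Counting.\<close> The half-open parallelogram contains exactly one point of each coset of \<open>\<Lambda>\<close>, hence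
  \<open>\<bar>det (a, b)\<bar>\<close> lattice points in all, and the ones in \<open>Gr(S)\<close> represent \<open>Gr(S)/\<Lambda>\<close>. Reduction modulo \<open>\<Lambda>\<close>
  maps the Apery set onto them, so the numerical identity says that this map is injective. Two
  elements of the Apery set in one coset are exactly what a violation of the condition produces
  (\<open>count_iff_depth_condition\<close>).

  \<^emph>\<open>From the condition to Cohen--Macaulay.\<close> Let \<open>M\<close> be a maximal ideal of \<open>R = K[S]\<close>. The ring \<open>R\<close> is a finite
  \<open>A\<close>-module, and this gives a Nullstellensatz: \<open>M\<close> contains \<open>f(x\<^sup>a)\<close> and \<open>g(x\<^sup>b)\<close> for some nonzero
  polynomials \<open>f\<close>, \<open>g\<close> in one variable over \<open>K\<close> (\<open>maximalideal_contains_poly_in_a\<close>). Under the condition,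
  the order of divisibility by \<open>x\<^sup>a\<close> is unchanged by multiplication with \<open>x\<^sup>b\<close>, and division with
  remainder by \<open>f(x\<^sup>a)\<close> shows that \<open>f(x\<^sup>a), g(x\<^sup>b)\<close> is a regular sequence
  (\<open>at_a_at_b_regular\<close>). So the depth of \<open>R\<^sub>M\<close> is at least 2. Depth never exceeds
  dimension, and the dimension is at most 2 because any three elements of \<open>K[x, y]\<close> are
  algebraically dependent, which excludes a chain of four primes.

  \<^emph>\<open>From Cohen--Macaulay to the condition.\<close> If the condition fails, there is an exponent \<open>f \<notin> S\<close> with
  \<open>f + s \<in> S\<close> for all nonzero \<open>s \<in> S\<close> (\<open>exists_socle_element\<close>). Localize at the maximal ideal \<open>m\<close>
  spanned by the nonconstant monomials. For \<open>y\<^sub>1, y\<^sub>2 \<in> m R\<^sub>m\<close> both \<open>y\<^sub>1 x\<^sup>f\<close> and \<open>y\<^sub>2 x\<^sup>f\<close> belong to \<open>R\<^sub>m\<close>, and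
  \<open>y\<^sub>2 (y\<^sub>1 x\<^sup>f) = (y\<^sub>2 x\<^sup>f) y\<^sub>1\<close>; if \<open>y\<^sub>1, y\<^sub>2\<close> were regular, \<open>x\<^sup>f\<close> would lie in \<open>R\<^sub>m\<close>, which it does not. So
  the depth is at most 1, whereas the dimension of \<open>R\<^sub>m\<close> is at least 2.
\<close>

section \<open>Localization at a multiplicative set\<close>

locale multiplicative_set = cring R for R (structure) +
  fixes W :: "'a set"
  assumes W_sub: "W \<subseteq> carrier R" and one_W: "\<one> \<in> W"
    and mult_W: "\<lbrakk>s \<in> W; t \<in> W\<rbrakk> \<Longrightarrow> s \<otimes> t \<in> W"
begin

abbreviation L where "L \<equiv> localization R W"
abbreviation frac where "frac \<equiv> fraction R W"

lemma W_carrier [simp, intro]: "s \<in> W \<Longrightarrow> s \<in> carrier R"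
  using W_sub by blast

lemmas W_closed [simp, intro] = one_W mult_W

lemma fraction_rel_iff:
  "((a, s), (b, t)) \<in> fraction_rel R W \<longleftrightarrow> a \<in> carrier R \<and> s \<in> W \<and> b \<in> carrier R \<and> t \<in> W \<and>
     (\<exists>u\<in>W. u \<otimes> (a \<otimes> t) = u \<otimes> (b \<otimes> s))"
proof -
  have "u \<otimes> (a \<otimes> t \<ominus> b \<otimes> s) = \<zero> \<longleftrightarrow> u \<otimes> (a \<otimes> t) = u \<otimes> (b \<otimes> s)"
    if "a \<in> carrier R" "s \<in> W" "b \<in> carrier R" "t \<in> W" "u \<in> W" for u
  proof -
    have "u \<otimes> (a \<otimes> t \<ominus> b \<otimes> s) = u \<otimes> (a \<otimes> t) \<ominus> u \<otimes> (b \<otimes> s)"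
      using that by (simp add: a_minus_def r_distr r_minus)
    then show ?thesis using that by simp
  qed
  then show ?thesis by (auto simp: fraction_rel_def)
qed

text \<open>Transitivity needs the witness \<open>u\<close> in the definition of equality of fractions: two
  witnesses and the middle denominator multiply to a witness for the composite.\<close>

lemma equiv_fraction_rel: "equiv (carrier R \<times> W) (fraction_rel R W)"
proof (rule equivI)
  show "fraction_rel R W \<subseteq> (carrier R \<times> W) \<times> (carrier R \<times> W)"
    by (auto simp: fraction_rel_def)
  show "refl_on (carrier R \<times> W) (fraction_rel R W)"
    by (rule refl_onI) (auto simp: fraction_rel_iff)
  show "sym (fraction_rel R W)"
    by (rule symI) (clarsimp simp: fraction_rel_iff, metis)
  show "trans (fraction_rel R W)"
  proof (rule transI, clarsimp simp: fraction_rel_iff)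
    fix a s b t c q u v
    assume c: "a \<in> carrier R" "s \<in> W" "b \<in> carrier R" "t \<in> W" "c \<in> carrier R" "q \<in> W"
      "u \<in> W" "v \<in> W"
      and u: "u \<otimes> (a \<otimes> t) = u \<otimes> (b \<otimes> s)" and v: "v \<otimes> (b \<otimes> q) = v \<otimes> (c \<otimes> t)"
    have "(u \<otimes> v \<otimes> t) \<otimes> (a \<otimes> q) = v \<otimes> q \<otimes> (u \<otimes> (a \<otimes> t))"
      using c by (simp add: m_ac)
    also have "\<dots> = u \<otimes> s \<otimes> (v \<otimes> (b \<otimes> q))"
      unfolding u using c by (simp add: m_ac)
    also have "\<dots> = (u \<otimes> v \<otimes> t) \<otimes> (c \<otimes> s)"
      unfolding v using c by (simp add: m_ac)
    finally show "\<exists>w\<in>W. w \<otimes> (a \<otimes> q) = w \<otimes> (c \<otimes> s)"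
      using c by blast
  qed
qed

lemma frac_eq_iff:
  assumes "a \<in> carrier R" "s \<in> W" "b \<in> carrier R" "t \<in> W"
  shows "frac a s = frac b t \<longleftrightarrow> (\<exists>u\<in>W. u \<otimes> (a \<otimes> t) = u \<otimes> (b \<otimes> s))"
  using eq_equiv_class_iff[OF equiv_fraction_rel, of "(a, s)" "(b, t)"] assms
  by (auto simp: fraction_def fraction_rel_iff)

lemma frac_eqI:
  assumes "a \<in> carrier R" "s \<in> W" "b \<in> carrier R" "t \<in> W" "a \<otimes> t = b \<otimes> s"
  shows "frac a s = frac b t"
  using assms frac_eq_iff[of a s b t] one_W by force

lemma frac_closed [simp, intro]: "\<lbrakk>a \<in> carrier R; s \<in> W\<rbrakk> \<Longrightarrow> frac a s \<in> carrier L"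
  by (auto simp: localization_def fraction_def intro!: quotientI)

lemma carrier_localizationE:
  assumes "x \<in> carrier L"
  obtains a s where "a \<in> carrier R" "s \<in> W" "x = frac a s"
  using assms by (auto simp: localization_def fraction_def elim!: quotientE)

text \<open>The union over representatives in the definition of the operations collapses because the
  summand is constant on equivalence classes.\<close>

lemma mult_frac [simp]:
  assumes "a \<in> carrier R" "s \<in> W" "b \<in> carrier R" "t \<in> W"
  shows "frac a s \<otimes>\<^bsub>L\<^esub> frac b t = frac (a \<otimes> b) (s \<otimes> t)"
proof -
  have *: "congruent2 (fraction_rel R W) (fraction_rel R W)
     (\<lambda>x y. frac (fst x \<otimes> fst y) (snd x \<otimes> snd y))"
  proof (rule congruent2I'[OF], clarsimp simp: fraction_rel_iff)
    fix a s a' s' b t b' t' u v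
    assume c: "a \<in> carrier R" "s \<in> W" "a' \<in> carrier R" "s' \<in> W" "u \<in> W"
      "b \<in> carrier R" "t \<in> W" "b' \<in> carrier R" "t' \<in> W" "v \<in> W"
     and u: "u \<otimes> (a \<otimes> s') = u \<otimes> (a' \<otimes> s)" and v: "v \<otimes> (b \<otimes> t') = v \<otimes> (b' \<otimes> t)"
    have "(u \<otimes> v) \<otimes> (a \<otimes> b \<otimes> (s' \<otimes> t')) = (u \<otimes> (a \<otimes> s')) \<otimes> (v \<otimes> (b \<otimes> t'))"
      using c by (simp add: m_ac)
    also have "\<dots> = (u \<otimes> v) \<otimes> (a' \<otimes> b' \<otimes> (s \<otimes> t))"
      unfolding u v using c by (simp add: m_ac)
    finally show "frac (a \<otimes> b) (s \<otimes> t) = frac (a' \<otimes> b') (s' \<otimes> t')"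
      using c by (auto simp: frac_eq_iff)
  qed
  show ?thesis
    using UN_equiv_class2[OF equiv_fraction_rel equiv_fraction_rel *, of "(a, s)" "(b, t)"] assms
    by (simp add: localization_def fraction_def case_prod_unfold)
qed

lemma add_frac [simp]:
  assumes "a \<in> carrier R" "s \<in> W" "b \<in> carrier R" "t \<in> W"
  shows "frac a s \<oplus>\<^bsub>L\<^esub> frac b t = frac (a \<otimes> t \<oplus> b \<otimes> s) (s \<otimes> t)"
proof -
  have *: "congruent2 (fraction_rel R W) (fraction_rel R W)
     (\<lambda>x y. frac (fst x \<otimes> snd y \<oplus> fst y \<otimes> snd x) (snd x \<otimes> snd y))"
  proof (rule congruent2I'[OF], clarsimp simp: fraction_rel_iff)
    fix a s a' s' b t b' t' u v
    assume c: "a \<in> carrier R" "s \<in> W" "a' \<in> carrier R" "s' \<in> W" "u \<in> W"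
      "b \<in> carrier R" "t \<in> W" "b' \<in> carrier R" "t' \<in> W" "v \<in> W"
     and u: "u \<otimes> (a \<otimes> s') = u \<otimes> (a' \<otimes> s)" and v: "v \<otimes> (b \<otimes> t') = v \<otimes> (b' \<otimes> t)"
    have "(u \<otimes> v) \<otimes> ((a \<otimes> t \<oplus> b \<otimes> s) \<otimes> (s' \<otimes> t'))
        = (u \<otimes> (a \<otimes> s')) \<otimes> (v \<otimes> t \<otimes> t') \<oplus> (v \<otimes> (b \<otimes> t')) \<otimes> (u \<otimes> s \<otimes> s')"
      using c by (simp add: m_ac l_distr r_distr)
    also have "\<dots> = (u \<otimes> v) \<otimes> ((a' \<otimes> t' \<oplus> b' \<otimes> s') \<otimes> (s \<otimes> t))"
      unfolding u v using c by (simp add: m_ac l_distr r_distr)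
    finally show "frac (a \<otimes> t \<oplus> b \<otimes> s) (s \<otimes> t) = frac (a' \<otimes> t' \<oplus> b' \<otimes> s') (s' \<otimes> t')"
      using c by (subst frac_eq_iff) auto
  qed
  show ?thesis
    using UN_equiv_class2[OF equiv_fraction_rel equiv_fraction_rel *, of "(a, s)" "(b, t)"] assms
    by (simp add: localization_def fraction_def case_prod_unfold)
qed

lemma one_localization: "\<one>\<^bsub>L\<^esub> = frac \<one> \<one>"
  by (simp add: localization_def)

lemma zero_localization: "\<zero>\<^bsub>L\<^esub> = frac \<zero> \<one>"
  by (simp add: localization_def)

lemma frac_zero: "s \<in> W \<Longrightarrow> frac \<zero> s = \<zero>\<^bsub>L\<^esub>"
  unfolding zero_localization by (rule frac_eqI) auto

sublocale L: cring L
proof (rule cringI)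
  show "abelian_group L"
  proof (rule abelian_groupI)
    fix x y z assume "x \<in> carrier L" "y \<in> carrier L" "z \<in> carrier L"
    then show "x \<oplus>\<^bsub>L\<^esub> y \<oplus>\<^bsub>L\<^esub> z = x \<oplus>\<^bsub>L\<^esub> (y \<oplus>\<^bsub>L\<^esub> z)"
      by (elim carrier_localizationE) (auto intro!: frac_eqI simp: m_ac a_ac l_distr r_distr)
  next
    fix x y assume "x \<in> carrier L" "y \<in> carrier L"
    then show "x \<oplus>\<^bsub>L\<^esub> y \<in> carrier L" "x \<oplus>\<^bsub>L\<^esub> y = y \<oplus>\<^bsub>L\<^esub> x"
      by (elim carrier_localizationE, auto intro!: frac_eqI simp: m_ac a_ac)+
  next
    fix x assume x: "x \<in> carrier L"
    show "\<zero>\<^bsub>L\<^esub> \<oplus>\<^bsub>L\<^esub> x = x"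
      using x unfolding zero_localization
      by (elim carrier_localizationE) (auto intro!: frac_eqI simp: m_ac)
    from x obtain a s where *: "a \<in> carrier R" "s \<in> W" "x = frac a s"
      by (rule carrier_localizationE)
    then have "frac (\<ominus> a) s \<oplus>\<^bsub>L\<^esub> x = frac \<zero> (s \<otimes> s)"
      by (auto simp: l_minus l_neg)
    then show "\<exists>y\<in>carrier L. y \<oplus>\<^bsub>L\<^esub> x = \<zero>\<^bsub>L\<^esub>"
      using * frac_zero by (intro bexI[of _ "frac (\<ominus> a) s"]) auto
  qed (auto simp: zero_localization)
  show "Group.comm_monoid L"
  proof (rule comm_monoidI)
    fix x y z assume "x \<in> carrier L" "y \<in> carrier L" "z \<in> carrier L"
    then show "x \<otimes>\<^bsub>L\<^esub> y \<otimes>\<^bsub>L\<^esub> z = x \<otimes>\<^bsub>L\<^esub> (y \<otimes>\<^bsub>L\<^esub> z)"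
      by (elim carrier_localizationE) (auto intro!: frac_eqI simp: m_ac)
  next
    fix x y assume "x \<in> carrier L" "y \<in> carrier L"
    then show "x \<otimes>\<^bsub>L\<^esub> y \<in> carrier L" "x \<otimes>\<^bsub>L\<^esub> y = y \<otimes>\<^bsub>L\<^esub> x"
      by (elim carrier_localizationE, auto intro!: frac_eqI simp: m_ac)+
  next
    fix x assume x: "x \<in> carrier L"
    then show "\<one>\<^bsub>L\<^esub> \<otimes>\<^bsub>L\<^esub> x = x"
      unfolding one_localization by (elim carrier_localizationE) (auto intro!: frac_eqI simp: m_ac)
  qed (auto simp: one_localization)
  fix x y z assume "x \<in> carrier L" "y \<in> carrier L" "z \<in> carrier L"
  then show "(x \<oplus>\<^bsub>L\<^esub> y) \<otimes>\<^bsub>L\<^esub> z = x \<otimes>\<^bsub>L\<^esub> z \<oplus>\<^bsub>L\<^esub> y \<otimes>\<^bsub>L\<^esub> z"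
    by (elim carrier_localizationE, simp, intro frac_eqI) (auto simp: m_ac a_ac l_distr r_distr)
qed

lemma frac_ring_hom: "(\<lambda>a. frac a \<one>) \<in> ring_hom R L"
  by (rule ring_hom_memI) (auto simp: one_localization)

lemma frac_pow:
  assumes "a \<in> carrier R"
  shows "frac a \<one> [^]\<^bsub>L\<^esub> (n::nat) = frac (a [^] n) \<one>"
  using assms by (induction n) (simp_all add: one_localization)

text \<open>Contraction of primes from the localization is strictly monotone: a fraction can be multiplied
  by the unit \<open>s\<close> to become the image of its numerator.\<close>
lemma krull_dim_localization_le: "krull_dim L \<le> krull_dim R"
proof -
  let ?c = "\<lambda>p. {a \<in> carrier R. frac a \<one> \<in> p}"
  interpret hom: ring_hom_ring R L "\<lambda>a. frac a \<one>"
    by (rule ring_hom_ringI2[OF ring_axioms L.ring_axioms frac_ring_hom])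
  have prime: "primeideal (?c p) R" if "primeideal p L" for p
    using hom.primeideal_vimage[OF is_cring that] .
  have mono: "?c p \<subset> ?c q" if p: "primeideal p L" and q: "primeideal q L" and "p \<subset> q" for p q
  proof -
    interpret p: primeideal p L by fact
    interpret q: primeideal q L by fact
    obtain x where x: "x \<in> q" "x \<notin> p" using \<open>p \<subset> q\<close> by blast
    then obtain a s where as: "a \<in> carrier R" "s \<in> W" "x = frac a s"
      using q.Icarr carrier_localizationE by blast
    have num: "frac a \<one> = x \<otimes>\<^bsub>L\<^esub> frac s \<one>"
      unfolding as(3) using as(1,2) by (simp, intro frac_eqI) (auto simp: m_ac)
    have den: "x = frac a \<one> \<otimes>\<^bsub>L\<^esub> frac \<one> s"
      unfolding as(3) using as(1,2) by simp
    have "frac a \<one> \<in> q"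
      unfolding num using x as by (intro q.I_r_closed) auto
    moreover have "frac a \<one> \<notin> p"
    proof
      assume "frac a \<one> \<in> p"
      then have "x \<in> p" unfolding den using as by (intro p.I_r_closed) auto
      then show False using x by simp
    qed
    ultimately show ?thesis using as \<open>p \<subset> q\<close> by blast
  qed
  show ?thesis
    unfolding krull_dim_def
  proof (intro Sup_subset_mono subsetI, clarify)
    fix n and p :: "nat \<Rightarrow> ('a \<times> 'a) set set"
    assume *: "\<forall>i\<le>n. primeideal (p i) L" "\<forall>i<n. p i \<subset> p (Suc i)"
    show "\<exists>m. enat n = enat m \<and> (\<exists>p. (\<forall>i\<le>m. primeideal (p i) R) \<and> (\<forall>i<m. p i \<subset> p (Suc i)))"
      using * prime mono
      by (intro exI[of _ n] conjI exI[of _ "\<lambda>i. ?c (p i)"] allI impI refl) auto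
  qed
qed

end

section \<open>Prime ideals, chains and regular sequences\<close>

text \<open>Krull's lemma: an ideal maximal among those containing \<open>I\<close> and missing \<open>T\<close> is prime, for if
  \<open>a\<close> and \<open>b\<close> are outside it, then enlarging it by either element meets \<open>T\<close>, and the product of
  two such elements of \<open>T\<close> would lie in it once \<open>a \<otimes> b\<close> does.\<close>

lemma (in cring) exists_prime_avoiding:
  assumes I: "ideal I R" and T: "T \<subseteq> carrier R" "\<one> \<in> T" "\<And>s t. s \<in> T \<Longrightarrow> t \<in> T \<Longrightarrow> s \<otimes> t \<in> T"
    and disj: "I \<inter> T = {}"
  shows "\<exists>Q. primeideal Q R \<and> I \<subseteq> Q \<and> Q \<inter> T = {}"
proof -
  let ?A = "{J. ideal J R \<and> I \<subseteq> J \<and> J \<inter> T = {}}"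
  have "\<exists>Q\<in>?A. \<forall>J\<in>?A. Q \<subseteq> J \<longrightarrow> J = Q"
  proof (rule subset_Zorn_nonempty)
    show "?A \<noteq> {}" using I disj by blast
    fix C assume C: "C \<noteq> {}" "subset.chain ?A C"
    then have "subset.chain {J. ideal J R} C"
      by (auto simp: subset.chain_def)
    from chain_Union_is_ideal[OF this] C have "ideal (\<Union>C) R" by simp
    then show "\<Union>C \<in> ?A"
      using C by (auto simp: subset.chain_def)
  qed
  then obtain Q where Q_max: "Q \<in> ?A" "\<forall>J\<in>?A. Q \<subseteq> J \<longrightarrow> J = Q" ..
  then have Q: "ideal Q R" "I \<subseteq> Q" "Q \<inter> T = {}" by simp_all
  have max: "J = Q" if J: "ideal J R" "Q \<subseteq> J" "J \<inter> T = {}" for J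
  proof -
    have "J \<in> ?A" using J subset_trans[OF Q(2) J(2)] by simp
    then show ?thesis using Q_max(2) J(2) by simp
  qed
  interpret Q: ideal Q R by fact
  have meets: "\<exists>q\<in>Q. \<exists>r\<in>carrier R. q \<oplus> r \<otimes> a \<in> T" if a: "a \<in> carrier R" "a \<notin> Q" for a
  proof -
    have id: "ideal (Q <+> PIdl a) R"
      using Q(1) cgenideal_ideal[OF a(1)] by (rule add_ideals)
    have sub: "Q \<subseteq> Q <+> PIdl a"
    proof
      fix q assume "q \<in> Q"
      then show "q \<in> Q <+> PIdl a"
        using a Q.Icarr by (auto simp: set_add_def' cgenideal_def intro!: bexI[of _ q] exI[of _ \<zero>])
    qed
    have "a \<in> Q <+> PIdl a"
    proof -
      have "a = \<zero> \<oplus> a" using a by simp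
      then show ?thesis
        unfolding set_add_def' using Q.zero_closed cgenideal_self[OF a(1)] by blast
    qed
    then have "(Q <+> PIdl a) \<inter> T \<noteq> {}"
      using max[OF id sub] a by auto
    then show ?thesis by (auto simp: set_add_def' cgenideal_def)
  qed
  have "primeideal Q R"
  proof (rule primeidealI[OF Q(1) is_cring])
    show "carrier R \<noteq> Q" using Q T by blast
    fix a b assume ab: "a \<in> carrier R" "b \<in> carrier R" "a \<otimes> b \<in> Q"
    show "a \<in> Q \<or> b \<in> Q"
    proof (rule ccontr)
      assume "\<not> ?thesis"
      then obtain q r q' r' where qr: "q \<in> Q" "r \<in> carrier R" "q \<oplus> r \<otimes> a \<in> T"
        "q' \<in> Q" "r' \<in> carrier R" "q' \<oplus> r' \<otimes> b \<in> T"
        using meets ab by metis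
      have [simp]: "q \<in> carrier R" "q' \<in> carrier R" using qr Q.Icarr by auto
      have "(q \<oplus> r \<otimes> a) \<otimes> (q' \<oplus> r' \<otimes> b)
          = q \<otimes> (q' \<oplus> r' \<otimes> b) \<oplus> ((r \<otimes> a) \<otimes> q' \<oplus> (r \<otimes> r') \<otimes> (a \<otimes> b))"
        using ab qr by (simp add: l_distr r_distr m_ac a_ac)
      also have "\<dots> \<in> Q"
        using Q.I_r_closed[OF qr(1), of "q' \<oplus> r' \<otimes> b"] Q.I_l_closed[OF qr(4), of "r \<otimes> a"]
          Q.I_l_closed[OF ab(3), of "r \<otimes> r'"] ab qr by (simp add: Q.a_closed)
      finally show False using T(3)[OF qr(3,6)] Q(3) by blast
    qed
  qed
  with Q show ?thesis by blast
qed

text \<open>This step lowers a prime in a chain. The multiplicative set is \<open>{x\<^sup>k s | s \<notin> p}\<close>: it contains \<open>x\<close> and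
  everything outside \<open>p\<close>, so a prime missing it is a proper part of \<open>p\<close> as soon as \<open>x \<in> p\<close>.\<close>

lemma (in cring) exists_smaller_prime:
  assumes p: "primeideal p R" and I: "ideal I R" "I \<subseteq> p" and x: "x \<in> carrier R"
    and reg: "\<And>k s. s \<in> carrier R \<Longrightarrow> x [^] (k::nat) \<otimes> s \<in> I \<Longrightarrow> s \<in> p"
  shows "\<exists>q. primeideal q R \<and> I \<subseteq> q \<and> q \<subseteq> p \<and> x \<notin> q"
proof -
  interpret p: primeideal p R by fact
  define T where "T = {x [^] (k::nat) \<otimes> s | k s. s \<in> carrier R - p}"
  have one: "\<one> \<in> carrier R - p"
    using p.one_imp_carrier p.I_notcarr by auto
  have in_T: "x [^] (k::nat) \<otimes> s \<in> T" if "s \<in> carrier R - p" for k s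
    using that unfolding T_def by blast
  have "\<exists>q. primeideal q R \<and> I \<subseteq> q \<and> q \<inter> T = {}"
  proof (rule exists_prime_avoiding[OF I(1)])
    show "T \<subseteq> carrier R" using x by (auto simp: T_def)
    show "\<one> \<in> T" using in_T[OF one, of 0] by simp
    show "I \<inter> T = {}" using reg by (auto simp: T_def)
    fix s t assume "s \<in> T" "t \<in> T"
    then obtain k s' l t' where *: "s = x [^] (k::nat) \<otimes> s'" "t = x [^] (l::nat) \<otimes> t'"
      "s' \<in> carrier R - p" "t' \<in> carrier R - p"
      unfolding T_def by blast
    then have "s \<otimes> t = x [^] (k + l) \<otimes> (s' \<otimes> t')"
      using x by (simp add: nat_pow_mult[symmetric] m_ac)
    moreover have "s' \<otimes> t' \<in> carrier R - p" using * p.I_prime by auto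
    ultimately show "s \<otimes> t \<in> T" using in_T by simp
  qed
  then obtain q where q: "primeideal q R" "I \<subseteq> q" "q \<inter> T = {}" by blast
  interpret q: primeideal q R by fact
  have "q \<subseteq> p"
  proof
    fix s assume s: "s \<in> q"
    then have "s \<in> carrier R" using q.Icarr by simp
    then show "s \<in> p" using in_T[of s 0] q(3) s by auto
  qed
  moreover have "x \<in> T" using in_T[OF one, of 1] x by simp
  ultimately show ?thesis using q by blast
qed

lemma krull_dim_ge:
  assumes "\<And>i. i \<le> n \<Longrightarrow> primeideal (p i) R" "\<And>i. i < n \<Longrightarrow> p i \<subset> p (Suc i)"
  shows "enat n \<le> krull_dim R"
  unfolding krull_dim_def using assms by (intro Sup_upper) auto

text \<open>Starting from a prime above the whole sequence, the last element of the sequence is removed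
  from the ideal again and again; since it is not a zero divisor modulo its predecessors, each
  removal yields a strictly smaller prime.\<close>

lemma (in cring) regular_sequence_length_le_krull_dim:
  assumes reg: "regular_sequence R xs"
  shows "enat (length xs) \<le> krull_dim R"
proof -
  define n where "n = length xs"
  define I where "I i = Idl (set (take i xs))" for i
  have carr: "set xs \<subseteq> carrier R" using reg by (simp add: regular_sequence_def)
  then have set_take: "set (take i xs) \<subseteq> carrier R" for i
    using set_take_subset by fast
  have ideal_I: "ideal (I i) R" for i
    unfolding I_def using set_take by (rule genideal_ideal)
  have mono_I: "I i \<subseteq> I n" if "i \<le> n" for i
    unfolding I_def n_def using subset_Idl_subset[OF carr set_take_subset[of i xs]] by simp
  have nzd: "r \<in> I i" if "i < n" "r \<in> carrier R" "xs ! i \<otimes> r \<in> I i" for i r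
    using reg that unfolding regular_sequence_def n_def I_def by blast
  have "\<exists>p. (\<forall>i\<le>k. primeideal (p i) R) \<and> (\<forall>i<k. p i \<subset> p (Suc i)) \<and> I (n - k) \<subseteq> p 0 \<and> I n \<subseteq> p k"
    if "k \<le> n" for k
    using that
  proof (induction k)
    case 0
    have "I n \<inter> {\<one>} = {}"
      using ideal.one_imp_carrier[OF ideal_I, of n] reg
      by (auto simp: I_def n_def regular_sequence_def)
    then obtain Q where "primeideal Q R" "I n \<subseteq> Q"
      using exists_prime_avoiding[OF ideal_I, of "{\<one>}" n] by auto
    then show ?case by (intro exI[of _ "\<lambda>_. Q"]) auto
  next
    case (Suc k)
    then obtain p where p: "\<And>i. i \<le> k \<Longrightarrow> primeideal (p i) R" "\<And>i. i < k \<Longrightarrow> p i \<subset> p (Suc i)"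
      "I (n - k) \<subseteq> p 0" "I n \<subseteq> p k"
      by (metis Suc_leD)
    define i where "i = n - Suc k"
    have i: "i < n" "n - k = Suc i" using Suc.prems by (auto simp: i_def)
    define x where "x = xs ! i"
    have x: "x \<in> carrier R" using carr i by (auto simp: x_def n_def)
    have x_I: "x \<in> I (Suc i)"
      unfolding I_def x_def using i
      by (intro subsetD[OF genideal_self[OF set_take]]) (simp add: n_def take_Suc_conv_app_nth)
    have I_le: "I i \<subseteq> I (Suc i)"
      unfolding I_def by (intro subset_Idl_subset set_take set_take_subset_set_take) simp
    \<comment> \<open>With a non-zero-divisor, the hypothesis on powers follows by cancelling one factor at a time.\<close>
    have pow: "s \<in> I i" if "s \<in> carrier R" "x [^] (m::nat) \<otimes> s \<in> I i" for m s
      using that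
    proof (induction m arbitrary: s)
      case (Suc m)
      have "x [^] m \<otimes> (x \<otimes> s) \<in> I i" using Suc.prems x by (simp add: m_assoc)
      then have "x \<otimes> s \<in> I i" using Suc.IH[of "x \<otimes> s"] Suc.prems x by simp
      then show ?case using nzd[OF i(1)] Suc.prems by (simp add: x_def)
    qed simp
    have sub: "I i \<subseteq> p 0" using I_le p(3) i by auto
    obtain q where q: "primeideal q R" "I i \<subseteq> q" "q \<subseteq> p 0" "x \<notin> q"
      using exists_smaller_prime[OF p(1)[of 0] ideal_I sub x] pow sub by blast
    have "q \<subset> p 0" using q x_I p(3) i by auto
    show ?case
    proof (intro exI[of _ "\<lambda>j. case j of 0 \<Rightarrow> q | Suc j \<Rightarrow> p j"] conjI allI impI)
      fix j assume "j \<le> Suc k"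
      then show "primeideal (case j of 0 \<Rightarrow> q | Suc j \<Rightarrow> p j) R"
        using q p by (auto split: nat.split)
    next
      fix j assume "j < Suc k"
      then show "(case j of 0 \<Rightarrow> q | Suc j \<Rightarrow> p j) \<subset> (case Suc j of 0 \<Rightarrow> q | Suc j \<Rightarrow> p j)"
        using \<open>q \<subset> p 0\<close> p by (cases j) auto
    qed (use q p i in \<open>auto simp: i_def\<close>)
  qed
  from this[of n] show ?thesis
    unfolding n_def[symmetric] using krull_dim_ge by blast
qed

lemma (in cring) local_depth_le_krull_dim: "local_depth R \<le> krull_dim R"
  unfolding local_depth_def
  by (rule Sup_least) (auto intro: regular_sequence_length_le_krull_dim)

lemma (in cring) Idl_empty: "Idl {} = {\<zero>}"
  using genideal_minimal[OF zeroideal, of "{}"] ideal.axioms(1)[OF genideal_ideal[of "{}"]]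
  by (auto dest: additive_subgroup.zero_closed)

lemma (in cring) regular_sequence_pair_iff:
  assumes "x \<in> carrier R" "y \<in> carrier R"
  shows "regular_sequence R [x, y] \<longleftrightarrow>
     (\<forall>r\<in>carrier R. x \<otimes> r = \<zero> \<longrightarrow> r = \<zero>) \<and>
     (\<forall>r\<in>carrier R. y \<otimes> r \<in> PIdl x \<longrightarrow> r \<in> PIdl x) \<and> Idl {x, y} \<noteq> carrier R"
  using assms by (auto simp: regular_sequence_def Idl_empty cgenideal_eq_genideal less_Suc_eq)

lemma (in cring) regular_sequence_first_two:
  assumes "regular_sequence R xs" "2 \<le> length xs"
  obtains x y where "x \<in> set xs" "y \<in> set xs"
    "\<And>r. r \<in> carrier R \<Longrightarrow> x \<otimes> r = \<zero> \<Longrightarrow> r = \<zero>"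
    "\<And>r. r \<in> carrier R \<Longrightarrow> y \<otimes> r \<in> PIdl x \<Longrightarrow> r \<in> PIdl x"
proof -
  obtain x y zs where xs: "xs = x # y # zs"
    using assms(2) by (cases xs; cases "tl xs") auto
  have *: "\<forall>i<length xs. \<forall>r\<in>carrier R.
        xs ! i \<otimes> r \<in> Idl (set (take i xs)) \<longrightarrow> r \<in> Idl (set (take i xs))" and c: "set xs \<subseteq> carrier R"
    using assms by (auto simp: regular_sequence_def)
  show ?thesis
    by (rule that[of x y])
       (use *[rule_format, of 0] *[rule_format, of 1] c in \<open>auto simp: xs Idl_empty cgenideal_eq_genideal\<close>)
qed

section \<open>Localization at a prime ideal\<close>

locale prime_localization = cring R + P: primeideal P R for R (structure) and P
begin

sublocale multiplicative_set R "carrier R - P"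
  by unfold_locales (use P.one_imp_carrier P.I_notcarr P.I_prime in auto)

text \<open>For \<open>W = carrier R - P\<close> the premise of this rule simplifies to its own conclusion, so the
  simplifier would loop.\<close>

declare W_carrier [simp del, rule del]

definition max_ideal where "max_ideal = {frac a s | a s. a \<in> P \<and> s \<in> carrier R - P}"

lemma frac_in_max_ideal_iff:
  assumes "a \<in> carrier R" "s \<in> carrier R - P"
  shows "frac a s \<in> max_ideal \<longleftrightarrow> a \<in> P"
proof
  assume "frac a s \<in> max_ideal"
  then obtain b t where bt: "b \<in> P" "t \<in> carrier R - P" "frac a s = frac b t"
    by (auto simp: max_ideal_def)
  then obtain u where u: "u \<in> carrier R - P" "u \<otimes> (a \<otimes> t) = u \<otimes> (b \<otimes> s)"
    using assms P.Icarr frac_eq_iff by metis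
  have "u \<otimes> (b \<otimes> s) \<in> P"
    using bt u assms P.Icarr by (intro P.I_l_closed P.I_r_closed) auto
  then have "u \<in> P \<or> a \<in> P \<or> t \<in> P"
    using u assms bt P.I_prime by (metis DiffD1 m_closed)
  then show "a \<in> P" using u bt by simp
qed (use assms in \<open>auto simp: max_ideal_def\<close>)

lemma maximalideal_max_ideal: "maximalideal max_ideal L"
  and maximalideal_unique: "maximalideal M L \<Longrightarrow> M = max_ideal"
proof -
  have id: "ideal max_ideal L"
  proof (rule idealI[OF L.ring_axioms])
    show "subgroup max_ideal (add_monoid L)"
    proof (rule L.add.subgroupI)
      show "max_ideal \<subseteq> carrier L" using P.Icarr by (auto simp: max_ideal_def)
      show "max_ideal \<noteq> {}"
        using P.zero_closed one_W unfolding max_ideal_def by blast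
      fix x assume "x \<in> max_ideal"
      then obtain a s where as: "a \<in> P" "s \<in> carrier R - P" "x = frac a s"
        by (auto simp: max_ideal_def)
      have "a \<in> carrier R" using as P.Icarr by simp
      then have "frac (\<ominus> a) s \<oplus>\<^bsub>L\<^esub> x = \<zero>\<^bsub>L\<^esub>"
        unfolding as(3) using as(1,2) frac_zero[OF mult_W[of s s]] by (simp add: l_minus l_neg)
      then have "frac (\<ominus> a) s = \<ominus>\<^bsub>L\<^esub> x"
        using as \<open>a \<in> carrier R\<close> by (intro L.minus_equality[symmetric]) auto
      then show "\<ominus>\<^bsub>L\<^esub> x \<in> max_ideal"
        using as P.a_inv_closed by (auto simp: max_ideal_def)
      fix y assume "y \<in> max_ideal"
      then obtain b t where bt: "b \<in> P" "t \<in> carrier R - P" "y = frac b t"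
        by (auto simp: max_ideal_def)
      have [simp]: "a \<in> carrier R" "b \<in> carrier R" using as bt P.Icarr by simp_all
      have "a \<otimes> t \<oplus> b \<otimes> s \<in> P"
        using as bt P.I_r_closed[of a t] P.I_r_closed[of b s] by (simp add: P.a_closed)
      moreover have "x \<oplus>\<^bsub>L\<^esub> y = frac (a \<otimes> t \<oplus> b \<otimes> s) (s \<otimes> t)"
        unfolding as(3) bt(3) using as(2) bt(2) by simp
      ultimately show "x \<oplus>\<^bsub>L\<^esub> y \<in> max_ideal"
        using as(2) bt(2) mult_W[of s t] unfolding max_ideal_def by blast
    qed
    fix x y assume xy: "x \<in> max_ideal" "y \<in> carrier L"
    then obtain a s b t where *: "a \<in> P" "s \<in> carrier R - P" "x = frac a s"
        "b \<in> carrier R" "t \<in> carrier R - P" "y = frac b t"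
      by (auto simp: max_ideal_def elim!: carrier_localizationE)
    moreover have "a \<in> carrier R" using * P.Icarr by simp
    ultimately show "y \<otimes>\<^bsub>L\<^esub> x \<in> max_ideal" "x \<otimes>\<^bsub>L\<^esub> y \<in> max_ideal"
      using P.I_l_closed P.I_r_closed mult_W by (auto simp: frac_in_max_ideal_iff)
  qed
  have one: "\<one>\<^bsub>L\<^esub> \<notin> max_ideal"
    using one_W by (simp add: one_localization frac_in_max_ideal_iff)
  have proper: "J \<subseteq> max_ideal" if J: "ideal J L" "J \<noteq> carrier L" for J
  proof
    interpret J: ideal J L by fact
    fix x assume x: "x \<in> J"
    then obtain a s where as: "a \<in> carrier R" "s \<in> carrier R - P" "x = frac a s"
      using J.Icarr carrier_localizationE by blast
    show "x \<in> max_ideal"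
    proof (rule ccontr)
      assume "x \<notin> max_ideal"
      then have a: "a \<in> carrier R - P" using as by (simp add: frac_in_max_ideal_iff)
      have "x \<otimes>\<^bsub>L\<^esub> frac s a = frac (a \<otimes> s) (s \<otimes> a)" using as a by simp
      also have "\<dots> = \<one>\<^bsub>L\<^esub>" unfolding one_localization using as a mult_W one_W by (intro frac_eqI) (auto simp: m_ac)
      finally have "\<one>\<^bsub>L\<^esub> \<in> J" using J.I_r_closed[OF x, of "frac s a"] as a by auto
      then show False using J.one_imp_carrier J by blast
    qed
  qed
  show max: "maximalideal max_ideal L"
    by (rule maximalidealI[OF id]) (use one proper in auto)
  show "M = max_ideal" if M: "maximalideal M L"
  proof -
    interpret M: maximalideal M L by fact
    show ?thesis
      using M.I_maximal[OF id proper] M.I_notcarr M.is_ideal one id by (metis L.one_closed ideal.Icarr subsetI)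
  qed
qed

lemma the_maximalideal: "(THE M. maximalideal M (localization_at R P)) = max_ideal"
  unfolding localization_at_def
  using maximalideal_max_ideal maximalideal_unique by (rule the_equality)

text \<open>Localization is flat, so it preserves regular sequences; for two elements this only takes
  clearing denominators.\<close>

lemma regular_pair_localizes:
  assumes xy: "x \<in> P" "y \<in> P"
    and x_reg: "\<And>r. r \<in> carrier R \<Longrightarrow> x \<otimes> r = \<zero> \<Longrightarrow> r = \<zero>"
    and y_reg: "\<And>r. r \<in> carrier R \<Longrightarrow> y \<otimes> r \<in> PIdl x \<Longrightarrow> r \<in> PIdl x"
  shows "2 \<le> local_depth (localization_at R P)"
proof -
  have c: "x \<in> carrier R" "y \<in> carrier R" using xy P.Icarr by auto
  let ?x = "frac x \<one>" and ?y = "frac y \<one>"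
  interpret M: maximalideal max_ideal L by (rule maximalideal_max_ideal)
  have in_M: "?x \<in> max_ideal" "?y \<in> max_ideal"
    using xy c one_W by (auto simp: frac_in_max_ideal_iff)
  have cl: "?x \<in> carrier L" "?y \<in> carrier L" using c one_W by auto
  have "regular_sequence L [?x, ?y]"
  proof (subst L.regular_sequence_pair_iff[OF cl], intro conjI ballI impI)
    show "Idl\<^bsub>L\<^esub> {?x, ?y} \<noteq> carrier L"
      using L.genideal_minimal[OF M.is_ideal, of "{?x, ?y}"] in_M M.I_notcarr M.a_subset by blast
  next
    fix r assume "r \<in> carrier L" "?x \<otimes>\<^bsub>L\<^esub> r = \<zero>\<^bsub>L\<^esub>"
    then obtain a s where as: "a \<in> carrier R" "s \<in> carrier R - P" "r = frac a s"
      by (elim carrier_localizationE)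
    with \<open>?x \<otimes>\<^bsub>L\<^esub> r = \<zero>\<^bsub>L\<^esub>\<close> have "frac (x \<otimes> a) s = frac \<zero> \<one>"
      using c one_W by (simp add: zero_localization)
    then obtain u where u: "u \<in> carrier R - P" "u \<otimes> (x \<otimes> a \<otimes> \<one>) = u \<otimes> (\<zero> \<otimes> s)"
      using as c one_W by (subst (asm) frac_eq_iff) auto
    then have "x \<otimes> (u \<otimes> a) = \<zero>" using as c by (simp add: m_ac)
    then have ua: "u \<otimes> a = \<zero>" using x_reg[of "u \<otimes> a"] u(1) as(1) by simp
    show "r = \<zero>\<^bsub>L\<^esub>"
      unfolding zero_localization as(3)
      using as u ua one_W by (subst frac_eq_iff) (auto intro!: bexI[of _ u])
  next
    fix r assume "r \<in> carrier L" and r: "?y \<otimes>\<^bsub>L\<^esub> r \<in> PIdl\<^bsub>L\<^esub> ?x"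
    then obtain q where q: "q \<in> carrier L" "?y \<otimes>\<^bsub>L\<^esub> r = q \<otimes>\<^bsub>L\<^esub> ?x"
      unfolding cgenideal_def by blast
    obtain a s where "a \<in> carrier R" "s \<in> carrier R - P" "r = frac a s"
      using \<open>r \<in> carrier L\<close> by (rule carrier_localizationE)
    moreover obtain b t where "b \<in> carrier R" "t \<in> carrier R - P" "q = frac b t"
      using q(1) by (rule carrier_localizationE)
    ultimately have as: "a \<in> carrier R" "s \<in> carrier R - P" "r = frac a s"
      "b \<in> carrier R" "t \<in> carrier R - P" "?y \<otimes>\<^bsub>L\<^esub> r = frac b t \<otimes>\<^bsub>L\<^esub> ?x"
      using q(2) by simp_all
    then have "frac (y \<otimes> a) s = frac (b \<otimes> x) t"
      using c one_W by simp
    then obtain u where u: "u \<in> carrier R - P" "u \<otimes> (y \<otimes> a \<otimes> t) = u \<otimes> (b \<otimes> x \<otimes> s)"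
      using as c by (subst (asm) frac_eq_iff) auto
    have "y \<otimes> (u \<otimes> a \<otimes> t) = u \<otimes> (y \<otimes> a \<otimes> t)"
      using u(1) as(1,5) c by (simp add: m_ac)
    also have "\<dots> = u \<otimes> b \<otimes> s \<otimes> x"
      unfolding u(2) using u(1) as(2,4) c by (simp add: m_ac)
    finally have "y \<otimes> (u \<otimes> a \<otimes> t) = u \<otimes> b \<otimes> s \<otimes> x" .
    moreover have "u \<otimes> b \<otimes> s \<in> carrier R" using u(1) as(2,4) by simp
    ultimately have "y \<otimes> (u \<otimes> a \<otimes> t) \<in> PIdl x" unfolding cgenideal_def by blast
    moreover have "u \<otimes> a \<otimes> t \<in> carrier R" using u(1) as(1,5) by simp
    ultimately have "u \<otimes> a \<otimes> t \<in> PIdl x" using y_reg by blast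
    then obtain k where k: "k \<in> carrier R" "u \<otimes> a \<otimes> t = k \<otimes> x" unfolding cgenideal_def by blast
    have w: "u \<otimes> t \<otimes> s \<in> carrier R - P" using as(2,5) u(1) mult_W by blast
    have "r = frac (k \<otimes> x) (u \<otimes> t \<otimes> s)"
      unfolding as(3)
    proof (rule frac_eqI)
      show "a \<otimes> (u \<otimes> t \<otimes> s) = k \<otimes> x \<otimes> s"
        unfolding k(2)[symmetric] using as(1,2,5) u(1) by (simp add: m_ac)
    qed (use as(1,2) k(1) c w in simp_all)
    also have "\<dots> = frac k (u \<otimes> t \<otimes> s) \<otimes>\<^bsub>L\<^esub> ?x"
      using w k(1) c one_W by simp
    finally show "r \<in> PIdl\<^bsub>L\<^esub> ?x"
      using frac_closed[OF k(1) w] unfolding cgenideal_def by blast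
  qed
  then have "enat (length [?x, ?y]) \<le> local_depth (localization_at R P)"
    unfolding local_depth_def the_maximalideal
    using in_M by (intro Sup_upper) (auto simp: localization_at_def intro!: exI[of _ "[?x, ?y]"])
  then show ?thesis by (simp add: numeral_eq_enat numeral_2_eq_2)
qed

end

section \<open>Cosets of a plane lattice\<close>

definition cross :: "int \<times> int \<Rightarrow> int \<times> int \<Rightarrow> int" where
  "cross u v = fst u * snd v - snd u * fst v"

definition lattice_cong :: "int \<times> int \<Rightarrow> int \<times> int \<Rightarrow> int \<times> int \<Rightarrow> int \<times> int \<Rightarrow> bool" where
  "lattice_cong a b z z' \<longleftrightarrow>
     (\<exists>i j. fst z = fst z' + i * fst a + j * fst b \<and> snd z = snd z' + i * snd a + j * snd b)"

text \<open>The lattice points of the half-open parallelogram in integer form: by Cramer's rule the two quotients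
  are the integer parts of the coordinates of \<open>z\<close> with respect to \<open>a\<close> and \<open>b\<close>, for either sign of
  the determinant.\<close>

definition fundamental_domain :: "int \<times> int \<Rightarrow> int \<times> int \<Rightarrow> (int \<times> int) set" where
  "fundamental_domain a b = {z. cross z b div cross a b = 0 \<and> cross a z div cross a b = 0}"

definition reduce :: "int \<times> int \<Rightarrow> int \<times> int \<Rightarrow> int \<times> int \<Rightarrow> int \<times> int" where
  "reduce a b z = (let i = cross z b div cross a b; j = cross a z div cross a b
     in (fst z - i * fst a - j * fst b, snd z - i * snd a - j * snd b))"

lemma reduce_in_fundamental_domain: "cross a b \<noteq> 0 \<Longrightarrow> reduce a b z \<in> fundamental_domain a b"
proof -
  assume D: "cross a b \<noteq> 0"
  let ?i = "cross z b div cross a b" and ?j = "cross a z div cross a b"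
  have "cross (reduce a b z) b = cross z b - ?i * cross a b"
    unfolding reduce_def Let_def by (simp add: cross_def algebra_simps)
  also have "\<dots> = cross z b mod cross a b" by (simp add: minus_div_mult_eq_mod)
  moreover have "cross a (reduce a b z) = cross a z - ?j * cross a b"
    unfolding reduce_def Let_def by (simp add: cross_def algebra_simps)
  moreover have "\<dots> = cross a z mod cross a b" by (simp add: minus_div_mult_eq_mod)
  ultimately show ?thesis by (simp add: fundamental_domain_def)
qed

lemma lattice_cong_reduce: "lattice_cong a b z (reduce a b z)"
  unfolding lattice_cong_def reduce_def Let_def
  by (intro exI[of _ "cross z b div cross a b"] exI[of _ "cross a z div cross a b"]) simp

lemma lattice_cong_sym: "lattice_cong a b z z' \<Longrightarrow> lattice_cong a b z' z"
  unfolding lattice_cong_def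
proof (elim exE)
  fix i j assume "fst z = fst z' + i * fst a + j * fst b \<and> snd z = snd z' + i * snd a + j * snd b"
  then show "\<exists>i j. fst z' = fst z + i * fst a + j * fst b \<and> snd z' = snd z + i * snd a + j * snd b"
    by (intro exI[of _ "-i"] exI[of _ "-j"]) simp
qed

lemma lattice_cong_trans: "lattice_cong a b x y \<Longrightarrow> lattice_cong a b y z \<Longrightarrow> lattice_cong a b x z"
  unfolding lattice_cong_def
proof (elim exE)
  fix i j i' j' assume "fst x = fst y + i * fst a + j * fst b \<and> snd x = snd y + i * snd a + j * snd b"
    "fst y = fst z + i' * fst a + j' * fst b \<and> snd y = snd z + i' * snd a + j' * snd b"
  then show "\<exists>i j. fst x = fst z + i * fst a + j * fst b \<and> snd x = snd z + i * snd a + j * snd b"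
    by (intro exI[of _ "i+i'"] exI[of _ "j+j'"]) (simp add: algebra_simps)
qed

lemma fundamental_domain_cong_imp_eq:
  assumes D: "cross a b \<noteq> 0" and z: "z \<in> fundamental_domain a b" "z' \<in> fundamental_domain a b" and "lattice_cong a b z z'"
  shows "z = z'"
proof -
  obtain i j where ij: "fst z = fst z' + i * fst a + j * fst b" "snd z = snd z' + i * snd a + j * snd b"
    using assms unfolding lattice_cong_def by blast
  have "cross z b = cross z' b + i * cross a b" "cross a z = cross a z' + j * cross a b"
    unfolding cross_def ij by (simp_all add: algebra_simps)
  then have "i = 0" "j = 0" using z D by (simp_all add: fundamental_domain_def)
  then show ?thesis using ij by (simp add: prod_eq_iff)
qed

lemma reduce_eq_iff:
  assumes "cross a b \<noteq> 0"
  shows "reduce a b z = reduce a b z' \<longleftrightarrow> lattice_cong a b z z'"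
  using fundamental_domain_cong_imp_eq[OF assms reduce_in_fundamental_domain[OF assms] reduce_in_fundamental_domain[OF assms]]
    lattice_cong_reduce lattice_cong_sym lattice_cong_trans by metis

text \<open>A second set of coset representatives is easy to count. With \<open>g = gcd c\<^sub>1 c\<^sub>2\<close> the lattice has a
  basis \<open>(g, h)\<close>, \<open>(0, k)\<close> in Hermite form, so the rectangle \<open>[0, g) \<times> [0, \<bar>k\<bar>)\<close> represents every coset
  once, and \<open>g k\<close> is the determinant. The map \<open>\<rho>\<close> moves a point to the rectangle.\<close>

lemma card_fundamental_domain:
  assumes D: "cross a b \<noteq> 0"
  shows "finite (fundamental_domain a b) \<and> int (card (fundamental_domain a b)) = \<bar>cross a b\<bar>"
proof -
  obtain c1 d1 c2 d2 where ab: "a = (c1, d1)" "b = (c2, d2)" by fastforce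
  define g where "g = gcd c1 c2"
  obtain u v where uv: "u * c1 + v * c2 = g" using bezout_int g_def by blast
  have g0: "g > 0" using D by (auto simp: g_def cross_def ab gcd_eq_0_iff intro: gr_zeroI)
  define e1 e2 where "e1 = c1 div g" and "e2 = c2 div g"
  have ce: "c1 = g * e1" "c2 = g * e2" by (simp_all add: e1_def e2_def g_def)
  have "g * (u * e1 + v * e2) = g * 1" using uv unfolding ce by (simp add: algebra_simps)
  then have ue: "u * e1 + v * e2 = 1" using g0 by simp
  define h k where "h = u * d1 + v * d2" and "k = e1 * d2 - e2 * d1"
  have Dk: "cross a b = g * k" by (simp add: cross_def ab ce k_def algebra_simps)
  then have k0: "k \<noteq> 0" using D by auto
  define \<rho> where "\<rho> z = (fst z mod g, (snd z - (fst z div g) * h) mod \<bar>k\<bar>)" for z :: "int \<times> int"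
  \<comment> \<open>\<open>\<rho>\<close> is invariant under the lattice, and conversely separates its cosets.\<close>
  have inv: "\<rho> z = \<rho> z'" if cg: "lattice_cong a b z z'" for z z'
  proof -
    obtain i j where ij: "fst z = fst z' + i * c1 + j * c2" "snd z = snd z' + i * d1 + j * d2"
      using cg unfolding lattice_cong_def ab by auto
    have x: "fst z = fst z' + g * (i * e1 + j * e2)"
      unfolding ij ce by (simp add: algebra_simps)
    then have dv: "fst z div g = fst z' div g + (i * e1 + j * e2)" and md: "fst z mod g = fst z' mod g"
      using g0 by simp_all
    have "i * d1 + j * d2 - (i * e1 + j * e2) * h
        = i * d1 * (1 - u * e1) + j * d2 * (1 - v * e2) - i * e1 * v * d2 - j * e2 * u * d1"
      by (simp add: h_def algebra_simps)
    also have "\<dots> = i * d1 * (v * e2) + j * d2 * (u * e1) - i * e1 * v * d2 - j * e2 * u * d1"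
    proof -
      have "1 - u * e1 = v * e2" "1 - v * e2 = u * e1" using ue by simp_all
      then show ?thesis by simp
    qed
    also have "\<dots> = (j * u - i * v) * k" by (simp add: k_def algebra_simps)
    finally have "snd z - fst z div g * h = snd z' - fst z' div g * h + (j * u - i * v) * k"
      by (simp add: dv ij(2) algebra_simps)
    also have "\<dots> mod \<bar>k\<bar> = (snd z' - fst z' div g * h) mod \<bar>k\<bar>"
      by (metis mod_add_right_eq add.right_neutral abs_dvd_iff dvd_triv_right mod_0_imp_dvd dvd_imp_mod_0)
    finally show ?thesis by (simp add: \<rho>_def md)
  qed
  have inv': "lattice_cong a b z z'" if "\<rho> z = \<rho> z'" for z z'
  proof -
    define q where "q = fst z div g - fst z' div g"
    have "fst z mod g = fst z' mod g" using that by (simp add: \<rho>_def)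
    then have "fst z - fst z' = (fst z - fst z mod g) - (fst z' - fst z' mod g)" by simp
    also have "\<dots> = g * q" unfolding q_def by (simp only: minus_mod_eq_mult_div right_diff_distrib)
    finally have x: "fst z = fst z' + g * q" by simp
    have "\<bar>k\<bar> dvd (snd z - fst z div g * h) - (snd z' - fst z' div g * h)"
      using that by (simp add: \<rho>_def mod_eq_dvd_iff)
    then obtain t where t: "(snd z - fst z div g * h) - (snd z' - fst z' div g * h) = k * t"
      by (auto elim: dvdE)
    then have y: "snd z = snd z' + q * h + k * t" by (simp add: q_def algebra_simps)
    have "g * q = (q * u - t * e2) * c1 + (q * v + t * e1) * c2"
    proof -
      have "(q * u - t * e2) * c1 + (q * v + t * e1) * c2 = q * (u * c1 + v * c2)"
        by (simp add: ce algebra_simps)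
      then show ?thesis by (simp add: uv)
    qed
    moreover have "q * h + k * t = (q * u - t * e2) * d1 + (q * v + t * e1) * d2"
      by (simp add: h_def k_def algebra_simps)
    ultimately show ?thesis
      unfolding lattice_cong_def ab using x y
      by (intro exI[of _ "q * u - t * e2"] exI[of _ "q * v + t * e1"]) simp
  qed
  have bij: "bij_betw \<rho> (fundamental_domain a b) ({0..<g} \<times> {0..<\<bar>k\<bar>})"
  proof (intro bij_betw_imageI inj_onI)
    fix z z' assume "z \<in> fundamental_domain a b" "z' \<in> fundamental_domain a b" "\<rho> z = \<rho> z'"
    then show "z = z'" using fundamental_domain_cong_imp_eq[OF D] inv' by blast
  next
    show "\<rho> ` fundamental_domain a b = {0..<g} \<times> {0..<\<bar>k\<bar>}"
    proof safe
      fix x y z assume "(x, y) = \<rho> z"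
      then show "x \<in> {0..<g}" "y \<in> {0..<\<bar>k\<bar>}" using g0 k0 by (auto simp: \<rho>_def)
    next
      fix x y assume "x \<in> {0..<g}" "y \<in> {0..<\<bar>k\<bar>}"
      then have "\<rho> (x, y) = (x, y)" by (simp add: \<rho>_def)
      then have "(x, y) = \<rho> (reduce a b (x, y))" using inv[OF lattice_cong_reduce] by metis
      then show "(x, y) \<in> \<rho> ` fundamental_domain a b" using reduce_in_fundamental_domain[OF D] by blast
    qed
  qed
  have "card (fundamental_domain a b) = card ({0..<g} \<times> {0..<\<bar>k\<bar>})" using bij by (rule bij_betw_same_card)
  also have "\<dots> = nat g * nat \<bar>k\<bar>" by (simp add: card_cartesian_product)
  finally have "int (card (fundamental_domain a b)) = \<bar>cross a b\<bar>" using g0 by (simp add: Dk abs_mult)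
  moreover have "finite (fundamental_domain a b)" using bij by (simp add: bij_betw_finite)
  ultimately show ?thesis by simp
qed

lemma div_eq_0_iff_unit_interval:
  fixes k l :: int assumes "l \<noteq> 0"
  shows "k div l = 0 \<longleftrightarrow> 0 \<le> real_of_int k / real_of_int l \<and> real_of_int k / real_of_int l < 1"
  by (metis floor_divide_of_int_eq floor_eq_iff of_int_0 add.left_neutral floor_correct)

lemma int_vec_parallelogram:
  assumes D: "cross (int_vec a) (int_vec b) \<noteq> 0"
  shows "int_vec ` half_open_parallelogram a b = fundamental_domain (int_vec a) (int_vec b)"
proof -
  let ?D = "cross (int_vec a) (int_vec b)"
  have key: "z \<in> fundamental_domain (int_vec a) (int_vec b) \<longleftrightarrow> (\<exists>l m :: real. 0 \<le> l \<and> l < 1 \<and> 0 \<le> m \<and> m < 1 \<and>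
      real_of_int (fst z) = l * real (fst a) + m * real (fst b) \<and>
      real_of_int (snd z) = l * real (snd a) + m * real (snd b))" (is "_ \<longleftrightarrow> ?R") for z
  proof -
    define l m where "l = real_of_int (cross z (int_vec b)) / real_of_int ?D"
      and "m = real_of_int (cross (int_vec a) z) / real_of_int ?D"
    have box: "z \<in> fundamental_domain (int_vec a) (int_vec b) \<longleftrightarrow> 0 \<le> l \<and> l < 1 \<and> 0 \<le> m \<and> m < 1"
      by (auto simp: fundamental_domain_def div_eq_0_iff_unit_interval[OF D] l_def m_def)
    have Dr: "real_of_int ?D = real (fst a) * real (snd b) - real (snd a) * real (fst b)"
      by (simp add: cross_def int_vec_def)
    have D0: "real_of_int ?D \<noteq> 0" using D by simp
    have sol: "real_of_int (fst z) = l * real (fst a) + m * real (fst b)"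
      "real_of_int (snd z) = l * real (snd a) + m * real (snd b)"
    proof -
      have "real_of_int ?D * real_of_int (fst z) = real_of_int ?D * (l * real (fst a) + m * real (fst b))"
        using D0 by (simp add: l_def m_def distrib_left) (simp add: cross_def int_vec_def algebra_simps)
      then show "real_of_int (fst z) = l * real (fst a) + m * real (fst b)" using D0 by simp
      have "real_of_int ?D * real_of_int (snd z) = real_of_int ?D * (l * real (snd a) + m * real (snd b))"
        using D0 by (simp add: l_def m_def distrib_left) (simp add: cross_def int_vec_def algebra_simps)
      then show "real_of_int (snd z) = l * real (snd a) + m * real (snd b)" using D0 by simp
    qed
    show ?thesis
    proof
      assume "z \<in> fundamental_domain (int_vec a) (int_vec b)"
      then show ?R using box sol by blast
    next
      assume ?R
      then obtain l' m' where lm: "0 \<le> l'" "l' < 1" "0 \<le> m'" "m' < 1"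
        "real_of_int (fst z) = l' * real (fst a) + m' * real (fst b)"
        "real_of_int (snd z) = l' * real (snd a) + m' * real (snd b)" by blast
      have "real_of_int (cross z (int_vec b)) = l' * real_of_int ?D"
        "real_of_int (cross (int_vec a) z) = m' * real_of_int ?D"
        unfolding Dr by (simp_all add: cross_def int_vec_def lm algebra_simps)
      then have "l = l'" "m = m'" using D0 by (simp_all add: l_def m_def)
      then show "z \<in> fundamental_domain (int_vec a) (int_vec b)" using box lm by simp
    qed
  qed
  show ?thesis
  proof (intro equalityI subsetI)
    fix z assume "z \<in> int_vec ` half_open_parallelogram a b"
    then show "z \<in> fundamental_domain (int_vec a) (int_vec b)"
      unfolding key by (force simp: half_open_parallelogram_def int_vec_def real_vec_def)
  next
    fix z assume z: "z \<in> fundamental_domain (int_vec a) (int_vec b)"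
    then obtain l m :: real where lm: "0 \<le> l" "l < 1" "0 \<le> m" "m < 1"
        "real_of_int (fst z) = l * real (fst a) + m * real (fst b)"
        "real_of_int (snd z) = l * real (snd a) + m * real (snd b)"
      unfolding key by blast
    then have "0 \<le> real_of_int (fst z)" "0 \<le> real_of_int (snd z)" by simp_all
    then have nn: "0 \<le> fst z" "0 \<le> snd z" by simp_all
    define w where "w = (nat (fst z), nat (snd z))"
    have "int_vec w = z" using nn by (simp add: w_def int_vec_def)
    moreover have "w \<in> half_open_parallelogram a b"
      unfolding half_open_parallelogram_def mem_Collect_eq
      by (rule exI[of _ l], rule exI[of _ m]) (use lm nn in \<open>simp add: real_vec_def w_def\<close>)
    ultimately show "z \<in> int_vec ` half_open_parallelogram a b" by blast
  qed
qed

section \<open>Extremal rays\<close>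

lemma mem_ray_if_parallel:
  fixes x b :: "real \<times> real"
  assumes "0 \<le> fst x" "0 \<le> snd x" "0 \<le> fst b" "0 \<le> snd b" "b \<noteq> 0" "fst x * snd b = snd x * fst b"
  shows "x \<in> conic hull {b}"
proof -
  have pos: "fst b + snd b > 0" using assms by (auto simp: prod_eq_iff)
  define c where "c = (fst x + snd x) / (fst b + snd b)"
  have "c * fst b = fst x" "c * snd b = snd x"
    unfolding c_def using pos assms(6) by (simp_all add: field_simps)
  then have "x = c *\<^sub>R b" by (simp add: prod_eq_iff)
  moreover have "c \<ge> 0" using assms pos by (simp add: c_def)
  ultimately show ?thesis unfolding conic_hull_explicit by blast
qed

text \<open>On a common ray, minimality would make each generator smaller than the other.\<close>

lemma extremal_rays_not_parallel:
  assumes "extremal_ray S a" "extremal_ray S b" "a \<noteq> b"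
  shows "cross (int_vec a) (int_vec b) \<noteq> 0"
proof
  assume "cross (int_vec a) (int_vec b) = 0"
  then have "int (fst a * snd b) = int (snd a * fst b)" by (simp add: cross_def int_vec_def)
  then have *: "fst a * snd b = snd a * fst b" by (simp only: of_nat_eq_iff)
  then have r: "real (fst a) * real (snd b) = real (snd a) * real (fst b)"
    by (metis of_nat_mult)
  have nz: "real_vec a \<noteq> 0" "real_vec b \<noteq> 0"
    using assms by (auto simp: extremal_ray_def real_vec_def prod_eq_iff)
  have "real_vec a \<in> conic hull {real_vec b}" "real_vec b \<in> conic hull {real_vec a}"
    using nz r by (auto intro!: mem_ray_if_parallel simp: real_vec_def algebra_simps)
  then have "fst a \<le> fst b \<and> snd a \<le> snd b" "fst b \<le> fst a \<and> snd b \<le> snd a"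
    using assms unfolding extremal_ray_def by blast+
  then show False using assms(3) by (simp add: prod_eq_iff)
qed

text \<open>No point of the cone can be strictly beyond an extremal ray: if \<open>s\<close> and \<open>a\<close> were on opposite sides of
  the line through \<open>b\<close>, the segment from \<open>s\<close> to \<open>a\<close> would cross the ray of \<open>b\<close> in an inner point, and the
  face property would put \<open>s\<close> on that ray.\<close>

lemma extremal_ray_same_side:
  assumes b: "extremal_ray S b" and "a \<in> S" "s \<in> S"
  shows "0 \<le> cross (int_vec s) (int_vec b) * cross (int_vec a) (int_vec b)"
proof (rule ccontr)
  define \<mu> \<nu> where "\<mu> = real_of_int \<bar>cross (int_vec s) (int_vec b)\<bar>"
    and "\<nu> = real_of_int \<bar>cross (int_vec a) (int_vec b)\<bar>"
  assume neg: "\<not> ?thesis"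
  then have "cross (int_vec s) (int_vec b) \<noteq> 0" "cross (int_vec a) (int_vec b) \<noteq> 0" by force+
  then have pos: "\<mu> > 0" "\<nu> > 0" by (simp_all add: \<mu>_def \<nu>_def)
  have ne: "real_vec s \<noteq> real_vec a"
  proof
    assume "real_vec s = real_vec a"
    then have "s = a" by (simp add: real_vec_def prod_eq_iff)
    then show False using neg by simp
  qed
  define t where "t = \<mu> / (\<mu> + \<nu>)"
  define p where "p = (1 - t) *\<^sub>R real_vec s + t *\<^sub>R real_vec a"
  have t: "0 < t" "t < 1" "1 - t = \<nu> / (\<mu> + \<nu>)" using pos by (simp_all add: t_def field_simps)
  have seg: "p \<in> open_segment (real_vec s) (real_vec a)"
    unfolding in_segment using ne t by (auto simp: p_def)
  have sgn: "\<nu> * real_of_int (cross (int_vec s) (int_vec b)) + \<mu> * real_of_int (cross (int_vec a) (int_vec b)) = 0"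
    using neg by (auto simp: \<mu>_def \<nu>_def abs_if mult_less_0_iff not_le split: if_splits)
  have "(\<mu> + \<nu>) * (fst p * real (snd b) - snd p * real (fst b))
      = ((\<mu> + \<nu>) * (1 - t)) * real_of_int (cross (int_vec s) (int_vec b)) + ((\<mu> + \<nu>) * t) * real_of_int (cross (int_vec a) (int_vec b))"
    by (simp add: p_def real_vec_def cross_def int_vec_def algebra_simps)
  also have "\<dots> = 0" using sgn pos t by (simp add: t_def)
  finally have par: "fst p * real (snd b) = snd p * real (fst b)" using pos by simp
  have "0 \<le> fst p" "0 \<le> snd p" using t(1,2) by (simp_all add: p_def real_vec_def)
  moreover have "real_vec b \<noteq> 0"
    using b by (simp add: extremal_ray_def real_vec_def prod_eq_iff)
  ultimately have ray: "p \<in> conic hull {real_vec b}"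
    using par by (intro mem_ray_if_parallel) (simp_all add: real_vec_def)
  have face: "(conic hull {real_vec b}) face_of semigroup_cone S"
    using b by (simp add: extremal_ray_def)
  have "real_vec s \<in> semigroup_cone S" "real_vec a \<in> semigroup_cone S"
    unfolding semigroup_cone_def using assms by (auto intro!: hull_inc)
  then have "real_vec s \<in> conic hull {real_vec b}"
    using face_ofD[OF face seg] ray by blast
  then obtain c where "real_vec s = c *\<^sub>R real_vec b" unfolding conic_hull_explicit by blast
  then have "real (fst s) * real (snd b) = real (snd s) * real (fst b)"
    by (simp add: real_vec_def)
  then have "fst s * snd b = snd s * fst b" by (metis of_nat_mult of_nat_eq_iff)
  then have "cross (int_vec s) (int_vec b) = 0"
    unfolding cross_def int_vec_def by (metis fst_conv snd_conv of_nat_mult diff_self)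
  then show False using neg by simp
qed

definition scale :: "nat \<Rightarrow> nat \<times> nat \<Rightarrow> nat \<times> nat" where
  "scale n a = (n * fst a, n * snd a)"

lemma scale_simps [simp]: "scale 0 a = 0" "scale n 0 = 0" "scale (Suc 0) a = a" "scale 1 a = a"
  "fst (scale n a) = n * fst a" "snd (scale n a) = n * snd a"
  by (simp_all add: scale_def prod_eq_iff)

lemma scale_Suc: "scale (Suc n) a = a + scale n a"
  by (simp add: scale_def prod_eq_iff)

lemma scale_add: "scale (m + n) a = scale m a + scale n a" "scale n (a + b) = scale n a + scale n b"
  by (simp_all add: scale_def prod_eq_iff algebra_simps)

lemma scale_scale: "scale m (scale n a) = scale (m * n) a"
  by (simp add: scale_def)

lemma int_vec_simps [simp]: "int_vec a = int_vec b \<longleftrightarrow> a = b" "int_vec (a + b) = int_vec a + int_vec b"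
  "fst (int_vec a) = int (fst a)" "snd (int_vec a) = int (snd a)"
  by (auto simp: int_vec_def prod_eq_iff)

section \<open>Simplicial semigroups and their Apery sets\<close>

text \<open>The assumption \<open>multiple\<close> says in integral terms that \<open>a\<close> and \<open>b\<close> generate the cone of \<open>S\<close>. The locale is
  symmetric in \<open>a\<close> and \<open>b\<close>, so every fact proved about \<open>a\<close> can be reused for \<open>b\<close>.\<close>

locale simplicial_semigroup =
  fixes S :: "(nat \<times> nat) set" and a b :: "nat \<times> nat"
  assumes fg: "affine_semigroup S" and a_S: "a \<in> S" and b_S: "b \<in> S"
    and det: "cross (int_vec a) (int_vec b) \<noteq> 0"
    and multiple: "s \<in> S \<Longrightarrow> \<exists>k>0. \<exists>i j. scale k s = scale i a + scale j b"

text \<open>Cramer's rule writes \<open>D s\<close> as an integral combination of \<open>a\<close> and \<open>b\<close>; multiplying once more by the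
  determinant \<open>D\<close> makes both coefficients nonnegative.\<close>

lemma extremal_rays_simplicial:
  assumes "affine_semigroup S" "extremal_ray S a" "extremal_ray S b" "a \<noteq> b"
  shows "simplicial_semigroup S a b"
proof
  have ab: "a \<in> S" "b \<in> S" using assms by (auto simp: extremal_ray_def)
  then show "a \<in> S" "b \<in> S" .
  let ?D = "cross (int_vec a) (int_vec b)"
  show D: "?D \<noteq> 0" using extremal_rays_not_parallel assms by blast
  fix s assume s: "s \<in> S"
  define i j where "i = cross (int_vec s) (int_vec b) * ?D" and "j = cross (int_vec a) (int_vec s) * ?D"
  have i: "i \<ge> 0" unfolding i_def using extremal_ray_same_side assms ab s by blast
  have "0 \<le> cross (int_vec s) (int_vec a) * cross (int_vec b) (int_vec a)"
    using extremal_ray_same_side assms ab s by blast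
  also have "\<dots> = j" unfolding j_def cross_def by (simp add: algebra_simps)
  finally have j: "j \<ge> 0" .
  have *: "?D * ?D * int (fst s) = i * int (fst a) + j * int (fst b)"
    "?D * ?D * int (snd s) = i * int (snd a) + j * int (snd b)"
    unfolding i_def j_def by (simp_all add: cross_def algebra_simps)
  have DD: "?D * ?D > 0" using D by (metis not_real_square_gt_zero not_square_less_zero linorder_neqE_linordered_idom mult_eq_0_iff)
  have "int (nat (?D * ?D) * fst s) = int (nat i * fst a + nat j * fst b)"
    "int (nat (?D * ?D) * snd s) = int (nat i * snd a + nat j * snd b)"
    using * i j DD by (simp_all del: zero_less_mult_iff)
  then have "scale (nat (?D * ?D)) s = scale (nat i) a + scale (nat j) b"
    unfolding of_nat_eq_iff by (simp add: prod_eq_iff)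
  then show "\<exists>k>0. \<exists>i j. scale k s = scale i a + scale j b"
    using DD by (intro exI[of _ "nat (?D * ?D)"]) auto
qed (use assms in auto)

context simplicial_semigroup
begin

lemma swap: "simplicial_semigroup S b a"
proof
  show "cross (int_vec b) (int_vec a) \<noteq> 0" using det by (simp add: cross_def algebra_simps)
  fix s assume "s \<in> S"
  then show "\<exists>k>0. \<exists>i j. scale k s = scale i b + scale j a" using multiple by (metis add.commute)
qed (use fg a_S b_S in auto)

lemma zero_S [simp]: "0 \<in> S" and add_S: "s \<in> S \<Longrightarrow> t \<in> S \<Longrightarrow> s + t \<in> S"
  using fg by (auto simp: affine_semigroup_def intro: generated_monoid.intros)

lemma scale_S: "s \<in> S \<Longrightarrow> scale n s \<in> S"
  by (induction n) (auto simp: scale_Suc add_S)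

lemma comb_S: "s \<in> S \<Longrightarrow> s + scale i a + scale j b \<in> S"
  by (intro add_S scale_S a_S b_S)

lemma nonzero: "a \<noteq> 0" "b \<noteq> 0"
  using det by (auto simp: cross_def)

lemma independent:
  assumes "i * fst (int_vec a) + j * fst (int_vec b) = 0" "i * snd (int_vec a) + j * snd (int_vec b) = 0"
  shows "i = 0" "j = 0"
proof -
  have "i * cross (int_vec a) (int_vec b) = (i * fst (int_vec a) + j * fst (int_vec b)) * snd (int_vec b)
      - (i * snd (int_vec a) + j * snd (int_vec b)) * fst (int_vec b)"
    by (simp add: cross_def algebra_simps)
  then show "i = 0" using det assms by simp
  have "j * cross (int_vec a) (int_vec b) = (i * snd (int_vec a) + j * snd (int_vec b)) * fst (int_vec a)
      - (i * fst (int_vec a) + j * fst (int_vec b)) * snd (int_vec a)"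
    by (simp add: cross_def algebra_simps)
  then show "j = 0" using det assms by simp
qed

abbreviation Ap where "Ap \<equiv> apery_set S {a, b}"

lemma mem_Ap_iff: "w \<in> Ap \<longleftrightarrow> w \<in> S \<and> (\<forall>s\<in>S. w \<noteq> s + a \<and> w \<noteq> s + b)"
proof -
  have "int_vec w - int_vec e \<in> int_vec ` S \<longleftrightarrow> (\<exists>s\<in>S. w = s + e)" for e
    by (auto simp: diff_eq_eq image_iff simp flip: int_vec_simps(2))
  then show ?thesis by (auto simp: apery_set_def)
qed

lemma apery_decomposition:
  assumes "s \<in> S"
  shows "\<exists>w\<in>Ap. \<exists>i j. s = w + scale i a + scale j b"
  using assms
proof (induction "fst s + snd s" arbitrary: s rule: less_induct)
  case less
  show ?case
  proof (cases "s \<in> Ap")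
    case True
    then show ?thesis by (intro bexI[of _ s] exI[of _ 0]) auto
  next
    case False
    then obtain t e where t: "t \<in> S" "s = t + e" "e = a \<or> e = b"
      using less.prems unfolding mem_Ap_iff by blast
    have "fst e + snd e > 0" using t nonzero by (auto simp: prod_eq_iff)
    then have "fst t + snd t < fst s + snd s" using t by simp
    then obtain w i j where w: "w \<in> Ap" "t = w + scale i a + scale j b" using less.hyps t by blast
    have "s = w + scale (Suc i) a + scale j b \<or> s = w + scale i a + scale (Suc j) b"
      using t w by (auto simp: scale_Suc algebra_simps)
    then show ?thesis using w(1) by blast
  qed
qed

text \<open>Each generator \<open>g\<close> has a multiple \<open>k g\<close> in \<open>\<nat>a + \<nat>b\<close>, so its coefficient may be reduced modulo \<open>k\<close>.\<close>

lemma finite_representatives: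
  "finite A \<Longrightarrow> A \<subseteq> S \<Longrightarrow>
   \<exists>F. finite F \<and> F \<subseteq> S \<and> (\<forall>s\<in>generated_monoid A. \<exists>f\<in>F. \<exists>i j. s = f + scale i a + scale j b)"
proof (induction A rule: finite_induct)
  case empty
  have "s = 0" if "s \<in> generated_monoid {}" for s :: "nat \<times> nat"
    using that by induction auto
  then show ?case by (intro exI[of _ "{0}"]) (auto intro!: exI[of _ 0])
next
  case (insert g A)
  then obtain F where F: "finite F" "F \<subseteq> S"
    "\<And>s. s \<in> generated_monoid A \<Longrightarrow> \<exists>f\<in>F. \<exists>i j. s = f + scale i a + scale j b"
    by auto
  from insert have g: "g \<in> S" by simp
  obtain k i0 j0 where k: "k > 0" "scale k g = scale i0 a + scale j0 b" using multiple[OF g] by blast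
  have split: "\<exists>n. \<exists>t\<in>generated_monoid A. s = scale n g + t" if "s \<in> generated_monoid (insert g A)" for s
    using that
  proof induction
    case zero
    show ?case by (intro exI[of _ 0] bexI[of _ 0]) (auto intro: generated_monoid.intros)
  next
    case (incl x)
    show ?case
    proof (cases "x = g")
      case True
      then show ?thesis by (intro exI[of _ 1] bexI[of _ 0]) (auto intro: generated_monoid.intros)
    next
      case False
      then show ?thesis using incl by (intro exI[of _ 0] bexI[of _ x]) (auto intro: generated_monoid.intros)
    qed
  next
    case (plus x y)
    then obtain n t n' t' where "t \<in> generated_monoid A" "x = scale n g + t"
      "t' \<in> generated_monoid A" "y = scale n' g + t'" by blast
    then show ?case
      by (intro exI[of _ "n + n'"] bexI[of _ "t + t'"])
         (auto simp: scale_add algebra_simps intro: generated_monoid.intros)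
  qed
  define F' where "F' = (\<lambda>(r, f). scale r g + f) ` ({..<k} \<times> F)"
  show ?case
  proof (intro exI[of _ F'] conjI ballI)
    show "finite F'" "F' \<subseteq> S" using F g by (auto simp: F'_def intro!: add_S scale_S)
    fix s assume "s \<in> generated_monoid (insert g A)"
    then obtain n t where nt: "t \<in> generated_monoid A" "s = scale n g + t" using split by blast
    then obtain f i j where f: "f \<in> F" "t = f + scale i a + scale j b" using F by blast
    let ?q = "n div k"
    have "scale n g = scale (n mod k) g + scale ?q (scale k g)"
      by (simp add: scale_scale flip: scale_add)
    then have "s = (scale (n mod k) g + f) + scale (i + ?q * i0) a + scale (j + ?q * j0) b"
      unfolding nt f k(2) by (simp add: scale_add scale_scale algebra_simps)
    moreover have "scale (n mod k) g + f \<in> F'" using f k by (force simp: F'_def)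
    ultimately show "\<exists>f\<in>F'. \<exists>i j. s = f + scale i a + scale j b" by blast
  qed
qed

lemma finite_Ap: "finite Ap"
proof -
  obtain A where A: "finite A" "S = generated_monoid A" using fg by (auto simp: affine_semigroup_def)
  then have "A \<subseteq> S" by (auto intro: generated_monoid.intros)
  then obtain F where F: "finite F" "F \<subseteq> S" "\<forall>s\<in>S. \<exists>f\<in>F. \<exists>i j. s = f + scale i a + scale j b"
    using finite_representatives[of A] A by blast
  have "Ap \<subseteq> F"
  proof
    fix w assume w: "w \<in> Ap"
    then obtain f i j where f: "f \<in> F" "w = f + scale i a + scale j b"
      using F by (auto simp: mem_Ap_iff)
    have "i = 0"
    proof (rule ccontr)
      assume "i \<noteq> 0"
      then obtain i' where "i = Suc i'" by (cases i) auto
      then have "w = (f + scale i' a + scale j b) + a" using f by (simp add: scale_Suc algebra_simps)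
      then show False using w comb_S[of f i' j] f F unfolding mem_Ap_iff by blast
    qed
    moreover have "j = 0"
    proof (rule ccontr)
      assume "j \<noteq> 0"
      then obtain j' where "j = Suc j'" by (cases j) auto
      then have "w = (f + scale i a + scale j' b) + b" using f by (simp add: scale_Suc algebra_simps)
      then show False using w comb_S[of f i j'] f F unfolding mem_Ap_iff by blast
    qed
    ultimately show "w \<in> F" using f by simp
  qed
  then show ?thesis using F finite_subset by blast
qed

text \<open>If \<open>z = s - a = t - b\<close> in \<open>\<int>\<^sup>2\<close>, then \<open>z \<in> S\<close>. Written with \<open>s = z + a\<close> and \<open>t = z + b\<close>, the condition
  avoids subtraction.\<close>

definition depth_condition where
  "depth_condition \<longleftrightarrow> (\<forall>s\<in>S. \<forall>t\<in>S. s + b = t + a \<longrightarrow> (\<exists>z\<in>S. s = z + a))"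

lemma depth_condition_iterate:
  assumes depth_condition "s \<in> S" "t \<in> S" "s + scale n b = t + a"
  shows "\<exists>z\<in>S. s = z + a"
  using assms(3,4)
proof (induction n arbitrary: t)
  case 0
  then show ?case by auto
next
  case (Suc n)
  have "(s + scale n b) + b = t + a" using Suc.prems by (simp add: scale_Suc algebra_simps)
  moreover have "s + scale n b \<in> S" by (intro add_S scale_S assms b_S)
  ultimately obtain z where "z \<in> S" "s + scale n b = z + a"
    using assms(1) Suc.prems(1) unfolding depth_condition_def by blast
  then show ?case by (rule Suc.IH)
qed

abbreviation red where "red \<equiv> reduce (int_vec a) (int_vec b)"
abbreviation cong where "cong \<equiv> lattice_cong (int_vec a) (int_vec b)"

text \<open>Let \<open>v - w = i a + j b\<close> with \<open>v\<close>, \<open>w\<close> in the Apery set. Coefficients of equal sign contradict minimality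
  directly; for opposite signs, \<open>v + \<bar>j\<bar> b = w + i a\<close> and the condition lets \<open>a\<close> be subtracted from \<open>v\<close>.\<close>

lemma depth_condition_imp_inj:
  assumes depth_condition
  shows "inj_on (\<lambda>w. red (int_vec w)) Ap"
proof (rule inj_onI)
  fix v w assume vw: "v \<in> Ap" "w \<in> Ap" and "red (int_vec v) = red (int_vec w)"
  then have "cong (int_vec v) (int_vec w)" using reduce_eq_iff[OF det] by simp
  then obtain i j where "fst (int_vec v) = fst (int_vec w) + i * fst (int_vec a) + j * fst (int_vec b)"
      "snd (int_vec v) = snd (int_vec w) + i * snd (int_vec a) + j * snd (int_vec b)"
    unfolding lattice_cong_def by blast
  then have ij: "int (fst v) = int (fst w) + i * int (fst a) + j * int (fst b)"
     "int (snd v) = int (snd w) + i * int (snd a) + j * int (snd b)" by simp_all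
  have pos: False if "v \<in> Ap" "w \<in> Ap" "v = w + scale i a + scale j b" "i > 0 \<or> j > 0" for v w i j
  proof -
    have "v = (w + scale (i - 1) a + scale j b) + a \<or> v = (w + scale i a + scale (j - 1) b) + b"
      using that by (cases i; cases j) (auto simp: scale_Suc algebra_simps)
    moreover have "w \<in> S" using that by (simp add: mem_Ap_iff)
    ultimately show False using that(1) comb_S[of w "i - 1" j] comb_S[of w i "j - 1"]
      unfolding mem_Ap_iff by blast
  qed
  have mixed: False if "v \<in> Ap" "w \<in> Ap" "v + scale j b = w + scale i a" "i > 0" for v w i j
  proof -
    have "v + scale j b = (w + scale (i - 1) a) + a"
      using that by (cases i) (auto simp: scale_Suc algebra_simps)
    moreover have "v \<in> S" "w + scale (i - 1) a \<in> S"
      using that by (simp_all add: mem_Ap_iff add_S scale_S a_S)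
    ultimately have "\<exists>z\<in>S. v = z + a" using depth_condition_iterate[OF assms] by blast
    then show False using that(1) unfolding mem_Ap_iff by blast
  qed
  consider "i \<ge> 0" "j \<ge> 0" | "i \<le> 0" "j \<le> 0" | "i > 0" "j < 0" | "i < 0" "j > 0" by linarith
  then show "v = w"
  proof cases
    case 1
    then have "int (fst v) = int (fst w + nat i * fst a + nat j * fst b)"
       "int (snd v) = int (snd w + nat i * snd a + nat j * snd b)" using ij by simp_all
    then have eq: "v = w + scale (nat i) a + scale (nat j) b"
      unfolding of_nat_eq_iff by (simp add: prod_eq_iff)
    have "\<not> (nat i > 0 \<or> nat j > 0)" by (rule notI) (rule pos[OF vw eq])
    then have "nat i = 0 \<and> nat j = 0" by simp
    then show ?thesis using eq by simp
  next
    case 2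
    then have "int (fst w) = int (fst v + nat (-i) * fst a + nat (-j) * fst b)"
       "int (snd w) = int (snd v + nat (-i) * snd a + nat (-j) * snd b)" using ij by simp_all
    then have eq: "w = v + scale (nat (-i)) a + scale (nat (-j)) b"
      unfolding of_nat_eq_iff by (simp add: prod_eq_iff)
    have "\<not> (nat (-i) > 0 \<or> nat (-j) > 0)" by (rule notI) (rule pos[OF vw(2,1) eq])
    then have "nat (-i) = 0 \<and> nat (-j) = 0" by simp
    then show ?thesis using eq by simp
  next
    case 3
    then have "int (fst v + nat (-j) * fst b) = int (fst w + nat i * fst a)"
       "int (snd v + nat (-j) * snd b) = int (snd w + nat i * snd a)" using ij by simp_all
    then have "v + scale (nat (-j)) b = w + scale (nat i) a"
      unfolding of_nat_eq_iff by (simp add: prod_eq_iff)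
    then show ?thesis using mixed[of v w "nat (-j)" "nat i"] vw 3 by simp
  next
    case 4
    then have "int (fst w + nat j * fst b) = int (fst v + nat (-i) * fst a)"
       "int (snd w + nat j * snd b) = int (snd v + nat (-i) * snd a)" using ij by simp_all
    then have "w + scale (nat j) b = v + scale (nat (-i)) a"
      unfolding of_nat_eq_iff by (simp add: prod_eq_iff)
    then show ?thesis using mixed[of w v "nat j" "nat (-i)"] vw 4 by simp
  qed
qed

text \<open>Decompose \<open>s = z + a\<close> and \<open>t = z + b\<close> over the Apery set. Their Apery parts are congruent, hence
  equal, and comparing coefficients shows that \<open>a\<close> occurs in the decomposition of \<open>s\<close>.\<close>

lemma inj_imp_depth_condition:
  assumes inj: "inj_on (\<lambda>w. red (int_vec w)) Ap"
  shows depth_condition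
  unfolding depth_condition_def
proof (intro ballI impI)
  fix s t assume st: "s \<in> S" "t \<in> S" "s + b = t + a"
  obtain w i j where w: "w \<in> Ap" "s = w + scale i a + scale j b"
    using apery_decomposition st by blast
  obtain w' i' j' where w': "w' \<in> Ap" "t = w' + scale i' a + scale j' b"
    using apery_decomposition st by blast
  have rel: "fst w + i * fst a + Suc j * fst b = fst w' + Suc i' * fst a + j' * fst b"
     "snd w + i * snd a + Suc j * snd b = snd w' + Suc i' * snd a + j' * snd b"
    using st(3) unfolding w(2) w'(2) by (simp_all add: prod_eq_iff algebra_simps)
  have rel': "int (fst w) + int i * int (fst a) + int (Suc j) * int (fst b) = int (fst w') + int (Suc i') * int (fst a) + int j' * int (fst b)"
     "int (snd w) + int i * int (snd a) + int (Suc j) * int (snd b) = int (snd w') + int (Suc i') * int (snd a) + int j' * int (snd b)"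
    using arg_cong[OF rel(1), of int] arg_cong[OF rel(2), of int]
    by (simp_all only: of_nat_add of_nat_mult)
  then have "cong (int_vec w) (int_vec w')"
    unfolding lattice_cong_def
    by (intro exI[of _ "int (Suc i') - int i"] exI[of _ "int j' - int (Suc j)"]) (simp add: algebra_simps)
  then have "w = w'" using inj_onD[OF inj] w w' reduce_eq_iff[OF det] by blast
  then have "(int i - int (Suc i')) * fst (int_vec a) + (int (Suc j) - int j') * fst (int_vec b) = 0"
    "(int i - int (Suc i')) * snd (int_vec a) + (int (Suc j) - int j') * snd (int_vec b) = 0"
    using rel' by (simp_all add: algebra_simps)
  then have "int i - int (Suc i') = 0" by (rule independent(1))
  then have "i = Suc i'" by simp
  then have "s = (w + scale i' a + scale j b) + a" using w by (simp add: scale_Suc algebra_simps)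
  moreover have "w + scale i' a + scale j b \<in> S" using w comb_S by (simp add: mem_Ap_iff)
  ultimately show "\<exists>z\<in>S. s = z + a" by blast
qed

lemma difference_group_lattice_cong:
  assumes "z \<in> difference_group S" "cong z' z"
  shows "z' \<in> difference_group S"
proof -
  obtain s t where st: "s \<in> S" "t \<in> S" "z = int_vec s - int_vec t"
    using assms by (auto simp: difference_group_def)
  obtain i j where ij: "fst z' = fst z + i * int (fst a) + j * int (fst b)" "snd z' = snd z + i * int (snd a) + j * int (snd b)"
    using assms(2) by (auto simp: lattice_cong_def)
  have "i = int (nat i) - int (nat (-i))" "j = int (nat j) - int (nat (-j))" by simp_all
  then have "fst z' = fst z + (int (nat i) - int (nat (-i))) * int (fst a) + (int (nat j) - int (nat (-j))) * int (fst b)"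
     "snd z' = snd z + (int (nat i) - int (nat (-i))) * int (snd a) + (int (nat j) - int (nat (-j))) * int (snd b)"
    using ij by presburger+
  then have "z' = int_vec (s + scale (nat i) a + scale (nat j) b) - int_vec (t + scale (nat (-i)) a + scale (nat (-j)) b)"
    using st by (simp add: prod_eq_iff algebra_simps)
  moreover have "s + scale (nat i) a + scale (nat j) b \<in> S" "t + scale (nat (-i)) a + scale (nat (-j)) b \<in> S"
    using st comb_S by auto
  ultimately show ?thesis unfolding difference_group_def by blast
qed

text \<open>For surjectivity, an element \<open>s - t\<close> of the difference group is congruent to \<open>s + (k - 1) t \<in> S\<close>, where
  \<open>k t \<in> \<nat>a + \<nat>b\<close>; its Apery part is the required preimage.\<close>

lemma red_Ap_image: "(\<lambda>w. red (int_vec w)) ` Ap = fundamental_domain (int_vec a) (int_vec b) \<inter> difference_group S"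
proof (intro equalityI subsetI)
  fix z assume "z \<in> (\<lambda>w. red (int_vec w)) ` Ap"
  then obtain w where w: "w \<in> S" "z = red (int_vec w)" by (auto simp: mem_Ap_iff)
  have "int_vec w = int_vec w - int_vec 0" by (simp add: int_vec_def)
  then have "int_vec w \<in> difference_group S" using w(1) zero_S unfolding difference_group_def by blast
  then show "z \<in> fundamental_domain (int_vec a) (int_vec b) \<inter> difference_group S"
    using w(2) reduce_in_fundamental_domain[OF det] difference_group_lattice_cong
      lattice_cong_sym[OF lattice_cong_reduce] by blast
next
  fix z assume z: "z \<in> fundamental_domain (int_vec a) (int_vec b) \<inter> difference_group S"
  then obtain s t where st: "s \<in> S" "t \<in> S" "z = int_vec s - int_vec t"
    by (auto simp: difference_group_def)
  obtain k i j where k: "k > 0" "scale k t = scale i a + scale j b" using multiple st by blast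
  then obtain k' where k': "k = Suc k'" by (cases k) auto
  have "s + scale k' t \<in> S" by (intro add_S scale_S st)
  then obtain w i' j' where w: "w \<in> Ap" "s + scale k' t = w + scale i' a + scale j' b"
    using apery_decomposition by blast
  have "t + scale k' t = scale i a + scale j b" using k k' by (simp add: scale_Suc)
  then have t: "fst t + k' * fst t = i * fst a + j * fst b" "snd t + k' * snd t = i * snd a + j * snd b"
    by (simp_all add: prod_eq_iff)
  have s: "fst s + k' * fst t = fst w + i' * fst a + j' * fst b" "snd s + k' * snd t = snd w + i' * snd a + j' * snd b"
    using w(2) by (simp_all add: prod_eq_iff)
  note ints = arg_cong[OF t(1), of int] arg_cong[OF t(2), of int] arg_cong[OF s(1), of int] arg_cong[OF s(2), of int]
  have "fst z = fst (int_vec w) + (int i' - int i) * fst (int_vec a) + (int j' - int j) * fst (int_vec b)"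
    "snd z = snd (int_vec w) + (int i' - int i) * snd (int_vec a) + (int j' - int j) * snd (int_vec b)"
    using ints unfolding st(3) of_nat_add of_nat_mult by (simp_all add: algebra_simps)
  then have "cong z (int_vec w)"
    unfolding lattice_cong_def by blast
  then have "red (int_vec w) = red z" using reduce_eq_iff[OF det] lattice_cong_sym by blast
  also have "red z = z"
    using z fundamental_domain_cong_imp_eq[OF det reduce_in_fundamental_domain[OF det]] lattice_cong_sym[OF lattice_cong_reduce] by blast
  finally show "z \<in> (\<lambda>w. red (int_vec w)) ` Ap" using w(1) by force
qed

theorem count_iff_depth_condition:
  "int (card Ap) + int (card (int_vec ` half_open_parallelogram a b - difference_group S)) =
    \<bar>cross (int_vec a) (int_vec b)\<bar> \<longleftrightarrow> depth_condition"
proof -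
  let ?B = "fundamental_domain (int_vec a) (int_vec b)" and ?G = "difference_group S"
  have B: "finite ?B" "int (card ?B) = \<bar>cross (int_vec a) (int_vec b)\<bar>" using card_fundamental_domain[OF det] by auto
  have "card ?B = card (?B \<inter> ?G) + card (?B - ?G)"
    using B(1) by (metis card_Int_Diff)
  then have "int (card Ap) + int (card (?B - ?G)) = \<bar>cross (int_vec a) (int_vec b)\<bar> \<longleftrightarrow> card Ap = card (?B \<inter> ?G)"
    using B(2) by linarith
  also have "\<dots> \<longleftrightarrow> inj_on (\<lambda>w. red (int_vec w)) Ap"
    unfolding red_Ap_image[symmetric] using finite_Ap by (metis card_image eq_card_imp_inj_on)
  also have "\<dots> \<longleftrightarrow> depth_condition" using depth_condition_imp_inj inj_imp_depth_condition by blast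
  finally show ?thesis by (simp add: int_vec_parallelogram[OF det])
qed

end

section \<open>Polynomials with exponents in the plane\<close>

text \<open>The lexicographic order on exponents is compatible with addition. It turns \<open>K[x, y]\<close> into an
  integral domain and provides leading monomials.\<close>

instance prod :: ("{ordered_cancel_comm_monoid_add, linorder}", "{ordered_cancel_comm_monoid_add, linorder}")
    ordered_cancel_comm_monoid_add
  by standard (auto simp: less_eq_prod_def add_strict_left_mono add_left_mono)

type_synonym 'k plane_poly = "(nat \<times> nat) \<Rightarrow>\<^sub>0 'k"

abbreviation const :: "'k::field \<Rightarrow> 'k plane_poly" where "const c \<equiv> Poly_Mapping.single 0 c"
abbreviation mon :: "nat \<times> nat \<Rightarrow> 'k::field plane_poly" where "mon s \<equiv> Poly_Mapping.single s 1"

lemma mon_power: "mon a ^ n = mon (scale n a)"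
  by (induction n) (simp_all add: mult_single scale_Suc)

lemma poly_mapping_eq_sum_single: "p = (\<Sum>s\<in>Poly_Mapping.keys p. Poly_Mapping.single s (Poly_Mapping.lookup p s))"
  by (rule poly_mapping_eqI)
     (simp add: lookup_sum lookup_single when_def in_keys_iff)

lemma lookup_single_mult:
  fixes p :: "'k::field plane_poly"
  shows "Poly_Mapping.lookup (Poly_Mapping.single s c * p) (s + u) = c * Poly_Mapping.lookup p u"
proof -
  have "Poly_Mapping.single s c * p
      = (\<Sum>t\<in>Poly_Mapping.keys p. Poly_Mapping.single (s + t) (c * Poly_Mapping.lookup p t))"
    by (subst poly_mapping_eq_sum_single[of p]) (simp add: sum_distrib_left mult_single)
  then show ?thesis
    by (simp add: lookup_sum lookup_single when_def in_keys_iff)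
qed

lemma lookup_single_mult_outside:
  fixes p :: "'k::field plane_poly"
  assumes "\<And>u. u \<in> Poly_Mapping.keys p \<Longrightarrow> v \<noteq> s + u"
  shows "Poly_Mapping.lookup (Poly_Mapping.single s c * p) v = 0"
proof (rule ccontr)
  assume "\<not> ?thesis"
  then have "v \<in> Poly_Mapping.keys (Poly_Mapping.single s c * p)" by (simp add: in_keys_iff)
  then obtain x y where "x \<in> Poly_Mapping.keys (Poly_Mapping.single s c)" "y \<in> Poly_Mapping.keys p" "v = x + y"
    using keys_mult[of "Poly_Mapping.single s c" p] by blast
  then show False using assms[of y] by (auto split: if_splits)
qed

lemma lookup_mult_0:
  fixes p q :: "'k::field plane_poly"
  shows "Poly_Mapping.lookup (p * q) 0 = Poly_Mapping.lookup p 0 * Poly_Mapping.lookup q 0"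
proof -
  have "Poly_Mapping.lookup (Poly_Mapping.single s c * q) 0
      = (if s = 0 then c * Poly_Mapping.lookup q 0 else 0)" for s c
  proof (cases "s = 0")
    case False
    then have "0 \<noteq> s + u" for u by (auto simp: prod_eq_iff)
    then show ?thesis using lookup_single_mult_outside[of q 0 s c] False by simp
  qed (use lookup_single_mult[of 0 c q 0] in simp)
  then show ?thesis
    by (subst poly_mapping_eq_sum_single[of p])
       (simp add: sum_distrib_right lookup_sum in_keys_iff)
qed

lemma keys_mon_mult:
  fixes p :: "'k::field plane_poly"
  assumes "c \<noteq> 0"
  shows "Poly_Mapping.keys (Poly_Mapping.single s c * p) = (+) s ` Poly_Mapping.keys p"
proof (intro equalityI subsetI)
  fix v assume "v \<in> Poly_Mapping.keys (Poly_Mapping.single s c * p)"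
  then show "v \<in> (+) s ` Poly_Mapping.keys p"
    using lookup_single_mult_outside[of p v s c] by (force simp: in_keys_iff)
next
  fix v assume "v \<in> (+) s ` Poly_Mapping.keys p"
  then show "v \<in> Poly_Mapping.keys (Poly_Mapping.single s c * p)"
    using assms by (auto simp: in_keys_iff lookup_single_mult)
qed

section \<open>Evaluation of polynomials through a coefficient homomorphism\<close>

definition ring_map :: "('c::comm_ring_1 \<Rightarrow> 'd::comm_ring_1) \<Rightarrow> bool" where
  "ring_map h \<longleftrightarrow> h 1 = 1 \<and> (\<forall>x y. h (x + y) = h x + h y) \<and> (\<forall>x y. h (x * y) = h x * h y)"

definition eval_hom :: "('c::comm_ring_1 \<Rightarrow> 'd::comm_ring_1) \<Rightarrow> 'd \<Rightarrow> 'c poly \<Rightarrow> 'd" where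
  "eval_hom h x p = poly (map_poly h p) x"

lemma ring_map_0: "ring_map h \<Longrightarrow> h 0 = 0"
  by (metis add_cancel_right_right add.right_neutral ring_map_def)

lemma ring_map_simps:
  assumes "ring_map h"
  shows "h 0 = 0" "h 1 = 1" "h (x + y) = h x + h y" "h (x * y) = h x * h y" "h (- x) = - h x"
    "h (x - y) = h x - h y" "h (x ^ n) = h x ^ n" "h (sum f A) = (\<Sum>a\<in>A. h (f a))"
proof -
  show 0: "h 0 = 0" using assms by (rule ring_map_0)
  show 1: "h 1 = 1" and a: "h (x + y) = h x + h y" and m: "h (x * y) = h x * h y" for x y
    using assms by (simp_all add: ring_map_def)
  show neg: "h (- x) = - h x" for x using a[of "-x" x] 0 by (simp add: eq_neg_iff_add_eq_0)
  show "h (x - y) = h x - h y" using a[of x "-y"] neg by simp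
  show "h (x ^ n) = h x ^ n" by (induction n) (simp_all add: 1 m)
  show "h (sum f A) = (\<Sum>a\<in>A. h (f a))"
    by (induction A rule: infinite_finite_induct) (simp_all add: 0 a)
qed

lemma eval_hom_pCons: "ring_map h \<Longrightarrow> eval_hom h x (pCons c p) = h c + x * eval_hom h x p"
  by (simp add: eval_hom_def map_poly_pCons ring_map_0)

lemma eval_hom_0 [simp]: "eval_hom h x 0 = 0"
  by (simp add: eval_hom_def)

lemma eval_hom_monom: "ring_map h \<Longrightarrow> eval_hom h x (Polynomial.monom c n) = h c * x ^ n"
  by (simp add: eval_hom_def map_poly_monom ring_map_0 poly_monom)

lemma ring_map_eval_hom:
  assumes h: "ring_map h"
  shows "ring_map (eval_hom h x)"
proof -
  have add: "eval_hom h x (p + q) = eval_hom h x p + eval_hom h x q" for p q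
    by (induction p q rule: poly_induct2)
       (simp_all add: eval_hom_pCons[OF h] ring_map_simps[OF h] algebra_simps)
  have smult: "eval_hom h x (smult c p) = h c * eval_hom h x p" for c p
    by (induction p) (simp_all add: eval_hom_pCons[OF h] ring_map_simps[OF h] algebra_simps)
  have "eval_hom h x (p * q) = eval_hom h x p * eval_hom h x q" for p q
    by (induction p)
       (simp_all add: eval_hom_pCons[OF h] ring_map_simps[OF h] add smult algebra_simps)
  moreover have "eval_hom h x 1 = 1"
    by (simp add: one_pCons eval_hom_pCons[OF h] ring_map_simps[OF h])
  ultimately show ?thesis using add by (simp add: ring_map_def)
qed

lemma eval_hom_const: "ring_map h \<Longrightarrow> eval_hom h x [:c:] = h c"
  by (simp add: eval_hom_pCons)

lemma eval_hom_altdef: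
  "ring_map h \<Longrightarrow> eval_hom h x p = (\<Sum>i\<le>Polynomial.degree p. h (Polynomial.coeff p i) * x ^ i)"
proof -
  assume h: "ring_map h"
  have "eval_hom h x p = eval_hom h x (\<Sum>i\<le>Polynomial.degree p. Polynomial.monom (Polynomial.coeff p i) i)"
    by (simp add: poly_as_sum_of_monoms)
  also have "\<dots> = (\<Sum>i\<le>Polynomial.degree p. h (Polynomial.coeff p i) * x ^ i)"
    by (simp add: ring_map_simps[OF ring_map_eval_hom[OF h]] eval_hom_monom[OF h])
  finally show ?thesis .
qed

lemma ring_map_const: "ring_map (Poly_Mapping.single 0 :: 'k::field \<Rightarrow> 'k plane_poly)"
  by (simp add: ring_map_def single_add mult_single)

section \<open>Algebraic dependence\<close>

lemma (in vector_space) dependent_family: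
  assumes "finite I" "finite T" "card T < card I" "e ` I \<subseteq> span T"
  shows "\<exists>c :: _ \<Rightarrow> 'a. (\<exists>i\<in>I. c i \<noteq> 0) \<and> (\<Sum>i\<in>I. scale (c i) (e i)) = 0"
proof (cases "inj_on e I")
  case True
  then have "card (e ` I) = card I" by (rule card_image)
  then have "dependent (e ` I)"
    using independent_span_bound[OF assms(2) _ assms(4)] assms(3) by auto
  then obtain u where u: "\<exists>v\<in>e ` I. u v \<noteq> 0" "(\<Sum>v\<in>e ` I. scale (u v) v) = 0"
    using assms(1) by (auto simp: dependent_finite)
  then show ?thesis
    using True by (intro exI[of _ "u \<circ> e"]) (auto simp: sum.reindex)
next
  case False
  then obtain x y where xy: "x \<in> I" "y \<in> I" "x \<noteq> y" "e x = e y" by (auto simp: inj_on_def)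
  define c :: "_ \<Rightarrow> 'a" where "c i = (if i = x then 1 else if i = y then - 1 else 0)" for i
  have "(\<Sum>i\<in>I. scale (c i) (e i)) = (\<Sum>i\<in>{x, y}. scale (c i) (e i))"
    using xy assms(1) by (intro sum.mono_neutral_right) (auto simp: c_def)
  also have "\<dots> = 0" using xy by (simp add: c_def)
  finally show ?thesis using xy by (intro exI[of _ c]) (auto simp: c_def)
qed

interpretation plane_poly: vector_space "\<lambda>c (p :: 'k::field plane_poly). const c * p"
  by unfold_locales (simp_all add: algebra_simps single_add mult_single flip: mult.assoc)

lemma keys_subset_span:
  fixes p :: "'k::field plane_poly"
  assumes "Poly_Mapping.keys p \<subseteq> B"
  shows "p \<in> plane_poly.span (mon ` B)"
proof -
  have "p = (\<Sum>s\<in>Poly_Mapping.keys p. const (Poly_Mapping.lookup p s) * mon s)"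
    by (simp add: mult_single flip: poly_mapping_eq_sum_single)
  also have "\<dots> \<in> plane_poly.span (mon ` B)"
    using assms by (intro plane_poly.span_sum plane_poly.span_scale plane_poly.span_base) auto
  finally show ?thesis .
qed

lemma keys_mult_box:
  fixes p q :: "'k::field plane_poly"
  assumes "Poly_Mapping.keys p \<subseteq> {..m} \<times> {..m}" "Poly_Mapping.keys q \<subseteq> {..n} \<times> {..n}"
  shows "Poly_Mapping.keys (p * q) \<subseteq> {..m + n} \<times> {..m + n}"
  using assms keys_mult[of p q] by (force simp: subset_iff)

lemma keys_power_box:
  fixes p :: "'k::field plane_poly"
  assumes "Poly_Mapping.keys p \<subseteq> {..m} \<times> {..m}"
  shows "Poly_Mapping.keys (p ^ n) \<subseteq> {..n * m} \<times> {..n * m}"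
proof (induction n)
  case (Suc n)
  then show ?case using keys_mult_box[OF assms Suc] by simp
qed (simp add: zero_prod_def)

text \<open>The \<open>(N + 1)\<^sup>3\<close> products of powers with exponents at most \<open>N\<close> lie in the span of
  \<open>(3 N D + 1)\<^sup>2\<close> monomials, where \<open>D\<close> bounds the degrees. For \<open>N = (3 D + 1)\<^sup>2\<close> the former number is larger.\<close>

lemma algebraically_dependent:
  fixes u v w :: "'k::field plane_poly"
  shows "\<exists>N c. (\<exists>i\<le>N. \<exists>j\<le>N. \<exists>k\<le>N. c i j k \<noteq> 0) \<and>
     (\<Sum>i\<le>N. u ^ i * (\<Sum>j\<le>N. v ^ j * (\<Sum>k\<le>N. w ^ k * const (c i j k)))) = 0"
proof -
  define K where "K = Poly_Mapping.keys u \<union> Poly_Mapping.keys v \<union> Poly_Mapping.keys w"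
  define D where "D = Max (insert 0 (fst ` K \<union> snd ` K))"
  have fin: "finite (insert 0 (fst ` K \<union> snd ` K))" by (simp add: K_def)
  have "x \<le> D \<and> y \<le> D" if "(x, y) \<in> K" for x y
    unfolding D_def using that fin by (intro conjI Max_ge) force+
  then have box: "Poly_Mapping.keys u \<subseteq> {..D} \<times> {..D}" "Poly_Mapping.keys v \<subseteq> {..D} \<times> {..D}"
      "Poly_Mapping.keys w \<subseteq> {..D} \<times> {..D}"
    unfolding K_def by auto
  define N where "N = (3 * D + 1)\<^sup>2"
  define I where "I = {..N} \<times> {..N} \<times> {..N}"
  define e where "e = (\<lambda>(i, j, k). u ^ i * (v ^ j * w ^ k))"
  define T :: "'k plane_poly set" where "T = mon ` ({..3 * N * D} \<times> {..3 * N * D})"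
  have "card T \<le> (3 * N * D + 1)\<^sup>2"
    unfolding T_def by (rule order_trans[OF card_image_le]) (auto simp: card_cartesian_product power2_eq_square)
  also have "\<dots> \<le> ((3 * D + 1) * (N + 1))\<^sup>2"
    by (intro power_mono) (auto simp: algebra_simps)
  also have "\<dots> = N * (N + 1)\<^sup>2" unfolding power_mult_distrib by (simp add: N_def)
  also have "\<dots> < (N + 1) * (N + 1)\<^sup>2" by simp
  also have "\<dots> = card I" by (simp add: I_def card_cartesian_product power2_eq_square)
  finally have card: "card T < card I" .
  have span: "e ` I \<subseteq> plane_poly.span T"
  proof clarify
    fix i j k assume "(i, j, k) \<in> I"
    then have "i * D \<le> N * D" "j * D \<le> N * D" "k * D \<le> N * D" by (auto simp: I_def)
    then have "i * D + (j * D + k * D) \<le> 3 * N * D" by linarith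
    moreover have "Poly_Mapping.keys (e (i, j, k)) \<subseteq> {..i * D + (j * D + k * D)} \<times> {..i * D + (j * D + k * D)}"
      unfolding e_def by (simp add: keys_mult_box keys_power_box box)
    ultimately have "Poly_Mapping.keys (e (i, j, k)) \<subseteq> {..3 * N * D} \<times> {..3 * N * D}" by fastforce
    then show "e (i, j, k) \<in> plane_poly.span T" unfolding T_def by (rule keys_subset_span)
  qed
  have "finite I" "finite T" by (simp_all add: I_def T_def)
  then obtain c where c: "\<exists>i\<in>I. c i \<noteq> 0" "(\<Sum>i\<in>I. const (c i) * e i) = 0"
    using plane_poly.dependent_family[OF _ _ card span] by blast
  have "(\<Sum>i\<in>I. const (c i) * e i) = (\<Sum>i\<le>N. \<Sum>j\<le>N. \<Sum>k\<le>N. const (c (i, j, k)) * e (i, j, k))"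
    unfolding I_def by (simp add: sum.cartesian_product case_prod_unfold)
  also have "\<dots> = (\<Sum>i\<le>N. u ^ i * (\<Sum>j\<le>N. v ^ j * (\<Sum>k\<le>N. w ^ k * const (c (i, j, k)))))"
    by (simp add: e_def sum_distrib_left mult_ac)
  finally show ?thesis
    using c by (intro exI[of _ N] exI[of _ "\<lambda>i j k. c (i, j, k)"]) (auto simp: I_def)
qed

section \<open>Maximal ideals of \<open>K[X][Y]\<close>\<close>

text \<open>A core of the Nullstellensatz. Suppose \<open>Q \<inter> K[X] = 0\<close> and take a nonzero \<open>P \<in> Q\<close> of least degree in
  \<open>Y\<close>; this degree is positive. Let \<open>P\<close> have leading coefficient \<open>c(X)\<close>. The polynomial \<open>q = 1 + X c\<close> is not constant but invertible modulo
  \<open>Q\<close>. Dividing its inverse by \<open>P\<close> after multiplication by a power of \<open>c\<close> leaves a remainder \<open>r\<close>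
  with \<open>q r = c\<^sup>e\<close>, by minimality of the degree; but \<open>q\<close> is coprime to \<open>c\<close>.\<close>

lemma maximal_ideal_meets_coefficients:
  fixes Q :: "'k::field poly poly set"
  assumes add: "\<And>p q. p \<in> Q \<Longrightarrow> q \<in> Q \<Longrightarrow> p + q \<in> Q"
    and mult: "\<And>p q. q \<in> Q \<Longrightarrow> p * q \<in> Q"
    and nz: "N \<in> Q" "N \<noteq> 0"
    and inv: "\<And>q. q \<notin> Q \<Longrightarrow> \<exists>p. q * p - 1 \<in> Q"
  shows "\<exists>f. f \<noteq> 0 \<and> [:f:] \<in> Q"
proof (rule ccontr)
  assume no: "\<not> ?thesis"
  have "\<exists>P. P \<in> Q \<and> P \<noteq> 0 \<and> (\<forall>R. R \<in> Q \<and> R \<noteq> 0 \<longrightarrow> Polynomial.degree P \<le> Polynomial.degree R)"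
    using ex_has_least_nat[of "\<lambda>P. P \<in> Q \<and> P \<noteq> 0" N Polynomial.degree] nz by blast
  then obtain P where P: "P \<in> Q" "P \<noteq> 0"
    and least: "\<And>R. R \<in> Q \<Longrightarrow> R \<noteq> 0 \<Longrightarrow> Polynomial.degree P \<le> Polynomial.degree R" by blast
  have deg: "Polynomial.degree P > 0"
  proof (rule ccontr)
    assume "\<not> ?thesis"
    then obtain f where "P = [:f:]" using degree_eq_zeroE by blast
    then show False using no P by auto
  qed
  define c where "c = Polynomial.lead_coeff P"
  define q where "q = 1 + pCons 0 c"
  have c0: "c \<noteq> 0" using P by (simp add: c_def)
  have q0: "q \<noteq> 0"
  proof
    assume "q = 0"
    then have "poly q 0 = 0" by simp
    then show False by (simp add: q_def)
  qed
  have "Polynomial.degree (pCons 0 c) > 0" using c0 by simp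
  then have "Polynomial.degree q = Polynomial.degree (pCons 0 c)"
    unfolding q_def by (intro degree_add_eq_right) simp
  then have degq: "Polynomial.degree q > 0" using c0 by simp
  have "[:q:] \<notin> Q" using no q0 by blast
  then obtain p where p: "[:q:] * p - 1 \<in> Q" using inv by blast
  obtain s r where sr: "pseudo_divmod p P = (s, r)" by fastforce
  define e where "e = Suc (Polynomial.degree p) - Polynomial.degree P"
  have pd: "smult (c ^ e) p = P * s + r" and r: "r = 0 \<or> Polynomial.degree r < Polynomial.degree P"
    using pseudo_divmod[OF P(2) sr] by (simp_all add: e_def c_def)
  define R where "R = smult q r - [:c ^ e:]"
  have "R = [:c ^ e:] * ([:q:] * p - 1) + (- [:q:] * s) * P"
  proof -
    have "[:c ^ e:] * ([:q:] * p - 1) = [:c ^ e:] * ([:q:] * p) - [:c ^ e:]"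
      by (simp only: right_diff_distrib mult_1_right)
    also have "[:c ^ e:] * ([:q:] * p) = smult q (smult (c ^ e) p)" by (simp add: mult.commute)
    finally have "[:c ^ e:] * ([:q:] * p - 1) = smult q (smult (c ^ e) p) - [:c ^ e:]" .
    then show ?thesis unfolding R_def pd by (simp add: smult_add_right algebra_simps)
  qed
  also have "\<dots> \<in> Q" by (intro add mult p P)
  finally have "R \<in> Q" .
  moreover have "Polynomial.degree R < Polynomial.degree P"
  proof -
    have "Polynomial.degree (smult q r) < Polynomial.degree P"
      using r deg degree_smult_le[of q r] by auto
    then show ?thesis unfolding R_def using deg by (intro degree_diff_less) auto
  qed
  ultimately have "R = 0" using least by fastforce
  then have "Polynomial.coeff (smult q r - [:c ^ e:]) 0 = 0" by (simp add: R_def)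
  then have "c ^ e = q * Polynomial.coeff r 0" by simp
  then have "q dvd c ^ e" by simp
  \<comment> \<open>Since \<open>1 = q - X c\<close>, the factors \<open>c\<close> can be removed one by one.\<close>
  then have "q dvd 1"
  proof (induction e)
    case (Suc e)
    have "c ^ e = (q - [:0, 1:] * c) * c ^ e" by (simp add: q_def)
    also have "\<dots> = q * c ^ e - [:0, 1:] * c ^ Suc e" by (simp add: algebra_simps)
    finally have "c ^ e = q * c ^ e - [:0, 1:] * c ^ Suc e" .
    moreover have "q dvd q * c ^ e - [:0, 1:] * c ^ Suc e"
      using Suc.prems by (intro dvd_diff dvd_triv_left dvd_mult)
    ultimately have "q dvd c ^ e" by simp
    then show ?case by (rule Suc.IH)
  qed simp
  then show False using degq is_unit_iff_degree[OF q0] by simp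
qed

section \<open>Least elements of sets of exponents\<close>

lemma least_index:
  assumes "\<exists>i\<le>(N::nat). Q i"
  shows "\<exists>i\<le>N. Q i \<and> (\<forall>i'<i. \<not> Q i')"
proof -
  obtain i where i: "i \<le> N" "Q i" using assms by blast
  show ?thesis
  proof (intro exI conjI allI impI)
    show "Least Q \<le> N" using Least_le[of Q, OF i(2)] i(1) by linarith
    show "Q (Least Q)" using i(2) by (rule LeastI)
    show "\<not> Q i'" if "i' < Least Q" for i' using that by (rule not_less_Least)
  qed
qed

text \<open>Dickson's lemma in two dimensions: a point of \<open>B\<close> dominates \<open>(i0, j0)\<close> unless it lies in one of
  finitely many rows or columns, each of which has a least point.\<close>

lemma dickson2:
  fixes B :: "(nat \<times> nat) set"
  shows "\<exists>F\<subseteq>B. finite F \<and> (\<forall>(i, j)\<in>B. \<exists>(i', j')\<in>F. i' \<le> i \<and> j' \<le> j)"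
proof (cases "B = {}")
  case False
  then obtain i0 j0 where 0: "(i0, j0) \<in> B" by auto
  define F where "F = {(i0, j0)} \<union> (\<lambda>i. (i, LEAST j. (i, j) \<in> B)) ` {i. i < i0 \<and> (\<exists>j. (i, j) \<in> B)}
     \<union> (\<lambda>j. (LEAST i. (i, j) \<in> B, j)) ` {j. j < j0 \<and> (\<exists>i. (i, j) \<in> B)}"
  have "F \<subseteq> B" using 0 by (auto simp: F_def intro: LeastI)
  moreover have "finite F" by (simp add: F_def)
  moreover have "\<exists>(i', j')\<in>F. i' \<le> i \<and> j' \<le> j" if ij: "(i, j) \<in> B" for i j
  proof -
    consider "i0 \<le> i" "j0 \<le> j" | "i < i0" | "j < j0" by linarith
    then show ?thesis
    proof cases
      case 1
      then show ?thesis by (intro bexI[of _ "(i0, j0)"]) (auto simp: F_def)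
    next
      case 2
      then show ?thesis using ij
        by (intro bexI[of _ "(i, LEAST j. (i, j) \<in> B)"]) (auto simp: F_def intro: Least_le)
    next
      case 3
      then show ?thesis using ij
        by (intro bexI[of _ "(LEAST i. (i, j) \<in> B, j)"]) (auto simp: F_def intro: Least_le)
    qed
  qed
  ultimately show ?thesis by (intro exI[of _ F]) auto
qed auto

section \<open>The semigroup ring\<close>

definition supp_in :: "(nat \<times> nat) set \<Rightarrow> 'k::field plane_poly set" where
  "supp_in S = {p. Poly_Mapping.keys p \<subseteq> S}"

lemma semigroup_ring_simps [simp]:
  "\<one>\<^bsub>semigroup_ring S\<^esub> = 1" "\<zero>\<^bsub>semigroup_ring S\<^esub> = 0"
  "p \<otimes>\<^bsub>semigroup_ring S\<^esub> q = p * q" "p \<oplus>\<^bsub>semigroup_ring S\<^esub> q = p + q"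
  by (simp_all add: semigroup_ring_def ring_of_type_algebra_def)

lemma a_inv_ring_of_type_algebra: "\<ominus>\<^bsub>ring_of_type_algebra\<^esub> (p :: 'a::comm_ring_1) = - p"
proof -
  interpret cring "ring_of_type_algebra :: 'a ring" by (rule cring_from_type_algebra)
  show ?thesis by (rule minus_equality) (simp_all add: ring_of_type_algebra_def)
qed

context simplicial_semigroup
begin

lemma single_supp: "s \<in> S \<Longrightarrow> Poly_Mapping.single s c \<in> supp_in S"
  by (simp add: supp_in_def)

lemma const_supp [simp]: "const c \<in> supp_in S" and one_supp [simp]: "1 \<in> supp_in S"
  and zero_supp [simp]: "0 \<in> supp_in S"
  using zero_S by (auto simp: supp_in_def)

lemma add_supp: "p \<in> supp_in S \<Longrightarrow> q \<in> supp_in S \<Longrightarrow> p + q \<in> supp_in S"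
  unfolding supp_in_def using keys_add[of p q] by blast

lemma mult_supp: "p \<in> supp_in S \<Longrightarrow> q \<in> supp_in S \<Longrightarrow> p * q \<in> supp_in S"
  unfolding supp_in_def using keys_mult[of p q] add_S by blast

lemma uminus_supp: "p \<in> supp_in S \<Longrightarrow> - p \<in> supp_in S"
  by (auto simp: supp_in_def in_keys_iff)

lemma diff_supp: "p \<in> supp_in S \<Longrightarrow> q \<in> supp_in S \<Longrightarrow> p - q \<in> supp_in S"
  using add_supp[OF _ uminus_supp, of p q] by simp

lemma power_supp: "p \<in> supp_in S \<Longrightarrow> p ^ n \<in> supp_in S"
  by (induction n) (auto intro: mult_supp)

lemma sum_supp: "(\<And>i. i \<in> I \<Longrightarrow> f i \<in> supp_in S) \<Longrightarrow> sum f I \<in> supp_in S"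
  by (induction I rule: infinite_finite_induct) (auto intro: add_supp)

lemma supp_induct [consumes 1, case_names zero single add]:
  assumes "p \<in> supp_in S" "P 0"
    and "\<And>s c. s \<in> S \<Longrightarrow> P (Poly_Mapping.single s c)"
    and "\<And>p q. p \<in> supp_in S \<Longrightarrow> q \<in> supp_in S \<Longrightarrow> P p \<Longrightarrow> P q \<Longrightarrow> P (p + q)"
  shows "P p"
proof -
  have "(\<Sum>s\<in>I. Poly_Mapping.single s (Poly_Mapping.lookup p s)) \<in> supp_in S \<and>
      P (\<Sum>s\<in>I. Poly_Mapping.single s (Poly_Mapping.lookup p s))" if "finite I" "I \<subseteq> S" for I
    using that by (induction I rule: finite_induct) (auto intro!: assms add_supp single_supp)
  from this[of "Poly_Mapping.keys p"] show ?thesis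
    using assms(1) by (simp add: supp_in_def flip: poly_mapping_eq_sum_single)
qed

lemma carrier_semigroup_ring [simp]:
  "carrier (semigroup_ring S :: 'k::field plane_poly ring) = supp_in S"
proof -
  let ?T = "ring_of_type_algebra :: 'k plane_poly ring"
  let ?G = "range (\<lambda>c::'k. const c) \<union> mon ` S"
  have "p \<in> supp_in S" if "p \<in> generate_ring ?T ?G" for p
    using that
  proof induction
    case (a_inv h)
    then show ?case by (simp add: a_inv_ring_of_type_algebra uminus_supp)
  qed (auto simp: ring_of_type_algebra_def add_supp mult_supp single_supp)
  moreover have "p \<in> generate_ring ?T ?G" if "p \<in> supp_in S" for p
    using that
  proof (induction rule: supp_induct)
    case zero
    have "const 0 \<in> generate_ring ?T ?G" by (rule generate_ring.incl) blast
    then show ?case by simp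
  next
    case (single s c)
    have "const c \<otimes>\<^bsub>?T\<^esub> mon s \<in> generate_ring ?T ?G"
      using single by (intro generate_ring.eng_mult generate_ring.incl) auto
    then show ?case by (simp add: ring_of_type_algebra_def mult_single)
  next
    case (add p q)
    then have "p \<oplus>\<^bsub>?T\<^esub> q \<in> generate_ring ?T ?G" by (intro generate_ring.eng_add)
    then show ?case by (simp add: ring_of_type_algebra_def)
  qed
  ultimately show ?thesis
    by (auto simp: semigroup_ring_def ring_of_type_algebra_def)
qed

lemma cring_semigroup_ring: "cring (semigroup_ring S)"
proof (rule cringI)
  show "abelian_group (semigroup_ring S)"
    by (rule abelian_groupI)
       (auto simp: algebra_simps add_supp intro!: bexI[of _ "- _"] uminus_supp)
  show "Group.comm_monoid (semigroup_ring S)"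
    by (rule comm_monoidI) (auto simp: algebra_simps mult_supp)
qed (auto simp: algebra_simps)

lemma pow_semigroup_ring [simp]: "p [^]\<^bsub>semigroup_ring S\<^esub> (n::nat) = p ^ n"
proof -
  interpret cring "semigroup_ring S" by (rule cring_semigroup_ring)
  show ?thesis by (induction n) (simp_all add: nat_pow_Suc mult.commute)
qed

text \<open>Closure under negatives is multiplication by the constant \<open>-1\<close>.\<close>

lemma ideal_semigroup_ring_iff:
  "ideal I (semigroup_ring S) \<longleftrightarrow> I \<subseteq> supp_in S \<and> 0 \<in> I \<and> (\<forall>x\<in>I. \<forall>y\<in>I. x + y \<in> I) \<and>
     (\<forall>x\<in>I. \<forall>r\<in>supp_in S. r * x \<in> I)" (is "_ \<longleftrightarrow> ?R")
proof
  interpret cring "semigroup_ring S" by (rule cring_semigroup_ring)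
  show ?R if I: "ideal I (semigroup_ring S)"
  proof -
    interpret ideal I "semigroup_ring S" by (rule I)
    show ?thesis
      using a_subset zero_closed a_closed I_l_closed by auto
  qed
  show "ideal I (semigroup_ring S)" if I: ?R
  proof (rule idealI[OF ring_axioms])
    show "subgroup I (add_monoid (semigroup_ring S))"
    proof (rule add.subgroupI)
      fix x assume x: "x \<in> I"
      then have "- x = \<ominus>\<^bsub>semigroup_ring S\<^esub> x"
        using I by (intro minus_equality[symmetric]) (auto intro: uminus_supp)
      moreover have "const (- 1) * x \<in> I" using x I const_supp by blast
      moreover have "const (- 1) * x = - x" by (simp add: single_uminus)
      ultimately show "\<ominus>\<^bsub>semigroup_ring S\<^esub> x \<in> I" by simp
    qed (use I in auto)
  qed (use I in \<open>auto simp: mult.commute\<close>)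
qed

lemma ideal_diff_mem:
  assumes "ideal I (semigroup_ring S)" "x \<in> I" "y \<in> I"
  shows "x - y \<in> I"
proof -
  have "const (- 1) * y \<in> I" using assms const_supp unfolding ideal_semigroup_ring_iff by blast
  then have "x + const (- 1) * y \<in> I" using assms unfolding ideal_semigroup_ring_iff by blast
  then show ?thesis by (simp add: single_uminus)
qed

lemma maximalideal_inverse:
  fixes M :: "'k::field plane_poly set"
  assumes M: "maximalideal M (semigroup_ring S)" and q: "q \<in> supp_in S" "q \<notin> M"
  shows "\<exists>r\<in>supp_in S. q * r - 1 \<in> M"
proof -
  interpret M: maximalideal M "semigroup_ring S" by fact
  have M': "M \<subseteq> supp_in S" "0 \<in> M" "\<And>x y. x \<in> M \<Longrightarrow> y \<in> M \<Longrightarrow> x + y \<in> M"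
      "\<And>x r. x \<in> M \<Longrightarrow> r \<in> supp_in S \<Longrightarrow> r * x \<in> M"
    using M.is_ideal by (auto simp: ideal_semigroup_ring_iff)
  define J where "J = {m + q * r | m r. m \<in> M \<and> r \<in> supp_in S}"
  have J_I: "m + q * r \<in> J" if "m \<in> M" "r \<in> supp_in S" for m r
    using that unfolding J_def by blast
  have "ideal J (semigroup_ring S)"
    unfolding ideal_semigroup_ring_iff
  proof (intro conjI ballI subsetI)
    fix x assume "x \<in> J"
    then obtain m r where x: "m \<in> M" "r \<in> supp_in S" "x = m + q * r" by (auto simp: J_def)
    then show "x \<in> supp_in S" using M' q by (auto intro!: add_supp mult_supp)
    { fix y assume "y \<in> J"
      then obtain m' r' where y: "m' \<in> M" "r' \<in> supp_in S" "y = m' + q * r'" by (auto simp: J_def)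
      have "x + y = (m + m') + q * (r + r')" using x y by (simp add: algebra_simps)
      also have "\<dots> \<in> J" by (intro J_I M'(3) add_supp x y)
      finally show "x + y \<in> J" . }
    fix t :: "'k plane_poly" assume t: "t \<in> supp_in S"
    have "t * x = t * m + q * (t * r)" using x by (simp add: algebra_simps)
    also have "\<dots> \<in> J" by (intro J_I M'(4) mult_supp x t)
    finally show "t * x \<in> J" .
  next
    have "0 = 0 + q * 0" by simp
    also have "\<dots> \<in> J" by (intro J_I M'(2) zero_supp)
    finally show "0 \<in> J" .
  qed
  moreover have "M \<subseteq> J"
  proof
    fix m assume "m \<in> M"
    then have "m + q * 0 \<in> J" by (intro J_I zero_supp)
    then show "m \<in> J" by simp
  qed
  moreover have "0 + q * 1 \<in> J" by (intro J_I M'(2) one_supp)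
  then have "q \<in> J" by simp
  ultimately have "J = supp_in S"
    using M.I_maximal[of J] q by (auto simp: ideal_semigroup_ring_iff)
  then have "1 \<in> J" by simp
  then obtain m r where mr: "m \<in> M" "r \<in> supp_in S" "1 = m + q * r" by (auto simp: J_def)
  have "q * r - 1 = 0 - m" by (simp add: mr(3))
  also have "\<dots> \<in> M" using ideal_diff_mem[OF M.is_ideal M'(2) mr(1)] .
  finally show ?thesis using mr by blast
qed

section \<open>Finite generation over \<open>K[x\<^sup>a, x\<^sup>b]\<close>\<close>

definition A_submodule :: "'k::field plane_poly set \<Rightarrow> bool" where
  "A_submodule V \<longleftrightarrow> 0 \<in> V \<and> (\<forall>x\<in>V. \<forall>y\<in>V. x + y \<in> V) \<and> (\<forall>c. \<forall>x\<in>V. const c * x \<in> V) \<and>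
     (\<forall>x\<in>V. mon a * x \<in> V \<and> mon b * x \<in> V)"

text \<open>The inner variable is sent to \<open>x\<^sup>a\<close> and the outer one to \<open>x\<^sup>b\<close>, so the range of \<open>ev\<close> is \<open>A\<close>.\<close>

definition ev :: "'k::field poly poly \<Rightarrow> 'k plane_poly" where
  "ev = eval_hom (eval_hom (Poly_Mapping.single 0) (mon a)) (mon b)"

lemma ring_map_ev: "ring_map ev"
  unfolding ev_def by (intro ring_map_eval_hom ring_map_const)

lemmas ev_simps = ring_map_simps[OF ring_map_ev]

lemma A_submodule_ev:
  assumes V: "A_submodule V" and x: "x \<in> V"
  shows "ev N * x \<in> V"
proof -
  have inner: "eval_hom (Poly_Mapping.single 0) (mon a) f * x \<in> V" if "x \<in> V" for f x
  proof (induction f)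
    case (pCons c f)
    then show ?case
      using V that by (simp add: eval_hom_pCons[OF ring_map_const] distrib_right mult.assoc A_submodule_def)
  qed (use V in \<open>simp add: A_submodule_def\<close>)
  show ?thesis
    unfolding ev_def
  proof (induction N)
    case (pCons f N)
    then show ?case
      using V inner[OF x]
      by (simp add: eval_hom_pCons[OF ring_map_eval_hom[OF ring_map_const]] distrib_right mult.assoc A_submodule_def)
  qed (use V in \<open>simp add: A_submodule_def\<close>)
qed

lemma A_submodule_single:
  assumes V: "A_submodule V" and x: "x \<in> V"
  shows "Poly_Mapping.single (scale i a + scale j b) c * x \<in> V"
proof -
  have "ev (Polynomial.monom (Polynomial.monom c i) j) = Poly_Mapping.single (scale i a + scale j b) c"
    by (simp add: ev_def eval_hom_monom[OF ring_map_eval_hom[OF ring_map_const]]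
         eval_hom_monom[OF ring_map_const] mon_power mult_single)
  then show ?thesis using A_submodule_ev[OF V x] by metis
qed

lemma A_submodule_ideal:
  assumes "ideal I (semigroup_ring S)"
  shows "A_submodule I"
  using assms single_supp[OF a_S] single_supp[OF b_S] const_supp
  unfolding A_submodule_def ideal_semigroup_ring_iff by blast

lemma ev_supp: "ev N \<in> supp_in S"
proof -
  interpret cring "semigroup_ring S" by (rule cring_semigroup_ring)
  have "A_submodule (supp_in S)"
    using A_submodule_ideal oneideal by simp
  from A_submodule_ev[OF this one_supp] show ?thesis by simp
qed

lemma dickson_semigroup:
  assumes "\<Lambda> \<subseteq> S"
  shows "\<exists>F\<subseteq>\<Lambda>. finite F \<and> (\<forall>s\<in>\<Lambda>. \<exists>f\<in>F. \<exists>i j. s = f + scale i a + scale j b)"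
proof -
  define B where "B w = {(i, j). w + scale i a + scale j b \<in> \<Lambda>}" for w
  have "\<forall>w. \<exists>F\<subseteq>B w. finite F \<and> (\<forall>(i, j)\<in>B w. \<exists>(i', j')\<in>F. i' \<le> i \<and> j' \<le> j)"
    using dickson2 by blast
  from choice[OF this] obtain G where
    G_all: "\<forall>w. G w \<subseteq> B w \<and> finite (G w) \<and> (\<forall>(i, j)\<in>B w. \<exists>(i', j')\<in>G w. i' \<le> i \<and> j' \<le> j)" ..
  then have G: "\<And>w. G w \<subseteq> B w" "\<And>w. finite (G w)"
    "\<And>w i j. (i, j) \<in> B w \<Longrightarrow> \<exists>(i', j')\<in>G w. i' \<le> i \<and> j' \<le> j"
    by blast+
  define F where "F = (\<Union>w\<in>Ap. (\<lambda>(i, j). w + scale i a + scale j b) ` G w)"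
  have "finite F" unfolding F_def using finite_Ap G(2) by blast
  moreover have "F \<subseteq> \<Lambda>" using G(1) by (fastforce simp: F_def B_def)
  moreover have "\<exists>f\<in>F. \<exists>i j. s = f + scale i a + scale j b" if s: "s \<in> \<Lambda>" for s
  proof -
    obtain w i j where w: "w \<in> Ap" "s = w + scale i a + scale j b"
      using apery_decomposition assms s by blast
    then have "(i, j) \<in> B w" using s by (simp add: B_def)
    then obtain i' j' where ij: "(i', j') \<in> G w" "i' \<le> i" "j' \<le> j" using G(3) by blast
    have "s = (w + scale i' a + scale j' b) + scale (i - i') a + scale (j - j') b"
      using w ij scale_add(1)[of i' "i - i'" a] scale_add(1)[of j' "j - j'" b] by (simp add: algebra_simps)
    moreover have "w + scale i' a + scale j' b \<in> F" using w ij by (force simp: F_def)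
    ultimately show ?thesis by blast
  qed
  ultimately show ?thesis by blast
qed

text \<open>Leading monomials reduce finite generation to Dickson's lemma: choose finitely many
  elements of \<open>V\<close> whose leading exponents generate all leading exponents of \<open>V\<close> over \<open>\<nat>a + \<nat>b\<close>, and divide by
  them. The conclusion says that \<open>V\<close> is the least submodule containing \<open>G\<close>, which avoids writing down linear
  combinations.\<close>

lemma A_submodule_finitely_generated:
  fixes V :: "'k::field plane_poly set"
  assumes V: "A_submodule V" "V \<subseteq> supp_in S"
  shows "\<exists>G\<subseteq>V. finite G \<and> (\<forall>U. A_submodule U \<longrightarrow> G \<subseteq> U \<longrightarrow> V \<subseteq> U)"
proof -
  define lm where "lm p = Max (Poly_Mapping.keys p)" for p :: "'k::field plane_poly"
  have lm_in: "lm p \<in> Poly_Mapping.keys p" if "p \<noteq> 0" for p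
    unfolding lm_def using that by (intro Max_in) (auto simp: poly_mapping_eq_iff fun_eq_iff in_keys_iff)
  have lm_ge: "s \<le> lm p" if "s \<in> Poly_Mapping.keys p" for s p
    unfolding lm_def using that by simp
  have "lm p \<in> S" if "p \<in> V - {0}" for p
    using lm_in[of p] V(2) that unfolding supp_in_def by blast
  then have "lm ` (V - {0}) \<subseteq> S" by (rule image_subsetI)
  then obtain F where F: "F \<subseteq> lm ` (V - {0})" "finite F"
    "\<And>s. s \<in> lm ` (V - {0}) \<Longrightarrow> \<exists>f\<in>F. \<exists>i j. s = f + scale i a + scale j b"
    using dickson_semigroup by metis
  have "\<forall>f\<in>F. \<exists>g. g \<in> V \<and> g \<noteq> 0 \<and> lm g = f" using F(1) by blast
  then obtain g where g: "\<And>f. f \<in> F \<Longrightarrow> g f \<in> V \<and> g f \<noteq> 0 \<and> lm (g f) = f" by metis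
  have "p \<in> U" if U: "A_submodule U" "g ` F \<subseteq> U" and p: "p \<in> V" for U p
    using p
  proof (induction "lm p" arbitrary: p rule: less_induct)
    case less
    show ?case
    proof (cases "p = 0")
      case True
      then show ?thesis using U by (simp add: A_submodule_def)
    next
      case False
      then obtain f i j where f: "f \<in> F" "lm p = f + scale i a + scale j b"
        using F(3)[of "lm p"] less.prems by blast
      define m where "m = scale i a + scale j b"
      define h where "h = g f"
      have h: "h \<in> V" "h \<noteq> 0" "lm h = f" "h \<in> U" using g f U by (auto simp: h_def)
      have lmp: "lm p = m + lm h" using f h by (simp add: m_def algebra_simps)
      define c where "c = Poly_Mapping.lookup p (lm p) / Poly_Mapping.lookup h (lm h)"
      have h_lc: "Poly_Mapping.lookup h (lm h) \<noteq> 0" using lm_in[OF h(2)] by (simp add: in_keys_iff)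
      define q where "q = Poly_Mapping.single m c * h"
      have q: "q \<in> V" "q \<in> U"
        unfolding q_def m_def using A_submodule_single V(1) U(1) h by blast+
      have "p - q = p + const (- 1) * q" by (simp add: single_uminus)
      moreover have "const (- 1) * q \<in> V" using V(1) q(1) unfolding A_submodule_def by blast
      then have "p + const (- 1) * q \<in> V" using V(1) less.prems unfolding A_submodule_def by blast
      ultimately have pq: "p - q \<in> V" by simp
      have "p - q \<in> U"
      proof (cases "p - q = 0")
        case True
        then show ?thesis using U by (simp add: A_submodule_def)
      next
        case False
        have "Poly_Mapping.lookup q (lm p) = c * Poly_Mapping.lookup h (lm h)"
          unfolding q_def lmp by (rule lookup_single_mult)
        then have cancel: "Poly_Mapping.lookup (p - q) (lm p) = 0"
          using h_lc by (simp add: lookup_minus c_def)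
        have le: "s \<le> lm p" if "s \<in> Poly_Mapping.keys (p - q)" for s
        proof (cases "s \<in> Poly_Mapping.keys p")
          case False
          then have "s \<in> Poly_Mapping.keys q" using that by (auto simp: in_keys_iff lookup_minus)
          then obtain u where "u \<in> Poly_Mapping.keys h" "s = m + u"
            using lookup_single_mult_outside[of h s m c] unfolding q_def by (auto simp: in_keys_iff)
          then show ?thesis using lm_ge lmp by (simp add: add_left_mono)
        qed (rule lm_ge)
        have "lm (p - q) \<in> Poly_Mapping.keys (p - q)" using lm_in False by blast
        then have "lm (p - q) \<noteq> lm p" "lm (p - q) \<le> lm p" using cancel le by (auto simp: in_keys_iff)
        then have "lm (p - q) < lm p" by simp
        then show ?thesis using less.hyps pq by blast
      qed
      then have "(p - q) + q \<in> U" using U(1) q(2) unfolding A_submodule_def by blast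
      then show ?thesis by simp
    qed
  qed
  then show ?thesis
    using F(2) g by (intro exI[of _ "g ` F"]) blast
qed

lemma noetherian_semigroup_ring: "noetherian_ring (semigroup_ring S :: 'k::field plane_poly ring)"
proof -
  interpret cring "semigroup_ring S :: 'k plane_poly ring" by (rule cring_semigroup_ring)
  show ?thesis
  proof (rule noetherian_ringI)
    fix I :: "'k plane_poly set" assume I: "ideal I (semigroup_ring S)"
    then have sub: "I \<subseteq> supp_in S" by (simp add: ideal_semigroup_ring_iff)
    obtain G where G: "G \<subseteq> I" "finite G" "\<And>U. A_submodule U \<Longrightarrow> G \<subseteq> U \<Longrightarrow> I \<subseteq> U"
      using A_submodule_finitely_generated[OF A_submodule_ideal[OF I] sub] by blast
    have Gc: "G \<subseteq> carrier (semigroup_ring S)" using G sub by auto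
    have "I \<subseteq> Idl\<^bsub>semigroup_ring S\<^esub> G"
      using G(3) A_submodule_ideal[OF genideal_ideal[OF Gc]] genideal_self[OF Gc] by blast
    moreover have "Idl\<^bsub>semigroup_ring S\<^esub> G \<subseteq> I" by (rule genideal_minimal[OF I G(1)])
    ultimately show "\<exists>A\<subseteq>carrier (semigroup_ring S). finite A \<and> I = Idl\<^bsub>semigroup_ring S\<^esub> A"
      using G Gc by blast
  qed
qed

text \<open>Since \<open>R\<close> is a finite \<open>A\<close>-module, \<open>A/(M \<inter> A)\<close> is a field. Let \<open>r\<close> be an inverse of \<open>q = ev Q\<close> modulo
  \<open>M\<close>. The submodules \<open>M + A + A r + ... + A r\<^sup>n\<close> become stationary, so \<open>r\<^sup>n\<^sup>+\<^sup>1\<close> is an \<open>A\<close>-combination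
  of lower powers modulo \<open>M\<close>; multiplying by \<open>q\<^sup>n\<^sup>+\<^sup>1\<close> gives \<open>1 \<in> q A + M\<close>.\<close>

lemma maximalideal_ev_inverse:
  fixes M :: "'k::field plane_poly set"
  assumes M: "maximalideal M (semigroup_ring S)" and q: "ev Q \<notin> M"
  shows "\<exists>P. ev (Q * P - 1) \<in> M"
proof -
  interpret M: maximalideal M "semigroup_ring S" by fact
  have M': "M \<subseteq> supp_in S" "0 \<in> M" "\<And>x y. x \<in> M \<Longrightarrow> y \<in> M \<Longrightarrow> x + y \<in> M"
      "\<And>x r. x \<in> M \<Longrightarrow> r \<in> supp_in S \<Longrightarrow> r * x \<in> M"
    using M.is_ideal by (auto simp: ideal_semigroup_ring_iff)
  have MA: "A_submodule M" by (rule A_submodule_ideal[OF M.is_ideal])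
  obtain r where r: "r \<in> supp_in S" "ev Q * r - 1 \<in> M"
    using maximalideal_inverse[OF M ev_supp q] by blast
  define N where "N n = {x. \<exists>m\<in>M. \<exists>p. x = m + (\<Sum>i\<le>n. ev (p i) * r ^ i)}" for n :: nat
  have N_I: "m + (\<Sum>i\<le>n. ev (p i) * r ^ i) \<in> N n" if "m \<in> M" for m p n
    using that unfolding N_def by blast
  have mono: "N k \<subseteq> N n" if "k \<le> n" for k n
  proof
    fix x assume "x \<in> N k"
    then obtain m p where x: "m \<in> M" "x = m + (\<Sum>i\<le>k. ev (p i) * r ^ i)" unfolding N_def by blast
    have "(\<Sum>i\<le>n. ev (if i \<le> k then p i else 0) * r ^ i) = (\<Sum>i\<le>k. ev (if i \<le> k then p i else 0) * r ^ i)"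
      using that by (intro sum.mono_neutral_right) (auto simp: ev_simps)
    then have "x = m + (\<Sum>i\<le>n. ev (if i \<le> k then p i else 0) * r ^ i)" using x by simp
    also have "\<dots> \<in> N n" by (rule N_I[OF x(1)])
    finally show "x \<in> N n" .
  qed
  have NA: "A_submodule (N n)" for n
    unfolding A_submodule_def
  proof (intro conjI ballI allI)
    have "0 + (\<Sum>i\<le>n. ev 0 * r ^ i) \<in> N n" using N_I[OF M'(2), of "\<lambda>_. 0"] .
    then show "0 \<in> N n" by (simp add: ev_simps)
    fix x assume "x \<in> N n"
    then obtain m p where x: "m \<in> M" "x = m + (\<Sum>i\<le>n. ev (p i) * r ^ i)" unfolding N_def by blast
    have mult: "ev P * x \<in> N n" for P
    proof -
      have "ev P * x = ev P * m + (\<Sum>i\<le>n. ev (P * p i) * r ^ i)"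
        by (simp add: x ev_simps distrib_left sum_distrib_left mult.assoc)
      also have "\<dots> \<in> N n" by (intro N_I M'(4) x ev_supp)
      finally show ?thesis .
    qed
    have "ev [:[:c:]:] = const c" for c :: "'k"
      by (simp add: ev_def eval_hom_const ring_map_const ring_map_eval_hom)
    then show "const c * x \<in> N n" for c using mult by metis
    have "ev [:[:0, 1:]:] = mon a"
      by (simp add: ev_def eval_hom_const ring_map_const ring_map_eval_hom eval_hom_pCons)
    then show "mon a * x \<in> N n" using mult by metis
    have "ev [:0, 1:] = mon b"
      by (simp add: ev_def ring_map_const ring_map_eval_hom eval_hom_pCons
           ring_map_simps[OF ring_map_eval_hom[OF ring_map_const]])
    then show "mon b * x \<in> N n" using mult by metis
    fix y assume "y \<in> N n"
    then obtain m' p' where y: "m' \<in> M" "y = m' + (\<Sum>i\<le>n. ev (p' i) * r ^ i)" unfolding N_def by blast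
    have "x + y = (m + m') + (\<Sum>i\<le>n. ev (p i + p' i) * r ^ i)"
      by (simp add: x y ev_simps distrib_right sum.distrib)
    also have "\<dots> \<in> N n" by (intro N_I M'(3) x y)
    finally show "x + y \<in> N n" .
  qed
  have UA: "A_submodule (\<Union>n. N n)"
    unfolding A_submodule_def
  proof (intro conjI ballI allI)
    show "0 \<in> (\<Union>n. N n)" using NA[of 0] by (auto simp: A_submodule_def)
    fix x assume "x \<in> (\<Union>n. N n)"
    then obtain n where n: "x \<in> N n" by blast
    then show "const c * x \<in> (\<Union>n. N n)" for c using NA[of n] unfolding A_submodule_def by blast
    show "mon a * x \<in> (\<Union>n. N n)" "mon b * x \<in> (\<Union>n. N n)"
      using n NA[of n] unfolding A_submodule_def by blast+
    fix y assume "y \<in> (\<Union>n. N n)"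
    then obtain k where "y \<in> N k" by blast
    then have "x \<in> N (max n k)" "y \<in> N (max n k)" using n mono[of n "max n k"] mono[of k "max n k"] by auto
    then show "x + y \<in> (\<Union>n. N n)" using NA[of "max n k"] unfolding A_submodule_def by blast
  qed
  have "N n \<subseteq> supp_in S" for n
  proof
    fix x assume "x \<in> N n"
    then obtain m p where x: "m \<in> M" "x = m + (\<Sum>i\<le>n. ev (p i) * r ^ i)" unfolding N_def by blast
    have "m \<in> supp_in S" using x(1) M'(1) by blast
    then show "x \<in> supp_in S" unfolding x(2) by (intro add_supp sum_supp mult_supp ev_supp power_supp r(1))
  qed
  then have "(\<Union>n. N n) \<subseteq> supp_in S" by blast
  from A_submodule_finitely_generated[OF UA this]
  obtain G where G: "G \<subseteq> (\<Union>n. N n)" "finite G"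
      "\<forall>U. A_submodule U \<longrightarrow> G \<subseteq> U \<longrightarrow> (\<Union>n. N n) \<subseteq> U"
    by (elim exE conjE)
  have "\<exists>n. G \<subseteq> N n"
    using G(2,1)
  proof (induction G rule: finite_induct)
    case (insert x G)
    then obtain n k where "G \<subseteq> N n" "x \<in> N k" by auto
    then have "insert x G \<subseteq> N (max n k)" using mono[of n "max n k"] mono[of k "max n k"] by auto
    then show ?case by blast
  qed auto
  then obtain n where "G \<subseteq> N n" ..
  then have "(\<Union>n. N n) \<subseteq> N n" using G(3) NA by simp
  moreover have "r ^ Suc n \<in> N (Suc n)"
  proof -
    have "0 + (\<Sum>i\<le>Suc n. ev (if i = Suc n then 1 else 0) * r ^ i) \<in> N (Suc n)" by (rule N_I[OF M'(2)])
    moreover have "(\<Sum>i\<le>Suc n. ev (if i = Suc n then 1 else 0) * r ^ i) = r ^ Suc n"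
      by (simp add: ev_simps)
    ultimately show ?thesis by simp
  qed
  ultimately obtain m p where rn: "m \<in> M" "r ^ Suc n = m + (\<Sum>i\<le>n. ev (p i) * r ^ i)"
    unfolding N_def by blast
  have qr: "ev Q ^ k * r ^ k - 1 \<in> M" for k
  proof (induction k)
    case (Suc k)
    have "ev Q ^ Suc k * r ^ Suc k - 1 = (ev Q * r) * (ev Q ^ k * r ^ k - 1) + (ev Q * r - 1)"
      by (simp add: algebra_simps)
    also have "\<dots> \<in> M" using Suc r by (intro M'(3,4) mult_supp ev_supp)
    finally show ?case .
  qed (use M'(2) in simp)
  define P where "P = (\<Sum>i\<le>n. p i * Q ^ (n - i))"
  have evP: "ev (Q * P) = (\<Sum>i\<le>n. ev (p i) * ev Q ^ (Suc n - i))"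
    unfolding P_def by (simp add: ev_simps sum_distrib_left Suc_diff_le mult_ac)
  have "ev Q ^ Suc n * r ^ Suc n - ev (Q * P) = ev Q ^ Suc n * m
     + (\<Sum>i\<le>n. (ev (p i) * ev Q ^ (Suc n - i)) * (ev Q ^ i * r ^ i - 1))"
  proof -
    have "ev Q ^ Suc n * (ev (p i) * r ^ i) = (ev (p i) * ev Q ^ (Suc n - i)) * (ev Q ^ i * r ^ i)" if "i \<le> n" for i
    proof -
      have "ev Q ^ Suc n = ev Q ^ (Suc n - i) * ev Q ^ i" using that by (simp flip: power_add)
      then show ?thesis by (simp add: mult_ac)
    qed
    then have "ev Q ^ Suc n * (\<Sum>i\<le>n. ev (p i) * r ^ i)
        = (\<Sum>i\<le>n. (ev (p i) * ev Q ^ (Suc n - i)) * (ev Q ^ i * r ^ i))"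
      unfolding sum_distrib_left by (intro sum.cong) auto
    then show ?thesis unfolding rn(2) evP
      by (simp add: distrib_left right_diff_distrib sum_subtractf del: power_Suc)
  qed
  also have "\<dots> \<in> M"
  proof (intro M'(3,4) rn power_supp ev_supp)
    have "sum f {..n} \<in> M" if "\<And>i. f i \<in> M" for f :: "nat \<Rightarrow> 'k plane_poly"
      by (induction n) (auto intro: that M'(3))
    then show "(\<Sum>i\<le>n. (ev (p i) * ev Q ^ (Suc n - i)) * (ev Q ^ i * r ^ i - 1)) \<in> M"
      by this (intro M'(4) qr mult_supp power_supp ev_supp)
  qed
  finally have "ev Q ^ Suc n * r ^ Suc n - ev (Q * P) \<in> M" .
  from ideal_diff_mem[OF M.is_ideal qr[of "Suc n"] this]
  have "ev (Q * P) - 1 \<in> M" by (simp del: power_Suc)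
  then show ?thesis by (intro exI[of _ P]) (simp add: ev_simps)
qed

section \<open>Dimension\<close>

text \<open>Both uses of algebraic dependence rest on this step: cancel the lowest power of \<open>x\<close> in a polynomial
  relation modulo \<open>P\<close>; what remains is the lowest coefficient plus a multiple of \<open>x \<in> P'\<close>.\<close>

lemma lowest_coefficient_mem:
  fixes P P' :: "'k::field plane_poly set"
  assumes P': "ideal P' (semigroup_ring S)" "P \<subseteq> P'" and x: "x \<in> P'"
    and cancel: "\<And>z. z \<in> supp_in S \<Longrightarrow> x * z \<in> P \<Longrightarrow> z \<in> P"
    and t: "\<And>i. t i \<in> supp_in S" "\<And>i. i < i0 \<Longrightarrow> t i = 0" and i0: "i0 \<le> N"
    and sum: "(\<Sum>i\<le>N. x ^ i * t i) \<in> P"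
  shows "t i0 \<in> P'"
proof -
  have P'': "P' \<subseteq> supp_in S" "\<And>y r. y \<in> P' \<Longrightarrow> r \<in> supp_in S \<Longrightarrow> r * y \<in> P'"
    using P' by (auto simp: ideal_semigroup_ring_iff)
  then have xS: "x \<in> supp_in S" using x by blast
  define r where "r = (\<Sum>i\<in>{Suc i0..N}. x ^ (i - Suc i0) * t i)"
  have rS: "r \<in> supp_in S" unfolding r_def by (intro sum_supp mult_supp power_supp xS t)
  have "(\<Sum>i\<le>N. x ^ i * t i) = (\<Sum>i\<in>{i0..N}. x ^ i * t i)"
    using t(2) by (intro sum.mono_neutral_right) auto
  also have "\<dots> = x ^ i0 * t i0 + (\<Sum>i\<in>{Suc i0..N}. x ^ i * t i)"
    using i0 by (simp add: sum.atLeast_Suc_atMost)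
  also have "(\<Sum>i\<in>{Suc i0..N}. x ^ i * t i) = x ^ i0 * (x * r)"
    unfolding r_def sum_distrib_left
  proof (intro sum.cong refl)
    fix i assume "i \<in> {Suc i0..N}"
    then have "x ^ i = x ^ i0 * (x * x ^ (i - Suc i0))"
      by (simp flip: power_add power_Suc)
    then show "x ^ i * t i = x ^ i0 * (x * (x ^ (i - Suc i0) * t i))" by (simp add: mult.assoc)
  qed
  finally have "x ^ i0 * (t i0 + x * r) \<in> P" using sum by (simp add: distrib_left)
  moreover have "z \<in> P" if "z \<in> supp_in S" "x ^ n * z \<in> P" for n z
    using that
  proof (induction n arbitrary: z)
    case (Suc n)
    then have *: "x ^ n * (x * z) \<in> P" by (simp add: mult_ac)
    have "x * z \<in> P" by (rule Suc.IH[OF mult_supp[OF xS Suc.prems(1)] *])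
    then show ?case by (rule cancel[OF Suc.prems(1)])
  qed simp
  moreover have "t i0 + x * r \<in> supp_in S" by (intro add_supp mult_supp xS rS t(1))
  ultimately have "t i0 + x * r \<in> P" by blast
  then have "t i0 + x * r \<in> P'" using P'(2) by blast
  moreover have "x * r \<in> P'" using P''(2)[OF x rS] by (simp add: mult.commute)
  ultimately have "(t i0 + x * r) - x * r \<in> P'" by (rule ideal_diff_mem[OF P'(1)])
  then show ?thesis by simp
qed

text \<open>Pick \<open>x\<^sub>i\<close> in each prime but not in the preceding one and take an algebraic relation between the three.
  Passing from each prime to the next removes one variable from the relation and leaves its lowest
  coefficient, until a nonzero constant lies in the last prime.\<close>

lemma no_prime_chain_of_length_3:
  fixes p :: "nat \<Rightarrow> 'k::field plane_poly set"
  assumes prime: "\<And>i. i \<le> 3 \<Longrightarrow> primeideal (p i) (semigroup_ring S)"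
    and chain: "\<And>i. i < 3 \<Longrightarrow> p i \<subset> p (Suc i)"
  shows False
proof -
  have ideal: "ideal (p i) (semigroup_ring S)" if "i \<le> 3" for i
    using prime[OF that] by (simp add: primeideal_def)
  have "\<exists>x. x \<in> p (Suc i) - p i" if "i < 3" for i using chain[OF that] by blast
  then obtain x where x: "\<And>i. i < 3 \<Longrightarrow> x i \<in> p (Suc i) - p i" by metis
  have xS: "x i \<in> supp_in S" if "i < 3" for i
    using x[OF that] ideal[of "Suc i"] that by (auto simp: ideal_semigroup_ring_iff)
  have cancel: "z \<in> p i" if "i < 3" "z \<in> supp_in S" "x i * z \<in> p i" for i z
    using primeideal.I_prime[OF prime, of i "x i" z] xS x that by fastforce
  obtain N c where c: "\<exists>i\<le>N. \<exists>j\<le>N. \<exists>k\<le>N. c i j k \<noteq> 0"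
    and rel: "(\<Sum>i\<le>N. x 0 ^ i * (\<Sum>j\<le>N. x 1 ^ j * (\<Sum>k\<le>N. x 2 ^ k * const (c i j k)))) = 0"
    using algebraically_dependent[of "x 0" "x 1" "x 2"] by blast
  define W where "W i j = (\<Sum>k\<le>N. x 2 ^ k * const (c i j k))" for i j
  define V where "V i = (\<Sum>j\<le>N. x 1 ^ j * W i j)" for i
  have WS: "W i j \<in> supp_in S" for i j
    unfolding W_def by (intro sum_supp mult_supp power_supp xS const_supp) simp
  have VS: "V i \<in> supp_in S" for i
    unfolding V_def by (intro sum_supp mult_supp power_supp xS WS) simp
  obtain i0 where i0: "i0 \<le> N" "\<exists>j\<le>N. \<exists>k\<le>N. c i0 j k \<noteq> 0"
     "\<And>i. i < i0 \<Longrightarrow> \<not> (\<exists>j\<le>N. \<exists>k\<le>N. c i j k \<noteq> 0)"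
    using least_index[OF c] by blast
  obtain j0 where j0: "j0 \<le> N" "\<exists>k\<le>N. c i0 j0 k \<noteq> 0" "\<And>j. j < j0 \<Longrightarrow> \<not> (\<exists>k\<le>N. c i0 j k \<noteq> 0)"
    using least_index[OF i0(2)] by blast
  obtain k0 where k0: "k0 \<le> N" "c i0 j0 k0 \<noteq> 0" "\<And>k. k < k0 \<Longrightarrow> \<not> c i0 j0 k \<noteq> 0"
    using least_index[OF j0(2)] by blast
  have W0: "W i j = 0" if "\<not> (\<exists>k\<le>N. c i j k \<noteq> 0)" for i j
    unfolding W_def using that by (intro sum.neutral) auto
  have V0: "V i = 0" if "\<not> (\<exists>j\<le>N. \<exists>k\<le>N. c i j k \<noteq> 0)" for i
    unfolding V_def using that W0 by (intro sum.neutral) auto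
  have sub: "p i \<subseteq> p (Suc i)" if "i < 3" for i using chain[OF that] by blast
  have xin: "x i \<in> p (Suc i)" if "i < 3" for i using x[OF that] by blast
  have "0 \<in> p 0" using ideal[of 0] by (simp add: ideal_semigroup_ring_iff)
  then have "(\<Sum>i\<le>N. x 0 ^ i * V i) \<in> p 0" using rel by (simp add: V_def W_def)
  then have "V i0 \<in> p (Suc 0)"
    using lowest_coefficient_mem[where t = V, OF ideal[of "Suc 0"] sub[of 0] xin[of 0] cancel[of 0] VS V0[OF i0(3)] i0(1)]
    by simp
  then have "(\<Sum>j\<le>N. x 1 ^ j * W i0 j) \<in> p 1" by (simp add: V_def)
  then have "W i0 j0 \<in> p (Suc 1)"
    using lowest_coefficient_mem[where t = "W i0", OF ideal[of "Suc 1"] sub[of 1] xin[of 1] cancel[of 1] WS W0[OF j0(3)] j0(1)]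
    by simp
  then have "(\<Sum>k\<le>N. x 2 ^ k * const (c i0 j0 k)) \<in> p 2" by (simp add: W_def numeral_2_eq_2)
  then have "const (c i0 j0 k0) \<in> p (Suc 2)"
    using lowest_coefficient_mem[where t = "\<lambda>k. const (c i0 j0 k)",
        OF ideal[of "Suc 2"] sub[of 2] xin[of 2] cancel[of 2] const_supp _ k0(1)] k0(3)
    by simp
  then have "const (c i0 j0 k0) \<in> p 3" by (simp add: numeral_3_eq_3 numeral_2_eq_2)
  then have "const (inverse (c i0 j0 k0)) * const (c i0 j0 k0) \<in> p 3"
    using ideal[of 3] const_supp unfolding ideal_semigroup_ring_iff by blast
  then have "1 \<in> p 3" using k0(2) by (simp add: mult_single)
  then have "p 3 = supp_in S"
    using ideal.one_imp_carrier[OF ideal[of 3]] by simp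
  then show False using primeideal.I_notcarr[OF prime[of 3]] by simp
qed

lemma krull_dim_semigroup_ring_le: "krull_dim (semigroup_ring S :: 'k::field plane_poly ring) \<le> 2"
  unfolding krull_dim_def
proof (rule Sup_least, clarify)
  fix n and p :: "nat \<Rightarrow> 'k plane_poly set"
  assume p: "\<forall>i\<le>n. primeideal (p i) (semigroup_ring S)" "\<forall>i<n. p i \<subset> p (Suc i)"
  have "n \<le> 2"
  proof (rule ccontr)
    assume "\<not> n \<le> 2"
    then show False using no_prime_chain_of_length_3[of p] p by force
  qed
  then show "enat n \<le> 2" by (simp add: numeral_eq_enat)
qed

section \<open>Maximal ideals\<close>

text \<open>An algebraic relation of a nonzero \<open>y \<in> M\<close> with \<open>x\<^sup>a\<close> and \<open>x\<^sup>b\<close> gives a nonzero polynomial \<open>P0\<close> with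
  \<open>ev P0 \<in> M\<close>. Hence the preimage of \<open>M\<close> under \<open>ev\<close> is a nonzero ideal of \<open>K[X][Y]\<close> modulo which everything
  outside is invertible, and such an ideal contains a nonzero polynomial in \<open>X\<close>.\<close>

lemma maximalideal_contains_poly_in_a:
  fixes M :: "'k::field plane_poly set"
  assumes M: "maximalideal M (semigroup_ring S)"
  shows "\<exists>f. f \<noteq> 0 \<and> eval_hom (Poly_Mapping.single 0) (mon a) f \<in> M"
proof -
  interpret M: maximalideal M "semigroup_ring S" by fact
  have M': "M \<subseteq> supp_in S" "0 \<in> M" "\<And>x y. x \<in> M \<Longrightarrow> y \<in> M \<Longrightarrow> x + y \<in> M"
      "\<And>x r. x \<in> M \<Longrightarrow> r \<in> supp_in S \<Longrightarrow> r * x \<in> M"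
    using M.is_ideal by (auto simp: ideal_semigroup_ring_iff)
  have "\<exists>y\<in>M. y \<noteq> 0"
  proof (cases "mon a \<in> M")
    case True
    then show ?thesis by (intro bexI[of _ "mon a"]) (auto simp: poly_mapping_eq_iff fun_eq_iff lookup_single)
  next
    case False
    then obtain r where r: "mon a * r - 1 \<in> M" using maximalideal_inverse[OF M single_supp[OF a_S]] by blast
    have "Poly_Mapping.lookup (mon a * r - 1) 0 = - 1"
      using nonzero by (simp add: lookup_minus lookup_mult_0 lookup_single when_def)
    then show ?thesis using r by (intro bexI[of _ "mon a * r - 1"]) auto
  qed
  then obtain y where y: "y \<in> M" "y \<noteq> 0" by blast
  obtain N c where c: "\<exists>i\<le>N. \<exists>j\<le>N. \<exists>k\<le>N. c i j k \<noteq> 0"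
    and rel: "(\<Sum>i\<le>N. y ^ i * (\<Sum>j\<le>N. mon a ^ j * (\<Sum>k\<le>N. mon b ^ k * const (c i j k)))) = 0"
    using algebraically_dependent[of y "mon a" "mon b"] by blast
  define V where "V i = (\<Sum>j\<le>N. mon a ^ j * (\<Sum>k\<le>N. mon b ^ k * const (c i j k)))" for i
  have VS: "V i \<in> supp_in S" for i
    unfolding V_def by (intro sum_supp mult_supp power_supp single_supp a_S b_S const_supp)
  obtain i0 where i0: "i0 \<le> N" "\<exists>j\<le>N. \<exists>k\<le>N. c i0 j k \<noteq> 0"
     "\<And>i. i < i0 \<Longrightarrow> \<not> (\<exists>j\<le>N. \<exists>k\<le>N. c i j k \<noteq> 0)"
    using least_index[OF c] by blast
  have V0: "V i = 0" if "i < i0" for i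
    unfolding V_def using i0(3)[OF that] by (intro sum.neutral) auto
  have "V i0 \<in> M"
    by (rule lowest_coefficient_mem[of M "{0}" y V i0 N])
       (use M.is_ideal M'(2) y VS V0 i0(1) rel in \<open>auto simp: V_def\<close>)
  define Q where "Q = {P. ev P \<in> M}"
  define P0 where "P0 = (\<Sum>k\<le>N. Polynomial.monom (\<Sum>j\<le>N. Polynomial.monom (c i0 j k) j) k)"
  have "ev P0 = (\<Sum>k\<le>N. \<Sum>j\<le>N. const (c i0 j k) * mon a ^ j * mon b ^ k)"
    unfolding P0_def ev_def
    by (simp add: ring_map_simps[OF ring_map_eval_hom[OF ring_map_eval_hom[OF ring_map_const]]]
        ring_map_simps[OF ring_map_eval_hom[OF ring_map_const]]
        eval_hom_monom[OF ring_map_eval_hom[OF ring_map_const]] eval_hom_monom[OF ring_map_const] sum_distrib_right)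
  also have "\<dots> = V i0"
    unfolding V_def sum_distrib_left by (subst sum.swap) (simp add: mult_ac)
  finally have "P0 \<in> Q" using \<open>V i0 \<in> M\<close> by (simp add: Q_def)
  moreover have "P0 \<noteq> 0"
  proof
    assume "P0 = 0"
    obtain j k where jk: "j \<le> N" "k \<le> N" "c i0 j k \<noteq> 0" using i0(2) by blast
    have "Polynomial.coeff (Polynomial.coeff P0 k) j = c i0 j k"
      using jk by (simp add: P0_def coeff_sum)
    then show False using jk \<open>P0 = 0\<close> by simp
  qed
  ultimately have "\<exists>f. f \<noteq> 0 \<and> [:f:] \<in> Q"
  proof (rule maximal_ideal_meets_coefficients[rotated 2])
    show "p + q \<in> Q" if "p \<in> Q" "q \<in> Q" for p q
      using that M'(3) by (simp add: Q_def ev_simps)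
    show "p * q \<in> Q" if "q \<in> Q" for p q
      using M'(4)[OF _ ev_supp, of "ev q" p] that by (simp add: Q_def ev_simps)
    show "\<exists>p. q * p - 1 \<in> Q" if "q \<notin> Q" for q
      using maximalideal_ev_inverse[OF M, of q] that by (simp add: Q_def)
  qed
  then show ?thesis
    by (auto simp: Q_def ev_def eval_hom_const[OF ring_map_eval_hom[OF ring_map_const]])
qed

section \<open>A regular sequence\<close>

definition divs where "divs i s \<longleftrightarrow> (\<exists>z\<in>S. s = z + scale i a)"
definition a_order where "a_order s = (GREATEST i. divs i s)"

lemma divs_bound: "divs i s \<Longrightarrow> i \<le> fst s + snd s"
proof -
  assume "divs i s"
  then have "i * (fst a + snd a) \<le> fst s + snd s" by (auto simp: divs_def algebra_simps)
  moreover have "fst a + snd a \<ge> 1" using nonzero(1) by (auto simp: prod_eq_iff)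
  then have "i * 1 \<le> i * (fst a + snd a)" by (intro mult_le_mono2)
  ultimately show ?thesis by linarith
qed

lemma divs_mono: "divs i s \<Longrightarrow> j \<le> i \<Longrightarrow> divs j s"
proof -
  assume "divs i s" "j \<le> i"
  then obtain z where z: "z \<in> S" "s = z + scale i a" by (auto simp: divs_def)
  then have "s = (z + scale (i - j) a) + scale j a"
    using scale_add(1)[of "i - j" j a] \<open>j \<le> i\<close> by (simp add: algebra_simps)
  then show "divs j s" unfolding divs_def using z by (blast intro: add_S scale_S a_S)
qed

lemma le_a_order_iff: "s \<in> S \<Longrightarrow> i \<le> a_order s \<longleftrightarrow> divs i s"
proof
  assume s: "s \<in> S"
  have "divs 0 s" using s by (simp add: divs_def)
  then have *: "divs (a_order s) s"
    unfolding a_order_def using divs_bound by (rule GreatestI_nat)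
  show "divs i s" if "i \<le> a_order s" using divs_mono[OF * that] .
  show "i \<le> a_order s" if "divs i s"
    unfolding a_order_def using that divs_bound by (rule Greatest_le_nat)
qed

lemma a_order_add_a: "s \<in> S \<Longrightarrow> a_order (s + scale n a) = a_order s + n"
proof -
  assume s: "s \<in> S"
  have "divs (i + n) (s + scale n a) \<longleftrightarrow> divs i s" for i
    unfolding divs_def by (simp add: scale_add flip: add.assoc)
  then have *: "i + n \<le> a_order (s + scale n a) \<longleftrightarrow> i \<le> a_order s" for i
    using s by (simp add: le_a_order_iff add_S scale_S a_S)
  from *[of "a_order s"] *[of "a_order (s + scale n a) - n"] *[of 0] show ?thesis by simp
qed

text \<open>This is where the condition on \<open>S\<close> enters: adding \<open>b\<close> does not create new divisibility by \<open>a\<close>.\<close>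

lemma a_order_add_b:
  assumes depth_condition "s \<in> S"
  shows "a_order (s + scale n b) = a_order s"
proof -
  have *: "divs i (s + b) \<longleftrightarrow> divs i s" if "s \<in> S" for i s
  proof
    assume "divs i s"
    then obtain z where "z \<in> S" "s = z + scale i a" by (auto simp: divs_def)
    then have "z + b \<in> S" "s + b = (z + b) + scale i a" using add_S b_S by (auto simp: algebra_simps)
    then show "divs i (s + b)" unfolding divs_def by blast
  next
    assume "divs i (s + b)"
    then show "divs i s"
      using that
    proof (induction i arbitrary: s)
      case 0
      then show ?case by (auto simp: divs_def)
    next
      case (Suc i)
      then obtain z where z: "z \<in> S" "s + b = z + scale (Suc i) a" by (auto simp: divs_def)
      then have "s + b = (z + scale i a) + a" by (simp add: scale_Suc algebra_simps)
      moreover have "z + scale i a \<in> S" using z by (intro add_S scale_S a_S)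
      ultimately obtain t where t: "t \<in> S" "s = t + a"
        using assms(1) Suc.prems unfolding depth_condition_def by blast
      have "t + b = z + scale i a"
        using z(2) unfolding t(2) scale_Suc by (simp add: prod_eq_iff)
      then have "divs i (t + b)" using z(1) by (auto simp: divs_def)
      then have "divs i t" using Suc.IH t by blast
      then obtain z' where "z' \<in> S" "t = z' + scale i a" by (auto simp: divs_def)
      then show ?case unfolding divs_def t(2) scale_Suc by (auto simp: algebra_simps)
    qed
  qed
  have one: "a_order (s + b) = a_order s" if "s \<in> S" for s
    using *[OF that] that le_a_order_iff add_S b_S by (metis order_antisym order_refl)
  show ?thesis
  proof (induction n)
    case (Suc n)
    have "s + scale (Suc n) b = (s + scale n b) + b" by (simp add: scale_Suc algebra_simps)
    then show ?case using Suc one[of "s + scale n b"] assms add_S scale_S b_S by simp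
  qed simp
qed

abbreviation at_a :: "'k::field poly \<Rightarrow> 'k plane_poly" where
  "at_a \<equiv> eval_hom (Poly_Mapping.single 0) (mon a)"
abbreviation at_b :: "'k::field poly \<Rightarrow> 'k plane_poly" where
  "at_b \<equiv> eval_hom (Poly_Mapping.single 0) (mon b)"

lemma at_a_altdef: "at_a f = (\<Sum>i\<le>Polynomial.degree f. Poly_Mapping.single (scale i a) (Polynomial.coeff f i))"
  by (simp add: eval_hom_altdef[OF ring_map_const] mon_power mult_single)

lemma at_b_altdef: "at_b f = (\<Sum>i\<le>Polynomial.degree f. Poly_Mapping.single (scale i b) (Polynomial.coeff f i))"
  by (simp add: eval_hom_altdef[OF ring_map_const] mon_power mult_single)

lemma at_supp: "at_a f \<in> supp_in S" "at_b f \<in> supp_in S"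
  unfolding at_a_altdef at_b_altdef by (intro sum_supp single_supp scale_S a_S b_S)+

text \<open>A remainder of division by \<open>f(x\<^sup>a)\<close> is unique: among the exponents of \<open>k\<close> take one of largest order; the
  leading term of \<open>f\<close> moves it to an exponent of order at least \<open>deg f\<close> where nothing cancels.\<close>

lemma multiple_of_at_a_small_order:
  fixes k :: "'k::field plane_poly"
  assumes f: "f \<noteq> 0" and k: "k \<in> supp_in S"
    and small: "\<And>s. s \<in> Poly_Mapping.keys (at_a f * k) \<Longrightarrow> a_order s < Polynomial.degree f"
  shows "k = 0"
proof (rule ccontr)
  assume "k \<noteq> 0"
  let ?n = "Polynomial.degree f"
  have "Poly_Mapping.keys k \<noteq> {}" using \<open>k \<noteq> 0\<close> by (auto simp: poly_mapping_eq_iff fun_eq_iff in_keys_iff)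
  then have "Max (a_order ` Poly_Mapping.keys k) \<in> a_order ` Poly_Mapping.keys k" by (intro Max_in) auto
  then obtain s where s: "s \<in> Poly_Mapping.keys k" "a_order s = Max (a_order ` Poly_Mapping.keys k)" by force
  have max: "a_order t \<le> a_order s" if "t \<in> Poly_Mapping.keys k" for t
    unfolding s(2) using that by (intro Max_ge) auto
  have sS: "s \<in> S" using s k by (auto simp: supp_in_def)
  have coeff: "Poly_Mapping.lookup (Poly_Mapping.single (scale i a) (Polynomial.coeff f i) * k) (s + scale ?n a)
      = (if i = ?n then Polynomial.coeff f i * Poly_Mapping.lookup k s else 0)" if "i \<le> ?n" for i
  proof -
    have "s + scale ?n a = scale i a + (s + scale (?n - i) a)"
      using scale_add(1)[of i "?n - i" a] that by (simp add: algebra_simps)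
    then have *: "Poly_Mapping.lookup (Poly_Mapping.single (scale i a) (Polynomial.coeff f i) * k) (s + scale ?n a)
      = Polynomial.coeff f i * Poly_Mapping.lookup k (s + scale (?n - i) a)"
      by (simp only: lookup_single_mult)
    show ?thesis
    proof (cases "i = ?n")
      case False
      then have "a_order (s + scale (?n - i) a) > a_order s" using that sS by (simp add: a_order_add_a)
      then have "s + scale (?n - i) a \<notin> Poly_Mapping.keys k" using max by (meson leD)
      then show ?thesis using * False by (simp add: in_keys_iff)
    qed (use * in simp)
  qed
  have "Poly_Mapping.lookup (at_a f * k) (s + scale ?n a) = Polynomial.lead_coeff f * Poly_Mapping.lookup k s"
    by (simp add: at_a_altdef sum_distrib_right lookup_sum coeff)
  then have "s + scale ?n a \<in> Poly_Mapping.keys (at_a f * k)"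
    using f s(1) by (simp add: in_keys_iff)
  from small[OF this] show False using a_order_add_a[OF sS, of ?n] by simp
qed

lemma at_a_nonzero: "f \<noteq> 0 \<Longrightarrow> at_a f \<noteq> 0"
  using multiple_of_at_a_small_order[of f 1] by auto

text \<open>For the monomial \<open>x\<^sup>z (x\<^sup>a)\<^sup>n\<close> with \<open>z\<close> of order 0, this is division of \<open>X\<^sup>n\<close> by \<open>f\<close> in \<open>K[X]\<close>.\<close>

lemma division_by_at_a:
  fixes f :: "'k::field poly"
  assumes f: "f \<noteq> 0" and r: "r \<in> supp_in S"
  shows "\<exists>k\<in>supp_in S. \<exists>r'\<in>supp_in S. r = at_a f * k + r' \<and>
     (\<forall>s\<in>Poly_Mapping.keys r'. a_order s < Polynomial.degree f)"
  using r
proof (induction rule: supp_induct)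
  case zero
  show ?case by (intro bexI[of _ 0]) auto
next
  case (single s c)
  obtain z where z: "z \<in> S" "s = z + scale (a_order s) a"
    using le_a_order_iff[OF single, of "a_order s"] by (auto simp: divs_def)
  have z0: "a_order z = 0" using a_order_add_a[OF z(1), of "a_order s"] z(2) by simp
  let ?m = "Polynomial.monom 1 (a_order s)"
  define q r' where "q = ?m div f" and "r' = ?m mod f"
  have "at_a ?m = at_a (f * q + r')" by (simp add: q_def r'_def)
  then have "mon (scale (a_order s) a) = at_a f * at_a q + at_a r'"
    by (simp add: ring_map_simps[OF ring_map_eval_hom[OF ring_map_const]] eval_hom_monom[OF ring_map_const] mon_power)
  moreover have "Poly_Mapping.single s c = Poly_Mapping.single z c * mon (scale (a_order s) a)"
    by (subst z(2)) (simp add: mult_single)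
  ultimately have "Poly_Mapping.single s c = at_a f * (at_a q * Poly_Mapping.single z c) + at_a r' * Poly_Mapping.single z c"
    by (simp add: algebra_simps)
  moreover have "a_order t < Polynomial.degree f" if t: "t \<in> Poly_Mapping.keys (at_a r' * Poly_Mapping.single z c)" for t
  proof -
    have "at_a r' * Poly_Mapping.single z c
      = (\<Sum>i\<le>Polynomial.degree r'. Poly_Mapping.single (z + scale i a) (c * Polynomial.coeff r' i))"
      unfolding at_a_altdef sum_distrib_right
      by (intro sum.cong refl) (simp add: mult_single add.commute mult.commute)
    then have "(\<Sum>i\<le>Polynomial.degree r'. Poly_Mapping.lookup (Poly_Mapping.single (z + scale i a) (c * Polynomial.coeff r' i)) t) \<noteq> 0"
      using t by (simp add: in_keys_iff lookup_sum)
    then obtain i where i: "i \<le> Polynomial.degree r'"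
        "Poly_Mapping.lookup (Poly_Mapping.single (z + scale i a) (c * Polynomial.coeff r' i)) t \<noteq> 0"
      by (meson atMost_iff sum.not_neutral_contains_not_neutral)
    then have "t = z + scale i a" "Polynomial.coeff r' i \<noteq> 0" by (auto simp: lookup_single when_def split: if_splits)
    then have "a_order t = i" "r' \<noteq> 0" using a_order_add_a[OF z(1)] z0 by auto
    then show ?thesis using degree_mod_less[OF f, of ?m] i(1) by (auto simp: r'_def)
  qed
  ultimately show ?case
    using at_supp single_supp[OF z(1)] mult_supp by blast
next
  case (add p q)
  then obtain k r' l t where *: "k \<in> supp_in S" "r' \<in> supp_in S" "p = at_a f * k + r'"
     "\<forall>s\<in>Poly_Mapping.keys r'. a_order s < Polynomial.degree f"
     "l \<in> supp_in S" "t \<in> supp_in S" "q = at_a f * l + t"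
     "\<forall>s\<in>Poly_Mapping.keys t. a_order s < Polynomial.degree f" by blast
  have "p + q = at_a f * (k + l) + (r' + t)" using * by (simp add: algebra_simps)
  moreover have "\<forall>s\<in>Poly_Mapping.keys (r' + t). a_order s < Polynomial.degree f"
    using * keys_add[of r' t] by blast
  ultimately show ?case using * add_supp by blast
qed

text \<open>Replace \<open>r\<close> by its remainder \<open>r'\<close> modulo \<open>f(x\<^sup>a)\<close>. Multiplication by \<open>g(x\<^sup>b)\<close> preserves orders, so
  \<open>g(x\<^sup>b) r'\<close> is a multiple of \<open>f(x\<^sup>a)\<close> and at the same time a remainder; hence it is 0.\<close>

lemma at_a_at_b_regular:
  fixes f g :: "'k::field poly"
  assumes D: depth_condition and f: "f \<noteq> 0" and g: "at_b g \<noteq> 0"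
    and r: "r \<in> supp_in S" and k: "k \<in> supp_in S" and eq: "at_b g * r = at_a f * k"
  shows "\<exists>q\<in>supp_in S. r = at_a f * q"
proof -
  obtain q r' where q: "q \<in> supp_in S" "r' \<in> supp_in S" "r = at_a f * q + r'"
    "\<And>s. s \<in> Poly_Mapping.keys r' \<Longrightarrow> a_order s < Polynomial.degree f"
    using division_by_at_a[OF f r] by blast
  have r': "at_b g * r' = at_a f * (k - at_b g * q)"
    using eq unfolding q(3) by (simp add: algebra_simps)
  have "k - at_b g * q = 0"
  proof (rule multiple_of_at_a_small_order[OF f])
    show "k - at_b g * q \<in> supp_in S" by (intro diff_supp mult_supp k q at_supp)
    fix s assume "s \<in> Poly_Mapping.keys (at_a f * (k - at_b g * q))"
    then have "s \<in> Poly_Mapping.keys (at_b g * r')" by (simp add: r')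
    moreover have "at_b g * r' = (\<Sum>i\<le>Polynomial.degree g. Poly_Mapping.single (scale i b) (Polynomial.coeff g i) * r')"
      by (simp add: at_b_altdef sum_distrib_right)
    ultimately have "(\<Sum>i\<le>Polynomial.degree g. Poly_Mapping.lookup (Poly_Mapping.single (scale i b) (Polynomial.coeff g i) * r') s) \<noteq> 0"
      by (simp add: in_keys_iff lookup_sum)
    then obtain i where "Poly_Mapping.lookup (Poly_Mapping.single (scale i b) (Polynomial.coeff g i) * r') s \<noteq> 0"
      by (meson sum.not_neutral_contains_not_neutral)
    then obtain u where u: "u \<in> Poly_Mapping.keys r'" "s = scale i b + u"
      using lookup_single_mult_outside by metis
    then have "u \<in> S" using q(2) by (auto simp: supp_in_def)
    then have "a_order s = a_order u" using a_order_add_b[OF D, of u i] u(2) by (simp add: add.commute)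
    then show "a_order s < Polynomial.degree f" using q(4) u(1) by simp
  qed
  then have "r' = 0" using r' g by simp
  then show ?thesis using q by auto
qed

lemma depth_condition_imp_cohen_macaulay:
  assumes depth_condition
  shows "cohen_macaulay (semigroup_ring S :: 'k::field plane_poly ring)"
proof -
  let ?R = "semigroup_ring S :: 'k plane_poly ring"
  interpret R: cring ?R by (rule cring_semigroup_ring)
  interpret sw: simplicial_semigroup S b a by (rule swap)
  have "local_depth (localization_at ?R M) = krull_dim (localization_at ?R M)" if M: "maximalideal M ?R" for M
  proof -
    interpret M: maximalideal M ?R by fact
    interpret P: prime_localization ?R M
      by (intro prime_localization.intro R.is_cring R.maximalideal_prime M)
    have L: "localization_at ?R M = P.L" by (simp add: localization_at_def)
    obtain f where f: "f \<noteq> 0" "at_a f \<in> M" using maximalideal_contains_poly_in_a[OF M] by blast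
    obtain g where g: "g \<noteq> 0" "at_b g \<in> M" using sw.maximalideal_contains_poly_in_a[OF M] by blast
    have g0: "at_b g \<noteq> 0" using sw.at_a_nonzero[OF g(1)] .
    have "2 \<le> local_depth (localization_at ?R M)"
    proof (rule P.regular_pair_localizes[OF f(2) g(2)])
      fix r assume "r \<in> carrier ?R" "at_a f \<otimes>\<^bsub>?R\<^esub> r = \<zero>\<^bsub>?R\<^esub>"
      then show "r = \<zero>\<^bsub>?R\<^esub>" using at_a_nonzero[OF f(1)] by simp
    next
      fix r assume r: "r \<in> carrier ?R" "at_b g \<otimes>\<^bsub>?R\<^esub> r \<in> PIdl\<^bsub>?R\<^esub> at_a f"
      then obtain k where "k \<in> supp_in S" "at_b g * r = at_a f * k"
        by (auto simp: cgenideal_def mult.commute)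
      then obtain q where "q \<in> supp_in S" "r = at_a f * q"
        using at_a_at_b_regular[OF assms f(1) g0] r by auto
      then show "r \<in> PIdl\<^bsub>?R\<^esub> at_a f" by (auto simp: cgenideal_def mult.commute)
    qed
    moreover have "local_depth (localization_at ?R M) \<le> krull_dim (localization_at ?R M)"
      unfolding L by (rule P.L.local_depth_le_krull_dim)
    moreover have "krull_dim (localization_at ?R M) \<le> 2"
      unfolding L using P.krull_dim_localization_le krull_dim_semigroup_ring_le order_trans by blast
    ultimately show ?thesis by simp
  qed
  then show ?thesis
    unfolding cohen_macaulay_def using R.is_cring noetherian_semigroup_ring by blast
qed

section \<open>Failure of the depth condition\<close>

text \<open>A violation of the condition is a lattice point \<open>z \<notin> S\<close> with \<open>z + a, z + b \<in> S\<close>. Only finitely many \<open>s \<in> S\<close>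
  satisfy \<open>z + s \<notin> S\<close>, because they all lie in the Apery set; a largest one gives \<open>f = z + s\<close>.\<close>

lemma exists_socle_element:
  assumes "\<not> depth_condition"
  shows "\<exists>f. f \<notin> S \<and> (\<forall>s\<in>S. s \<noteq> 0 \<longrightarrow> f + s \<in> S)"
proof -
  obtain s t where st: "s \<in> S" "t \<in> S" "s + b = t + a" "\<And>z. z \<in> S \<Longrightarrow> s \<noteq> z + a"
    using assms unfolding depth_condition_def by blast
  \<comment> \<open>The point \<open>s - a = t - b\<close> has nonnegative coordinates because both cone coordinates are.\<close>
  have "\<exists>z. s = z + a"
  proof -
    obtain k i j where k: "k > 0" "scale k s = scale i a + scale j b" using multiple[OF st(1)] by blast
    obtain k' i' j' where k': "k' > 0" "scale k' t = scale i' a + scale j' b" using multiple[OF st(2)] by blast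
    have "k * fst s = i * fst a + j * fst b" "k * snd s = i * snd a + j * snd b"
      "k' * fst t = i' * fst a + j' * fst b" "k' * snd t = i' * snd a + j' * snd b"
      "fst s + fst b = fst t + fst a" "snd s + snd b = snd t + snd a"
      using k(2) k'(2) st(3) by (simp_all add: prod_eq_iff)
    note ints = this[THEN arg_cong[of _ _ int], unfolded of_nat_add of_nat_mult]
    define I where "I = int i * int k' - int k * int k' - int k * int i'"
    define J where "J = int j * int k' + int k * int k' - int k * int j'"
    have "int k * int k' * (int (fst s) + int (fst b) - int (fst t) - int (fst a)) = 0"
      "int k * int k' * (int (snd s) + int (snd b) - int (snd t) - int (snd a)) = 0"
      using ints by simp_all
    moreover have "int k * int k' * (int (fst s) + int (fst b) - int (fst t) - int (fst a))
        = int k' * (int k * int (fst s)) - int k * (int k' * int (fst t)) + int k * int k' * (int (fst b) - int (fst a))"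
      "int k * int k' * (int (snd s) + int (snd b) - int (snd t) - int (snd a))
        = int k' * (int k * int (snd s)) - int k * (int k' * int (snd t)) + int k * int k' * (int (snd b) - int (snd a))"
      by (simp_all add: algebra_simps)
    ultimately have "I * fst (int_vec a) + J * fst (int_vec b) = 0" "I * snd (int_vec a) + J * snd (int_vec b) = 0"
      unfolding ints(1-4) I_def J_def by (simp_all add: algebra_simps)
    then have "I = 0" by (rule independent(1))
    then have "int k' * int i = int k' * int k + int k * int i'" by (simp add: I_def algebra_simps)
    then have "k' * i = k' * k + k * i'" by (metis of_nat_add of_nat_eq_iff of_nat_mult)
    then have "k' * k \<le> k' * i" by simp
    then have ik: "k \<le> i" using k'(1) by simp
    have "k * fst a \<le> k * fst s" "k * snd a \<le> k * snd s"
      using k(2) mult_le_mono1[OF ik] by (simp_all add: prod_eq_iff trans_le_add1)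
    then have "fst a \<le> fst s" "snd a \<le> snd s" using k(1) by simp_all
    then show ?thesis by (intro exI[of _ "(fst s - fst a, snd s - snd a)"]) (simp add: prod_eq_iff)
  qed
  then obtain z where z: "s = z + a" by blast
  have t: "t = z + b" using st(3) unfolding z by (simp add: prod_eq_iff)
  have zS: "z \<notin> S" using st(4) z by blast
  define Y where "Y = {s \<in> S. z + s \<notin> S}"
  have "Y \<subseteq> Ap"
  proof
    fix x assume x: "x \<in> Y"
    have "x \<noteq> y + a \<and> x \<noteq> y + b" if y: "y \<in> S" for y
    proof (rule ccontr)
      assume "\<not> ?thesis"
      then have "z + x = s + y \<or> z + x = t + y" using z t by (auto simp: algebra_simps)
      then have "z + x \<in> S" using add_S[OF st(1) y] add_S[OF st(2) y] by metis
      then show False using x by (simp add: Y_def)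
    qed
    then show "x \<in> Ap" using x by (simp add: mem_Ap_iff Y_def)
  qed
  then have fin: "finite Y" using finite_Ap finite_subset by blast
  have "0 \<in> Y" using zS by (simp add: Y_def)
  then have "Max ((\<lambda>s. fst s + snd s) ` Y) \<in> (\<lambda>s. fst s + snd s) ` Y" using fin by (intro Max_in) auto
  then obtain x where x: "x \<in> Y" "fst x + snd x = Max ((\<lambda>s. fst s + snd s) ` Y)" by force
  have "(z + x) + y \<in> S" if y: "y \<in> S" "y \<noteq> 0" for y
  proof (rule ccontr)
    assume "(z + x) + y \<notin> S"
    then have "x + y \<in> Y" using x y add_S by (auto simp: Y_def add.assoc)
    from Max_ge[OF finite_imageI[OF fin] imageI[OF this]]
    have "fst (x + y) + snd (x + y) \<le> fst x + snd x" unfolding x(2) .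
    then show False using y(2) by (simp add: prod_eq_iff)
  qed
  then show ?thesis using x(1) by (intro exI[of _ "z + x"]) (auto simp: Y_def)
qed

lemma maximalideal_monomials:
  "maximalideal {p \<in> supp_in S. Poly_Mapping.lookup p 0 = 0} (semigroup_ring S :: 'k::field plane_poly ring)"
    (is "maximalideal ?m _")
proof (rule maximalidealI)
  show id: "ideal ?m (semigroup_ring S)"
    by (auto simp: ideal_semigroup_ring_iff lookup_add lookup_mult_0 intro: add_supp mult_supp)
  show "carrier (semigroup_ring S :: 'k plane_poly ring) \<noteq> ?m"
  proof
    assume eq: "carrier (semigroup_ring S :: 'k plane_poly ring) = ?m"
    have "1 \<in> carrier (semigroup_ring S :: 'k plane_poly ring)" by simp
    then have "1 \<in> ?m" unfolding eq .
    then show False by simp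
  qed
  fix J assume J: "ideal J (semigroup_ring S :: 'k plane_poly ring)" "?m \<subseteq> J" "J \<subseteq> carrier (semigroup_ring S)"
  show "J = ?m \<or> J = carrier (semigroup_ring S)"
  proof (rule disjCI)
    assume "J \<noteq> carrier (semigroup_ring S)"
    then have one: "1 \<notin> J" using ideal.one_imp_carrier[OF J(1)] by auto
    have "p \<in> ?m" if p: "p \<in> J" for p
    proof (rule ccontr)
      assume "p \<notin> ?m"
      define c where "c = Poly_Mapping.lookup p 0"
      have pS: "p \<in> supp_in S" using p J by auto
      then have c: "c \<noteq> 0" using \<open>p \<notin> ?m\<close> by (auto simp: c_def)
      have "p - const c \<in> ?m" using diff_supp[OF pS const_supp] by (simp add: c_def lookup_minus)
      then have "p - (p - const c) \<in> J" using ideal_diff_mem[OF J(1) p] J(2) by blast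
      then have "const c \<in> J" by simp
      then have "const (inverse c) * const c \<in> J"
        using J(1) const_supp unfolding ideal_semigroup_ring_iff by blast
      then show False using one c by (simp add: mult_single)
    qed
    then show "J = ?m" using J by blast
  qed
qed

text \<open>The localization at the origin has dimension at least 2, but a monomial \<open>x\<^sup>f\<close> outside \<open>K[S]\<close> that the
  maximal ideal multiplies into \<open>K[S]\<close> obstructs a regular sequence of length 2.\<close>

lemma cohen_macaulay_imp_depth_condition:
  assumes CM: "cohen_macaulay (semigroup_ring S :: 'k::field plane_poly ring)"
  shows depth_condition
proof (rule ccontr)
  assume "\<not> depth_condition"
  then obtain f where f: "f \<notin> S" "\<And>s. s \<in> S \<Longrightarrow> s \<noteq> 0 \<Longrightarrow> f + s \<in> S"
    using exists_socle_element by blast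
  let ?R = "semigroup_ring S :: 'k plane_poly ring"
  define m where "m = {p \<in> supp_in S. Poly_Mapping.lookup p 0 = (0::'k)}"
  interpret R: cring ?R by (rule cring_semigroup_ring)
  note carrier_semigroup_ring [simp del]
  have mult_carrier: "p * q \<in> carrier ?R" if "p \<in> carrier ?R" "q \<in> carrier ?R" for p q
    using R.m_closed[OF that] by simp
  have max: "maximalideal m ?R" unfolding m_def by (rule maximalideal_monomials)
  interpret M: maximalideal m ?R by (rule max)
  interpret P: prime_localization ?R m
    by (intro prime_localization.intro R.is_cring R.maximalideal_prime max)
  have L: "localization_at ?R m = P.L" by (simp add: localization_at_def)
  have W_iff: "u \<in> carrier ?R - m \<longleftrightarrow> u \<in> supp_in S \<and> Poly_Mapping.lookup u 0 \<noteq> 0" for u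
    by (auto simp: m_def carrier_semigroup_ring)
  have W_D: "Poly_Mapping.lookup u 0 \<noteq> 0" if "u \<in> carrier ?R - m" for u
    using that unfolding W_iff by simp
  have mon_m: "mon s \<in> m" if "s \<in> S" "s \<noteq> 0" for s
    using that by (simp add: m_def single_supp lookup_single when_def)
  have inj: "p = q" if "mon s * p = mon s * (q :: 'k plane_poly)" for s p q
    by (rule poly_mapping_eqI) (use that lookup_single_mult[of s 1] in \<open>metis mult_1\<close>)
  interpret LM: maximalideal P.max_ideal P.L by (rule P.maximalideal_max_ideal)
  have LM_prime: "primeideal P.max_ideal P.L" by (rule P.L.maximalideal_prime[OF P.maximalideal_max_ideal])
  have one_W: "1 \<in> carrier ?R - m" unfolding W_iff by simp
  let ?a = "P.frac (mon a) 1" and ?b = "P.frac (mon b) 1"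
  have ab: "mon a \<in> carrier ?R" "mon b \<in> carrier ?R" by (simp_all add: carrier_semigroup_ring single_supp a_S b_S)
  have abL: "?a \<in> carrier P.L" "?b \<in> carrier P.L" using ab one_W by auto
  \<comment> \<open>The chain is built downwards from the maximal ideal: first a prime that contains \<open>x\<^sup>b\<close> but not \<open>x\<^sup>a\<close>, then one without \<open>x\<^sup>b\<close>.\<close>
  have dim: "2 \<le> krull_dim P.L"
  proof -
    have pow: "?a [^]\<^bsub>P.L\<^esub> (k::nat) = P.frac (mon (scale k a)) 1" "?b [^]\<^bsub>P.L\<^esub> (k::nat) = P.frac (mon (scale k b)) 1" for k
      using P.frac_pow[OF ab(1), of k] P.frac_pow[OF ab(2), of k] by (simp_all add: mon_power)
    have b_max: "?b \<in> P.max_ideal"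
      using P.frac_in_max_ideal_iff[OF ab(2) one_W] mon_m[OF b_S nonzero(2)] by simp
    have a_max: "?a \<in> P.max_ideal"
      using P.frac_in_max_ideal_iff[OF ab(1) one_W] mon_m[OF a_S nonzero(1)] by simp
    have reg: "x \<in> P.max_ideal" if x: "x \<in> carrier P.L" "?a [^]\<^bsub>P.L\<^esub> (k::nat) \<otimes>\<^bsub>P.L\<^esub> x \<in> PIdl\<^bsub>P.L\<^esub> ?b" for k x
    proof -
      obtain c t where c: "c \<in> carrier ?R" "t \<in> carrier ?R - m" "x = P.frac c t"
        using x(1) by (rule P.carrier_localizationE)
      obtain y where "y \<in> carrier P.L" "?a [^]\<^bsub>P.L\<^esub> k \<otimes>\<^bsub>P.L\<^esub> x = y \<otimes>\<^bsub>P.L\<^esub> ?b"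
        using x(2) unfolding cgenideal_def by blast
      then obtain d w where d: "d \<in> carrier ?R" "w \<in> carrier ?R - m"
        "?a [^]\<^bsub>P.L\<^esub> k \<otimes>\<^bsub>P.L\<^esub> P.frac c t = P.frac d w \<otimes>\<^bsub>P.L\<^esub> ?b"
        using c(3) by (metis P.carrier_localizationE)
      have monk: "mon (scale k a) \<in> carrier ?R" by (simp add: carrier_semigroup_ring single_supp scale_S a_S)
      have "P.frac (mon (scale k a) * c) t = P.frac (d * mon b) w"
        using d(3) P.mult_frac[OF monk one_W c(1,2)] P.mult_frac[OF d(1,2) ab(2) one_W] by (simp add: pow)
      then obtain u where u: "u \<in> carrier ?R - m" "u * (mon (scale k a) * c * w) = u * (d * mon b * t)"
        using P.frac_eq_iff[of "mon (scale k a) * c" t "d * mon b" w] c(1,2) d(1,2) ab(2) monk mult_carrier by auto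
      have eq: "mon (scale k a) * (u * c * w) = mon b * (u * d * t)" using u(2) by (simp add: mult_ac)
      have udt: "u * d * t \<in> supp_in S" using u(1) d(1) c(2) by (simp add: carrier_semigroup_ring mult_supp)
      have "Poly_Mapping.lookup (mon b * (u * d * t)) (scale k a) = 0"
      proof (rule lookup_single_mult_outside)
        fix v assume "v \<in> Poly_Mapping.keys (u * d * t)"
        then have v: "v \<in> S" using udt by (auto simp: supp_in_def)
        show "scale k a \<noteq> b + v"
        proof
          assume *: "scale k a = b + v"
          obtain l i j where l: "l > 0" "scale l v = scale i a + scale j b" using multiple[OF v] by blast
          have "l * (k * fst a) = l * fst b + l * fst v" "l * (k * snd a) = l * snd b + l * snd v"
            using * by (simp_all add: prod_eq_iff algebra_simps flip: distrib_left)
          then have "l * (k * fst a) = l * fst b + (i * fst a + j * fst b)" "l * (k * snd a) = l * snd b + (i * snd a + j * snd b)"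
            using l(2) by (simp_all add: prod_eq_iff)
          note ints = this[THEN arg_cong[of _ _ int], unfolded of_nat_add of_nat_mult]
          have "(int i - int l * int k) * fst (int_vec a) + (int l + int j) * fst (int_vec b) = 0"
            "(int i - int l * int k) * snd (int_vec a) + (int l + int j) * snd (int_vec b) = 0"
            using ints by (simp_all add: algebra_simps)
          then have "int l + int j = 0" by (rule independent(2))
          then show False using l(1) by simp
        qed
      qed
      moreover have "Poly_Mapping.lookup (mon (scale k a) * (u * c * w)) (scale k a) = Poly_Mapping.lookup (u * c * w) 0"
        using lookup_single_mult[of "scale k a" 1 "u * c * w" 0] by simp
      ultimately have "Poly_Mapping.lookup u 0 * Poly_Mapping.lookup c 0 * Poly_Mapping.lookup w 0 = 0"
        using eq by (simp add: lookup_mult_0)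
      then have "Poly_Mapping.lookup c 0 = 0" using W_D[OF u(1)] W_D[OF d(2)] by simp
      then have "c \<in> m" using c(1) by (simp add: m_def carrier_semigroup_ring)
      then show ?thesis using P.frac_in_max_ideal_iff[OF c(1,2)] c(3) by simp
    qed
    have sub: "PIdl\<^bsub>P.L\<^esub> ?b \<subseteq> P.max_ideal" by (rule P.L.cgenideal_minimal[OF LM.is_ideal b_max])
    have "\<exists>q. primeideal q P.L \<and> PIdl\<^bsub>P.L\<^esub> ?b \<subseteq> q \<and> q \<subseteq> P.max_ideal \<and> ?a \<notin> q"
      by (rule P.L.exists_smaller_prime[OF LM_prime P.L.cgenideal_ideal[OF abL(2)] sub abL(1)]) (rule reg)
    then obtain p1 where p1: "primeideal p1 P.L" "PIdl\<^bsub>P.L\<^esub> ?b \<subseteq> p1" "p1 \<subseteq> P.max_ideal" "?a \<notin> p1"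
      by blast
    interpret p1: primeideal p1 P.L by (rule p1)
    have reg0: "x \<in> p1" if x: "x \<in> carrier P.L" "?b [^]\<^bsub>P.L\<^esub> (k::nat) \<otimes>\<^bsub>P.L\<^esub> x \<in> {\<zero>\<^bsub>P.L\<^esub>}" for k x
    proof -
      obtain c t where c: "c \<in> carrier ?R" "t \<in> carrier ?R - m" "x = P.frac c t"
        using x(1) by (rule P.carrier_localizationE)
      have monk: "mon (scale k b) \<in> carrier ?R" by (simp add: carrier_semigroup_ring single_supp scale_S b_S)
      have "P.frac (mon (scale k b) * c) t = P.frac 0 1"
        using x(2) P.mult_frac[OF monk one_W c(1,2)] by (simp add: pow c(3) P.zero_localization)
      then obtain u where u: "u \<in> carrier ?R - m" "u * (mon (scale k b) * c * 1) = u * (0 * t)"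
        using P.frac_eq_iff[of "mon (scale k b) * c" t 0 1] c(1,2) monk one_W mult_carrier R.zero_closed by auto
      have "u \<noteq> 0" using W_D[OF u(1)] by auto
      moreover have "mon (scale k b) \<noteq> (0 :: 'k plane_poly)" by (simp add: poly_mapping_eq_iff fun_eq_iff lookup_single when_def)
      ultimately have "c = 0" using u(2) by simp
      then have "x = \<zero>\<^bsub>P.L\<^esub>" using c P.frac_zero[OF c(2)] by simp
      then show ?thesis using p1.zero_closed by simp
    qed
    have "{\<zero>\<^bsub>P.L\<^esub>} \<subseteq> p1" using p1.zero_closed by blast
    then have "\<exists>q. primeideal q P.L \<and> {\<zero>\<^bsub>P.L\<^esub>} \<subseteq> q \<and> q \<subseteq> p1 \<and> ?b \<notin> q"
      by (rule P.L.exists_smaller_prime[OF p1(1) P.L.zeroideal _ abL(2)]) (rule reg0)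
    then obtain p0 where p0: "primeideal p0 P.L" "p0 \<subseteq> p1" "?b \<notin> p0"
      by blast
    have "?b \<in> p1" using P.L.cgenideal_self[OF abL(2)] p1(2) by blast
    then have "p0 \<subset> p1" "p1 \<subset> P.max_ideal" using p0 p1 a_max by blast+
    then have "enat 2 \<le> krull_dim P.L"
      using p0(1) p1(1) LM_prime
      by (intro krull_dim_ge[where p = "\<lambda>i. if i = 0 then p0 else if i = 1 then p1 else P.max_ideal"])
         (auto simp: less_2_cases_iff)
    then show ?thesis by (simp add: numeral_eq_enat)
  qed
  have "2 \<le> local_depth P.L"
    using CM max dim unfolding cohen_macaulay_def L[symmetric] by metis
  then have "\<exists>xs. regular_sequence P.L xs \<and> set xs \<subseteq> P.max_ideal \<and> 2 \<le> length xs"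
  proof -
    have "1 < local_depth P.L" using \<open>2 \<le> local_depth P.L\<close> by (rule less_le_trans[rotated]) simp
    then show ?thesis
      unfolding local_depth_def using P.the_maximalideal L
      by (auto simp: less_Sup_iff one_enat_def)
  qed
  then obtain xs where xs: "regular_sequence P.L xs" "set xs \<subseteq> P.max_ideal" "2 \<le> length xs" by blast
  obtain y1 y2 where y: "y1 \<in> set xs" "y2 \<in> set xs"
    "\<And>r. r \<in> carrier P.L \<Longrightarrow> y1 \<otimes>\<^bsub>P.L\<^esub> r = \<zero>\<^bsub>P.L\<^esub> \<Longrightarrow> r = \<zero>\<^bsub>P.L\<^esub>"
    "\<And>r. r \<in> carrier P.L \<Longrightarrow> y2 \<otimes>\<^bsub>P.L\<^esub> r \<in> PIdl\<^bsub>P.L\<^esub> y1 \<Longrightarrow> r \<in> PIdl\<^bsub>P.L\<^esub> y1"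
    using P.L.regular_sequence_first_two[OF xs(1,3)] by blast
  obtain p1 t1 where p1: "p1 \<in> m" "t1 \<in> carrier ?R - m" "y1 = P.frac p1 t1"
    using y(1) xs(2) unfolding P.max_ideal_def by blast
  obtain p2 t2 where p2: "p2 \<in> m" "t2 \<in> carrier ?R - m" "y2 = P.frac p2 t2"
    using y(2) xs(2) unfolding P.max_ideal_def by blast
  have shift: "mon f * p \<in> supp_in S" if "p \<in> m" for p
  proof -
    have "f + s \<in> S" if "s \<in> Poly_Mapping.keys p" for s
    proof -
      have "s \<noteq> 0" using that \<open>p \<in> m\<close> by (auto simp: m_def in_keys_iff)
      moreover have "s \<in> S" using that \<open>p \<in> m\<close> by (auto simp: m_def supp_in_def)
      ultimately show ?thesis using f(2) by blast
    qed
    then show ?thesis by (auto simp: supp_in_def keys_mon_mult)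
  qed
  have pS: "p1 \<in> carrier ?R" "p2 \<in> carrier ?R" using p1(1) p2(1) by (simp_all add: m_def carrier_semigroup_ring)
  have fp: "mon f * p1 \<in> carrier ?R" "mon f * p2 \<in> carrier ?R" using shift p1 p2 by (simp_all add: carrier_semigroup_ring)
  let ?F1 = "P.frac (mon f * p1) t1" and ?F2 = "P.frac (mon f * p2) t2"
  have FL: "?F1 \<in> carrier P.L" "?F2 \<in> carrier P.L" using fp p1(2) p2(2) by auto
  \<comment> \<open>\<open>?F1\<close> and \<open>?F2\<close> stand for \<open>y1 x\<^sup>f\<close> and \<open>y2 x\<^sup>f\<close>.\<close>
  have "y2 \<otimes>\<^bsub>P.L\<^esub> ?F1 = ?F2 \<otimes>\<^bsub>P.L\<^esub> y1"
    unfolding p1(3) p2(3) using pS fp p1(2) p2(2) P.mult_W[OF p1(2) p2(2)] P.mult_W[OF p2(2) p1(2)]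
    by (simp only: P.mult_frac) (intro P.frac_eqI, auto simp: mult_ac mult_carrier)
  then have "y2 \<otimes>\<^bsub>P.L\<^esub> ?F1 \<in> PIdl\<^bsub>P.L\<^esub> y1" using FL(2) unfolding cgenideal_def by blast
  then have "?F1 \<in> PIdl\<^bsub>P.L\<^esub> y1" by (rule y(4)[OF FL(1)])
  then obtain r where r: "r \<in> carrier P.L" "?F1 = r \<otimes>\<^bsub>P.L\<^esub> y1" unfolding cgenideal_def by blast
  have y1L: "y1 \<in> carrier P.L" unfolding p1(3) using pS p1(2) by auto
  \<comment> \<open>Since \<open>x\<^sup>f\<close> itself is not in the ring, the conclusion \<open>r = x\<^sup>f\<close> is expressed as \<open>x\<^sup>f\<^sup>+\<^sup>a = r x\<^sup>a\<close>.\<close>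
  have faS: "f + a \<in> S" using f(2)[OF a_S nonzero(1)] .
  let ?fa = "P.frac (mon (f + a)) 1"
  have mfa: "mon (f + a) \<in> carrier ?R" using faS by (simp add: carrier_semigroup_ring single_supp)
  have faL: "?fa \<in> carrier P.L" using mfa one_W by auto
  have "y1 \<otimes>\<^bsub>P.L\<^esub> ?fa = ?F1 \<otimes>\<^bsub>P.L\<^esub> ?a"
  proof -
    have "mon (f + a) = mon f * (mon a :: 'k plane_poly)" by (simp add: mult_single)
    then have E: "p1 * mon (f + a) = (mon f * p1) * mon a" by (simp only: mult_ac)
    have 1: "y1 \<otimes>\<^bsub>P.L\<^esub> ?fa = P.frac (p1 * mon (f + a)) t1"
      unfolding p1(3) using P.mult_frac[OF pS(1) p1(2) mfa one_W] by simp
    have 2: "?F1 \<otimes>\<^bsub>P.L\<^esub> ?a = P.frac ((mon f * p1) * mon a) t1"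
      using P.mult_frac[OF fp(1) p1(2) ab(1) one_W] by simp
    show ?thesis unfolding 1 2 E ..
  qed
  also have "\<dots> = y1 \<otimes>\<^bsub>P.L\<^esub> (r \<otimes>\<^bsub>P.L\<^esub> ?a)"
    unfolding r(2) using r(1) y1L abL(1) by (simp add: P.L.m_ac)
  finally have zero: "y1 \<otimes>\<^bsub>P.L\<^esub> (?fa \<ominus>\<^bsub>P.L\<^esub> r \<otimes>\<^bsub>P.L\<^esub> ?a) = \<zero>\<^bsub>P.L\<^esub>"
    using r(1) y1L abL(1) faL by (simp add: P.L.minus_eq P.L.r_distr P.L.r_minus P.L.r_neg)
  have "?fa \<ominus>\<^bsub>P.L\<^esub> r \<otimes>\<^bsub>P.L\<^esub> ?a \<in> carrier P.L"
    using r(1) abL(1) faL by (intro P.L.minus_closed P.L.m_closed)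
  from y(3)[OF this zero] have "?fa \<ominus>\<^bsub>P.L\<^esub> r \<otimes>\<^bsub>P.L\<^esub> ?a = \<zero>\<^bsub>P.L\<^esub>" .
  then have far: "?fa = r \<otimes>\<^bsub>P.L\<^esub> ?a"
    using P.L.r_right_minus_eq[OF faL P.L.m_closed[OF r(1) abL(1)]] by blast
  obtain c t where c: "c \<in> carrier ?R" "t \<in> carrier ?R - m" "r = P.frac c t"
    using r(1) by (rule P.carrier_localizationE)
  have "?fa = P.frac (c * mon a) t" using far P.mult_frac[OF c(1,2) ab(1) one_W] c(3) by simp
  then obtain u where u: "u \<in> carrier ?R - m" "u * (mon (f + a) * t) = u * (c * mon a * 1)"
    using P.frac_eq_iff[of "mon (f + a)" 1 "c * mon a" t] c(1,2) mfa ab(1) one_W mult_carrier by auto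
  have "mon (f + a) = mon a * (mon f :: 'k plane_poly)" by (simp add: mult_single add.commute)
  then have "mon a * (mon f * (u * t)) = mon a * (u * c)" using u(2) by (simp add: mult_ac)
  then have eq: "mon f * (u * t) = u * c" by (rule inj)
  \<comment> \<open>The coefficient of \<open>x\<^sup>f\<close> is the nonzero constant term of \<open>u t\<close>, yet every exponent of \<open>u c\<close> is in \<open>S\<close>.\<close>
  have "Poly_Mapping.lookup (mon f * (u * t)) (f + 0) = Poly_Mapping.lookup (u * t) 0"
    using lookup_single_mult[of f 1 "u * t" 0] by simp
  also have "\<dots> \<noteq> 0" using W_D[OF u(1)] W_D[OF c(2)] by (simp add: lookup_mult_0)
  finally have "f \<in> Poly_Mapping.keys (u * c)" by (simp add: eq in_keys_iff)
  moreover have "u * c \<in> supp_in S" using u(1) c(1) by (simp add: carrier_semigroup_ring mult_supp)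
  ultimately show False using f(1) by (auto simp: supp_in_def)
qed

end

theorem proposition3p4:
  fixes S :: "(nat \<times> nat) set" and c1 d1 c2 d2 :: nat
  assumes "affine_semigroup S"
    and "span (real_vec ` S) = UNIV"
    and "extremal_ray S (c1, d1)" and "extremal_ray S (c2, d2)"
    and "(c1, d1) \<noteq> (c2, d2)"
  shows "cohen_macaulay (semigroup_ring S :: ((nat \<times> nat) \<Rightarrow>\<^sub>0 'k::field) ring) \<longleftrightarrow>
    int (card (apery_set S {(c1, d1), (c2, d2)})) +
    int (card (int_vec ` half_open_parallelogram (c1, d1) (c2, d2) - difference_group S)) =
    \<bar>int c1 * int d2 - int c2 * int d1\<bar>"
proof -
  interpret simplicial_semigroup S "(c1, d1)" "(c2, d2)"
    using assms by (intro extremal_rays_simplicial)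
  have "cross (int_vec (c1, d1)) (int_vec (c2, d2)) = int c1 * int d2 - int c2 * int d1"
    by (simp add: cross_def mult.commute)
  then show ?thesis
    using count_iff_depth_condition depth_condition_imp_cohen_macaulay cohen_macaulay_imp_depth_condition by metis
qed

end
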